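(* Let $N\ge5$ and let $\Omega$ be a bounded open subset of $\mathbb{R}^N$ of class $C^2$. Let $\Omega_r$ and $\Omega_s$ be any two disjoint open subsets of $\Omega$ such that $\overline\Omega=\overline{\Omega_r}\cup\overline{\Omega_s}$. Then there exists $F\in L^2(\Omega)$ such that for the corresponding weak solution $u\in H_0^1(\Omega)$ of $-\Delta u=F(x)$ in $\Omega$ one has $$(\operatorname{sd}u)(a)=\begin{cases}0 & \text{for all } a\in\Omega_r,\\ N-4 & \text{for all } a\in\overline{\Omega_s}.\end{cases}$$
   Context: For a Lebesgue measurable function $u:\Omega\to\overline{\mathbb{R}}$ on an open set $\Omega\subseteq\mathbb{R}^N$, the singular set $\operatorname{Sing}u$ is the set of points $a\in\Omega$ for which there exist positive constants $C=C(a)$, $\gamma=\gamma(a)$, $r=r(a)$ such that $u(x)\ge C|x-a|^{-\gamma}$ for a.e. $x\in B_r(a)$, where $B_r(a)$ is the open ball of radius $r$ centred at $a$. For $a\in\overline\Omega$, the singular dimension of $u$ at $a$ is $$(\operatorname{sd}u)(a):=\lim_{r\to0}\dim_H\bigl(\operatorname{Sing}(u|_{B_r(a)\cap\Omega})\bigr),$$ where $\dim_H$ is the Hausdorff dimension (with $\dim_H\emptyset=0$). *)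

theory Defs
  imports "HOL-Analysis.Analysis"
begin

section \<open>Hausdorff dimension\<close>

text \<open>
  The convention is \<open>diam {} ^ s = 0\<close> and \<open>diam U ^ 0 = 1\<close> for nonempty \<open>U\<close>; the explicit case
  distinction is needed because \<open>0 powr 0 = 0\<close> in the library.
\<close>

definition diam_pow :: "real \<Rightarrow> 'a::metric_space set \<Rightarrow> real" where
  "diam_pow s U = (if U = {} then 0 else if s = 0 then 1 else diameter U powr s)"

text \<open>
  Covering sets are required to be bounded since the library's \<^const>\<open>diameter\<close> is a
  real number, unspecified on unbounded sets. The usual normalising constant is omitted: it does
  not affect the dimension.
\<close>

definition hausdorff_premeasure :: "real \<Rightarrow> real \<Rightarrow> 'a::metric_space set \<Rightarrow> ennreal" where
  "hausdorff_premeasure s \<delta> A =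
     (INF U \<in> {U :: nat \<Rightarrow> 'a set. A \<subseteq> (\<Union>n. U n) \<and> (\<forall>n. bounded (U n) \<and> diameter (U n) \<le> \<delta>)}.
        \<Sum>n. ennreal (diam_pow s (U n)))"

definition hausdorff_measure :: "real \<Rightarrow> 'a::metric_space set \<Rightarrow> ennreal" where
  "hausdorff_measure s A = (SUP \<delta>\<in>{0<..}. hausdorff_premeasure s \<delta> A)"

definition hausdorff_dim :: "'a::metric_space set \<Rightarrow> ereal" where
  "hausdorff_dim A = (INF s \<in> {s. 0 \<le> s \<and> hausdorff_measure s A = 0}. ereal s)"

lemma hausdorff_premeasure_mono:
  "A \<subseteq> B \<Longrightarrow> hausdorff_premeasure s \<delta> A \<le> hausdorff_premeasure s \<delta> B"
  unfolding hausdorff_premeasure_def by (rule INF_superset_mono) auto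

lemma hausdorff_measure_mono: "A \<subseteq> B \<Longrightarrow> hausdorff_measure s A \<le> hausdorff_measure s B"
  unfolding hausdorff_measure_def by (intro SUP_mono) (blast intro: hausdorff_premeasure_mono)

lemma hausdorff_dim_mono:
  assumes "A \<subseteq> B"
  shows "hausdorff_dim A \<le> hausdorff_dim B"
proof -
  have "hausdorff_measure s A = 0" if "hausdorff_measure s B = 0" for s
    using hausdorff_measure_mono[OF assms, of s] that by simp
  then show ?thesis
    unfolding hausdorff_dim_def by (intro INF_superset_mono) auto
qed

lemma hausdorff_dim_empty: "hausdorff_dim ({} :: 'a::metric_space set) = 0"
proof -
  have "hausdorff_premeasure 0 \<delta> ({} :: 'a set) \<le> 0" if "\<delta> > 0" for \<delta>
    unfolding hausdorff_premeasure_def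
    by (rule INF_lower2[of "\<lambda>_. {}"]) (use that in \<open>auto simp: diam_pow_def\<close>)
  then have "hausdorff_measure 0 ({} :: 'a set) = 0"
    unfolding hausdorff_measure_def by (simp add: SUP_eq_const)
  then have "hausdorff_dim ({} :: 'a set) \<le> 0"
    unfolding hausdorff_dim_def by (intro INF_lower2[of 0]) auto
  moreover have "0 \<le> hausdorff_dim ({} :: 'a set)"
    unfolding hausdorff_dim_def by (rule INF_greatest) auto
  ultimately show ?thesis by (rule antisym)
qed


section \<open>Singular set and singular dimension\<close>

text \<open>
  A function on an open set \<open>\<Omega>\<close> is represented by a function on the whole type whose values
  outside \<open>\<Omega>\<close> are never used. In particular \<open>singular_set (ball a r \<inter> \<Omega>) u\<close> is the singular set
  of the restriction of \<open>u\<close>, and the ball occurring in the definition has to lie in the domain.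
\<close>

definition singular_set :: "'a::euclidean_space set \<Rightarrow> ('a \<Rightarrow> ereal) \<Rightarrow> 'a set" where
  "singular_set \<Omega> u = {a \<in> \<Omega>. \<exists>C>0. \<exists>\<gamma>>0. \<exists>r>0. ball a r \<subseteq> \<Omega> \<and>
     (AE x in lebesgue_on (ball a r). ereal (C * norm (x - a) powr (- \<gamma>)) \<le> u x)}"

definition singular_dim :: "'a::euclidean_space set \<Rightarrow> ('a \<Rightarrow> ereal) \<Rightarrow> 'a \<Rightarrow> ereal" where
  "singular_dim \<Omega> u a =
     Lim (at_right 0) (\<lambda>r. hausdorff_dim (singular_set (ball a r \<inter> \<Omega>) u))"

lemma singular_set_mono: "U \<subseteq> V \<Longrightarrow> singular_set U u \<subseteq> singular_set V u"
  unfolding singular_set_def by blast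

lemma tendsto_singular_dim:
  "((\<lambda>r. hausdorff_dim (singular_set (ball a r \<inter> \<Omega>) u)) \<longlongrightarrow> singular_dim \<Omega> u a) (at_right 0)"
proof -
  let ?f = "\<lambda>r. hausdorff_dim (singular_set (ball a r \<inter> \<Omega>) u)"
  let ?L = "INF r\<in>{0<..}. ?f r"
  have mono: "?f r \<le> ?f r'" if "r \<le> r'" for r r'
    using that by (intro hausdorff_dim_mono singular_set_mono) auto
  have "(?f \<longlongrightarrow> ?L) (at_right 0)"
  proof (rule order_tendstoI)
    fix y assume "y < ?L"
    then have "y < ?f r" if "r > 0" for r
      using that by (meson INF_lower greaterThan_iff less_le_trans)
    then show "eventually (\<lambda>r. y < ?f r) (at_right 0)"
      by (auto simp: eventually_at_right_less eventually_at_filter)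
  next
    fix y assume "?L < y"
    then obtain r where r: "r > 0" "?f r < y"
      by (auto simp: INF_less_iff)
    then have "?f s < y" if "0 < s" "s < r" for s
      using mono[of s r] that by (meson le_less_trans less_imp_le)
    then show "eventually (\<lambda>r. ?f r < y) (at_right 0)"
      using r(1) by (auto simp: eventually_at_right_field)
  qed
  then show ?thesis
    unfolding singular_dim_def by (simp add: tendsto_Lim)
qed


section \<open>Functions of class \<open>C\<^sup>k\<close> and sets of class \<open>C\<^sup>k\<close>\<close>

primrec Ck :: "nat \<Rightarrow> ('a::euclidean_space \<Rightarrow> real) \<Rightarrow> bool" where
  "Ck 0 f \<longleftrightarrow> continuous_on UNIV f"
| "Ck (Suc k) f \<longleftrightarrow> f differentiable_on UNIV \<and>
     (\<forall>b\<in>Basis. Ck k (\<lambda>x. frechet_derivative f (at x) b))"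

text \<open>
  Near each boundary point, and up to a rigid motion, \<open>\<Omega>\<close> is the region above the graph of a \<open>C\<^sup>k\<close>
  function of \<open>N - 1\<close> variables. The unit vector \<open>e\<close> is the \<open>N\<close>-th axis of the rotated coordinate
  system, \<open>x - (x \<bullet> e) *\<^sub>R e\<close> comprises the other \<open>N - 1\<close> coordinates, and \<open>g\<close> is evaluated only on the
  hyperplane orthogonal to \<open>e\<close> (a \<open>C\<^sup>k\<close> function on that hyperplane is the restriction of a \<open>C\<^sup>k\<close>
  function on the whole space).
\<close>

definition of_class_Ck :: "nat \<Rightarrow> 'a::euclidean_space set \<Rightarrow> bool" where
  "of_class_Ck k \<Omega> \<longleftrightarrow> (\<forall>p\<in>frontier \<Omega>. \<exists>r>0. \<exists>e g. norm e = 1 \<and> Ck k g \<and>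
     \<Omega> \<inter> ball p r = {x \<in> ball p r. x \<bullet> e > g (x - (x \<bullet> e) *\<^sub>R e)})"


section \<open>Sobolev spaces and weak solutions\<close>

definition test_functions :: "'a::euclidean_space set \<Rightarrow> ('a \<Rightarrow> real) set" where
  "test_functions \<Omega> = {\<phi>. (\<forall>k. Ck k \<phi>) \<and>
     compact (closure {x. \<phi> x \<noteq> 0}) \<and> closure {x. \<phi> x \<noteq> 0} \<subseteq> \<Omega>}"

definition L2_on :: "'a::euclidean_space set \<Rightarrow> ('a \<Rightarrow> 'b::euclidean_space) set" where
  "L2_on \<Omega> = {f \<in> borel_measurable (lebesgue_on \<Omega>).
     integrable (lebesgue_on \<Omega>) (\<lambda>x. (norm (f x))\<^sup>2)}"

definition locally_integrable_on :: "('a::euclidean_space \<Rightarrow> 'b::euclidean_space) \<Rightarrow> 'a set \<Rightarrow> bool"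
    (infixr \<open>locally'_integrable'_on\<close> 46) where
  "f locally_integrable_on \<Omega> \<longleftrightarrow> (\<forall>K. compact K \<and> K \<subseteq> \<Omega> \<longrightarrow> f absolutely_integrable_on K)"

definition grad :: "('a::euclidean_space \<Rightarrow> real) \<Rightarrow> 'a \<Rightarrow> 'a" where
  "grad \<phi> x = (\<Sum>b\<in>Basis. frechet_derivative \<phi> (at x) b *\<^sub>R b)"

definition has_weak_grad :: "'a::euclidean_space set \<Rightarrow> ('a \<Rightarrow> real) \<Rightarrow> ('a \<Rightarrow> 'a) \<Rightarrow> bool" where
  "has_weak_grad \<Omega> u G \<longleftrightarrow> u locally_integrable_on \<Omega> \<and> G locally_integrable_on \<Omega> \<and>
     (\<forall>\<phi>\<in>test_functions \<Omega>.
        (LINT x|lebesgue_on \<Omega>. u x *\<^sub>R grad \<phi> x) = - (LINT x|lebesgue_on \<Omega>. \<phi> x *\<^sub>R G x))"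

text \<open>
  The weak gradient is unique up to null sets in \<open>\<Omega>\<close> and is only used under integrals over \<open>\<Omega>\<close>,
  so the choice of representative is immaterial.
\<close>

definition weak_grad :: "'a::euclidean_space set \<Rightarrow> ('a \<Rightarrow> real) \<Rightarrow> 'a \<Rightarrow> 'a" where
  "weak_grad \<Omega> u = (SOME G. has_weak_grad \<Omega> u G)"

definition H1 :: "'a::euclidean_space set \<Rightarrow> ('a \<Rightarrow> real) set" where
  "H1 \<Omega> = {u \<in> L2_on \<Omega>. \<exists>G\<in>L2_on \<Omega>. has_weak_grad \<Omega> u G}"

definition H1_norm :: "'a::euclidean_space set \<Rightarrow> ('a \<Rightarrow> real) \<Rightarrow> real" where
  "H1_norm \<Omega> u = sqrt ((LINT x|lebesgue_on \<Omega>. (u x)\<^sup>2) +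
     (LINT x|lebesgue_on \<Omega>. (norm (weak_grad \<Omega> u x))\<^sup>2))"

definition H10 :: "'a::euclidean_space set \<Rightarrow> ('a \<Rightarrow> real) set" where
  "H10 \<Omega> = {u \<in> H1 \<Omega>. \<exists>\<phi> :: nat \<Rightarrow> 'a \<Rightarrow> real. (\<forall>n. \<phi> n \<in> test_functions \<Omega>) \<and>
     (\<lambda>n. H1_norm \<Omega> (\<lambda>x. \<phi> n x - u x)) \<longlonglongrightarrow> 0}"

definition weak_solution :: "'a::euclidean_space set \<Rightarrow> ('a \<Rightarrow> real) \<Rightarrow> ('a \<Rightarrow> real) \<Rightarrow> bool" where
  "weak_solution \<Omega> F u \<longleftrightarrow> u \<in> H10 \<Omega> \<and>
     (\<forall>v\<in>H10 \<Omega>. (LINT x|lebesgue_on \<Omega>. weak_grad \<Omega> u x \<bullet> weak_grad \<Omega> v x) =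
                 (LINT x|lebesgue_on \<Omega>. F x * v x))"

end

theory Submission
  imports Defs
begin

text \<open>
  The solution is written down first and the right-hand side read off from it: \<open>u = (\<Sum>i. \<phi> i)\<close> with nonnegative
  test functions \<open>\<phi> i\<close> supported in \<open>\<Omega>\<^sub>s\<close> such that the \<open>L\<^sup>2\<close> norms of \<open>\<phi> i\<close> and of its Laplacian are
  summable. The partial sums are test functions, so \<open>u\<close> is a weak solution for \<open>F = - (\<Sum>i. \<Delta> \<phi> i)\<close> without any
  existence or regularity theory, and it vanishes on \<open>\<Omega>\<^sub>r\<close>.

  The building block near a point \<open>q\<close> is \<open>\<Sum>n. l powr (- n * \<gamma>) * w n\<close>, where \<open>w n\<close> is a smooth bump of height of order
  1 on the \<open>l ^ n\<close>-neighbourhood of a self-similar Cantor dust of dimension \<open>s < N - 4\<close>. The squared \<open>L\<^sup>2\<close> norm of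
  \<open>\<Delta> (w n)\<close> is of order \<open>l powr (n * (N - 4 - s))\<close>, so that a small \<open>\<gamma> > 0\<close> is affordable, and the sum is
  at least of order \<open>dist (x, a) powr (- \<gamma>)\<close> near every point \<open>a\<close> of the dust. Blocks with \<open>s\<close> tending to
  \<open>N - 4\<close> are placed in rapidly shrinking balls around a dense sequence of points of \<open>\<Omega>\<^sub>s\<close>.

  Conversely, a point outside the dusts that is far, relative to their radii, from all but finitely many of the
  balls is not singular: finitely many blocks are bounded near it, and the other balls fill at most half of
  any ball around it. The exceptional points form a limsup of rapidly shrinking balls.
\<close>

section \<open>Functions of class \<open>C\<^sup>k\<close>\<close>

text \<open>The number N - 4 comes from a count. Stage n of a dust consists of
  \<open>2 ^ (N * n)\<close> = \<open>l powr (- s * n)\<close> bumps, each of volume of order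
  \<open>l ^ (N * n)\<close>, and two derivatives, squared, cost \<open>l powr (- 4 * n)\<close>.
  What remains is \<open>l powr (n * (N - 4 - s))\<close>, so s has to stay strictly below N - 4.
  The dimension N - 4 is therefore a supremum over infinitely many blocks that none of them attains,
  and the singular set itself has Hausdorff measure zero in dimension N - 4. The obstacle is the
  upper bound: blocks accumulate at every point of the closure, so the sum is unbounded on every
  ball there. A point is shown not to be singular by finding a set of positive measure, arbitrarily
  close to it, on which only finitely many terms survive; this contradicts a lower bound that holds
  almost everywhere. The condition \<open>l < 1 / 2\<close> acts twice: it keeps the supports of the
  children disjoint, so that squared norms add without cross terms, and it leaves the gaps that make
  the inverse of the Cantor map Hoelder continuous. A weak solution is determined only up to null
  sets, so a uniqueness proof is still required to reach every representative.\<close>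

lemma Ck_SucI:
  assumes "\<And>x. (f has_derivative f' x) (at x)" "\<And>b. b \<in> Basis \<Longrightarrow> Ck k (\<lambda>x. f' x b)"
  shows "Ck (Suc k) f"
proof -
  have "frechet_derivative f (at x) = f' x" for x
    using frechet_derivative_at[OF assms(1)] by simp
  then show ?thesis
    using assms by (auto simp: differentiable_on_def differentiable_def)
qed

lemma Ck_Suc_has_derivative:
  "Ck (Suc k) f \<Longrightarrow> (f has_derivative frechet_derivative f (at x)) (at x)"
  by (auto simp: differentiable_on_def frechet_derivative_works)

lemma Ck_SucD: "Ck (Suc k) f \<Longrightarrow> Ck k f"
proof (induction k arbitrary: f)
  case 0
  then show ?case by (auto intro: differentiable_imp_continuous_on)
next
  case (Suc k)
  then show ?case by (metis Ck.simps(2))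
qed

lemma Ck_continuous_on: "Ck k f \<Longrightarrow> continuous_on UNIV f"
  by (induction k) (auto intro: differentiable_imp_continuous_on)

lemma Ck_const: "Ck k (\<lambda>x. c)"
proof (induction k arbitrary: c)
  case (Suc k)
  show ?case
    by (rule Ck_SucI[where f' = "\<lambda>_ _. 0"]) (auto intro: Suc)
qed auto

lemma Ck_inner: "Ck k (\<lambda>x. x \<bullet> c)"
proof (cases k)
  case (Suc n)
  then show ?thesis
    by (auto intro!: Ck_SucI[where f' = "\<lambda>_ h. h \<bullet> c"] Ck_const derivative_eq_intros simp del: Ck.simps)
qed (auto intro!: continuous_intros)

lemma Ck_add: "Ck k f \<Longrightarrow> Ck k g \<Longrightarrow> Ck k (\<lambda>x. f x + g x)"
proof (induction k arbitrary: f g)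
  case (Suc k)
  show ?case
  proof (rule Ck_SucI)
    show "((\<lambda>x. f x + g x) has_derivative (\<lambda>h. frechet_derivative f (at x) h + frechet_derivative g (at x) h)) (at x)" for x
      by (intro derivative_intros Ck_Suc_has_derivative[OF Suc.prems(1)] Ck_Suc_has_derivative[OF Suc.prems(2)])
    show "Ck k (\<lambda>x. frechet_derivative f (at x) b + frechet_derivative g (at x) b)" if "b \<in> Basis" for b
      using that Suc by auto
  qed
qed (auto intro: continuous_intros)

lemma Ck_mult: "Ck k f \<Longrightarrow> Ck k g \<Longrightarrow> Ck k (\<lambda>x. f x * g x)"
proof (induction k arbitrary: f g)
  case (Suc k)
  show ?case
  proof (rule Ck_SucI)
    show "((\<lambda>x. f x * g x) has_derivative (\<lambda>h. f x * frechet_derivative g (at x) h + frechet_derivative f (at x) h * g x)) (at x)" for x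
      by (intro derivative_intros Ck_Suc_has_derivative[OF Suc.prems(1)] Ck_Suc_has_derivative[OF Suc.prems(2)])
    show "Ck k (\<lambda>x. f x * frechet_derivative g (at x) b + frechet_derivative f (at x) b * g x)" if "b \<in> Basis" for b
      using that Suc.prems Ck_SucD[of k f] Ck_SucD[of k g] by (intro Ck_add Suc.IH) auto
  qed
qed (auto intro: continuous_intros)

text \<open>The outer function lives on the reals, where a linear map is multiplication by its value
  at 1. The derivative of the composition is thus a product of a composition and a derivative, and
  the induction runs with both functions generalised.\<close>

lemma Ck_compose:
  fixes h :: "real \<Rightarrow> real"
  shows "Ck k h \<Longrightarrow> Ck k f \<Longrightarrow> Ck k (\<lambda>x. h (f x))"
proof (induction k arbitrary: f h)
  case 0
  then show ?case by (auto intro: continuous_on_compose2)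
next
  case (Suc k)
  show ?case
  proof (rule Ck_SucI)
    show "((\<lambda>x. h (f x)) has_derivative (\<lambda>e. frechet_derivative h (at (f x)) 1 * frechet_derivative f (at x) e)) (at x)" for x
    proof -
      have "linear (frechet_derivative h (at (f x)))"
        using Ck_Suc_has_derivative[OF Suc.prems(1)] has_derivative_linear by blast
      then have *: "frechet_derivative h (at (f x)) t = frechet_derivative h (at (f x)) 1 * t" for t
        using linear_cmul[of "frechet_derivative h (at (f x))" t 1] by simp
      have "(\<lambda>e. frechet_derivative h (at (f x)) (frechet_derivative f (at x) e)) =
          (\<lambda>e. frechet_derivative h (at (f x)) 1 * frechet_derivative f (at x) e)"
        by (rule ext, rule *)
      with has_derivative_compose[OF Ck_Suc_has_derivative[OF Suc.prems(2)] Ck_Suc_has_derivative[OF Suc.prems(1)]]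
      show ?thesis by metis
    qed
    show "Ck k (\<lambda>x. frechet_derivative h (at (f x)) 1 * frechet_derivative f (at x) b)" if "b \<in> Basis" for b
      using that Suc.prems Ck_SucD[of k f] by (intro Ck_mult Suc.IH[of "\<lambda>y. frechet_derivative h (at y) 1"]) auto
  qed
qed

lemma Ck_cmult: "Ck k f \<Longrightarrow> Ck k (\<lambda>x. c * f x)"
  by (intro Ck_mult Ck_const)

lemma Ck_diff: "Ck k f \<Longrightarrow> Ck k g \<Longrightarrow> Ck k (\<lambda>x. f x - g x)"
  using Ck_add[OF _ Ck_cmult[of k g "-1"], of f] by simp

lemma Ck_sum: "(\<And>i. i \<in> I \<Longrightarrow> Ck k (f i)) \<Longrightarrow> Ck k (\<lambda>x. \<Sum>i\<in>I. f i x)"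
  by (induction I rule: infinite_finite_induct) (auto intro: Ck_const Ck_add simp del: Ck.simps)

lemma Ck_prod: "(\<And>i. i \<in> I \<Longrightarrow> Ck k (f i)) \<Longrightarrow> Ck k (\<lambda>x. \<Prod>i\<in>I. f i x)"
  by (induction I rule: infinite_finite_induct) (auto intro: Ck_const Ck_mult simp del: Ck.simps)

lemma frechet_derivative_affine:
  assumes "Ck (Suc k) f"
  shows "frechet_derivative (\<lambda>x. f (c *\<^sub>R x + d)) (at x) = (\<lambda>h. c * frechet_derivative f (at (c *\<^sub>R x + d)) h)"
proof -
  have lin: "linear (frechet_derivative f (at (c *\<^sub>R x + d)))"
    using Ck_Suc_has_derivative[OF assms] has_derivative_linear by blast
  have "((\<lambda>x. c *\<^sub>R x + d) has_derivative (\<lambda>h. c *\<^sub>R h)) (at x)"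
    by (auto intro!: derivative_eq_intros)
  from has_derivative_compose[OF this Ck_Suc_has_derivative[OF assms]]
  have "((\<lambda>x. f (c *\<^sub>R x + d)) has_derivative (\<lambda>h. c * frechet_derivative f (at (c *\<^sub>R x + d)) h)) (at x)"
    using lin by (simp add: linear_cmul)
  then show ?thesis by (rule frechet_derivative_at[symmetric])
qed

lemma Ck_affine: "Ck k f \<Longrightarrow> Ck k (\<lambda>x. f (c *\<^sub>R x + d))"
proof (induction k arbitrary: f)
  case 0
  then show ?case by (auto intro!: continuous_on_compose2[of UNIV f] continuous_intros)
next
  case (Suc k)
  have "((\<lambda>x. f (c *\<^sub>R x + d)) differentiable at x)" for x
    using Suc.prems by (intro differentiable_compose[of f "\<lambda>x. c *\<^sub>R x + d"])
      (auto simp: differentiable_on_def)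
  then show ?case
    using Suc.prems Suc.IH[of "\<lambda>y. frechet_derivative f (at y) b" for b]
      frechet_derivative_affine[OF Suc.prems, of c d]
    by (auto simp: differentiable_on_def intro!: Ck_cmult)
qed

text \<open>\<open>flat m\<close> is closed under differentiation up to linear combinations, which gives smoothness of
  \<open>flat 0\<close>.\<close>

definition flat :: "nat \<Rightarrow> real \<Rightarrow> real" where
  "flat m t = (if t > 0 then exp (- (1 / t)) / t ^ m else 0)"

lemma flat_nonneg: "0 \<le> flat m t"
  by (simp add: flat_def)

lemma flat_pos: "0 < t \<Longrightarrow> 0 < flat m t"
  by (simp add: flat_def)

lemma flat_0_le_1: "flat 0 t \<le> 1"
  by (simp add: flat_def)

lemma flat_eq_0: "t \<le> 0 \<Longrightarrow> flat m t = 0"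
  by (simp add: flat_def)

text \<open>Substituting 1 / t turns this into the fact that the exponential beats every
  power.\<close>

lemma flat_tendsto_0: "(flat m \<longlongrightarrow> 0) (at 0)"
proof -
  have "((\<lambda>t. inverse t ^ m / exp (inverse t)) \<longlongrightarrow> (0::real)) (at_right 0)"
    by (rule filterlim_compose[OF tendsto_power_div_exp_0 filterlim_inverse_at_top_right])
  moreover have "eventually (\<lambda>t. inverse t ^ m / exp (inverse t) = flat m t) (at_right 0)"
    by (auto simp: eventually_at_filter flat_def exp_minus field_simps)
  ultimately have "(flat m \<longlongrightarrow> 0) (at_right 0)"
    by (rule Lim_transform_eventually)
  moreover have "(flat m \<longlongrightarrow> 0) (at_left 0)"
    by (rule Lim_transform_eventually[OF tendsto_const]) (auto simp: eventually_at_filter flat_def)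
  ultimately show ?thesis
    by (simp add: filterlim_at_split)
qed

lemma flat_has_real_derivative:
  "(flat m has_real_derivative (flat (m + 2) t - m * flat (m + 1) t)) (at t)"
proof -
  consider "t < 0" | "t = 0" | "t > 0" by linarith
  then show ?thesis
  proof cases
    case 1
    have "((\<lambda>t. 0) has_real_derivative (flat (m + 2) t - m * flat (m + 1) t)) (at t)"
      using 1 by (simp add: flat_def)
    then show ?thesis
      by (rule has_field_derivative_transform_within_open[where S="{..<0}"]) (use 1 in \<open>auto simp: flat_def\<close>)
  next
    case 2
    \<comment> \<open>At 0 the difference quotient of \<open>flat m\<close> is
      \<open>flat (m + 1)\<close>, on both sides of 0.\<close>
    have "((\<lambda>h. flat m h / h) \<longlongrightarrow> 0) (at 0)"
      by (rule Lim_transform_eventually[OF flat_tendsto_0[of "m + 1"]])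
        (auto simp: eventually_at_filter flat_def)
    then show ?thesis
      by (simp add: 2 DERIV_def flat_def)
  next
    case 3
    have e: "((\<lambda>t. exp (- (1 / t))) has_real_derivative exp (- (1 / t)) / t\<^sup>2) (at t)"
      using 3 by (auto intro!: derivative_eq_intros simp: power2_eq_square)
    have "((\<lambda>t. exp (- (1 / t)) / t ^ m) has_real_derivative
        (exp (- (1 / t)) / t\<^sup>2 * t ^ m - exp (- (1 / t)) * (m * t ^ (m - Suc 0))) / (t ^ m * t ^ m)) (at t)"
      by (rule DERIV_divide[OF e DERIV_pow]) (use 3 in auto)
    also have "(exp (- (1 / t)) / t\<^sup>2 * t ^ m - exp (- (1 / t)) * (m * t ^ (m - Suc 0))) / (t ^ m * t ^ m) =
        flat (m + 2) t - m * flat (m + 1) t"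
      using 3 by (cases m) (auto simp: flat_def field_simps power2_eq_square)
    finally have "((\<lambda>t. exp (- (1 / t)) / t ^ m) has_real_derivative (flat (m + 2) t - m * flat (m + 1) t)) (at t)" .
    then show ?thesis
      by (rule has_field_derivative_transform_within_open[where S="{0<..}"]) (use 3 in \<open>auto simp: flat_def\<close>)
  qed
qed

lemma Ck_flat: "Ck k (flat m)"
proof (induction k arbitrary: m)
  case 0
  show ?case
    using flat_has_real_derivative by (auto intro!: continuous_at_imp_continuous_on DERIV_isCont)
next
  case (Suc k)
  show ?case
  proof (rule Ck_SucI)
    show "(flat m has_derivative (\<lambda>h. (flat (m + 2) t - m * flat (m + 1) t) * h)) (at t)" for t
      using flat_has_real_derivative by (simp add: has_field_derivative_def)
    show "Ck k (\<lambda>t. (flat (m + 2) t - m * flat (m + 1) t) * b)" for b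
      by (intro Ck_mult Ck_diff Ck_const Suc)
  qed
qed

section \<open>Integration by parts\<close>

abbreviation pd :: "'a::euclidean_space \<Rightarrow> ('a \<Rightarrow> real) \<Rightarrow> 'a \<Rightarrow> real" where
  "pd b f \<equiv> (\<lambda>x. frechet_derivative f (at x) b)"

lemma Ck_pd: "Ck (Suc k) f \<Longrightarrow> b \<in> Basis \<Longrightarrow> Ck k (pd b f)"
  by simp

lemma pd_mult:
  assumes "Ck (Suc k) f" "Ck (Suc k) g"
  shows "pd b (\<lambda>x. f x * g x) = (\<lambda>x. f x * pd b g x + pd b f x * g x)"
proof
  fix x
  have "((\<lambda>x. f x * g x) has_derivative (\<lambda>h. f x * frechet_derivative g (at x) h + frechet_derivative f (at x) h * g x)) (at x)"
    by (intro derivative_intros Ck_Suc_has_derivative[OF assms(1)] Ck_Suc_has_derivative[OF assms(2)])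
  from frechet_derivative_at[OF this]
  show "pd b (\<lambda>x. f x * g x) x = f x * pd b g x + pd b f x * g x" by metis
qed

lemma pd_add:
  assumes "Ck (Suc k) f" "Ck (Suc k) g"
  shows "pd b (\<lambda>x. f x + g x) = (\<lambda>x. pd b f x + pd b g x)"
proof
  fix x
  have "((\<lambda>x. f x + g x) has_derivative (\<lambda>h. frechet_derivative f (at x) h + frechet_derivative g (at x) h)) (at x)"
    by (intro derivative_intros Ck_Suc_has_derivative[OF assms(1)] Ck_Suc_has_derivative[OF assms(2)])
  from frechet_derivative_at[OF this]
  show "pd b (\<lambda>x. f x + g x) x = pd b f x + pd b g x" by metis
qed

lemma pd_const: "pd b (\<lambda>x. c) = (\<lambda>x. 0)"
  by (simp add: frechet_derivative_const)

lemma pd_cmult: "Ck (Suc k) f \<Longrightarrow> pd b (\<lambda>x. c * f x) = (\<lambda>x. c * pd b f x)"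
  by (subst pd_mult[where k=k]) (auto intro: Ck_const simp: pd_const simp del: Ck.simps)

lemma pd_sum:
  "(\<And>i. i \<in> I \<Longrightarrow> Ck (Suc k) (f i)) \<Longrightarrow> pd b (\<lambda>x. \<Sum>i\<in>I. f i x) = (\<lambda>x. \<Sum>i\<in>I. pd b (f i) x)"
proof (induction I rule: infinite_finite_induct)
  case (insert i I)
  then have "pd b (\<lambda>x. \<Sum>i\<in>I. f i x) = (\<lambda>x. \<Sum>i\<in>I. pd b (f i) x)"
    by blast
  with insert show ?case
    by (simp add: pd_add[where k=k] Ck_sum fun_eq_iff del: Ck.simps)
qed (simp_all add: pd_const)

lemma pd_inner: "pd b (\<lambda>x. x \<bullet> c) = (\<lambda>x. b \<bullet> c)"
proof
  fix x
  have "((\<lambda>x. x \<bullet> c) has_derivative (\<lambda>h. h \<bullet> c)) (at x)"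
    by (auto intro!: derivative_eq_intros)
  from frechet_derivative_at[OF this] show "pd b (\<lambda>x. x \<bullet> c) x = b \<bullet> c" by metis
qed

lemma pd_eq_0_outside_closure:
  assumes "x \<notin> closure {x. f x \<noteq> 0}"
  shows "pd b f x = 0"
proof -
  have "((\<lambda>x. 0) has_derivative (\<lambda>h. 0)) (at x)" by simp
  then have "(f has_derivative (\<lambda>h. 0)) (at x)"
    by (rule has_derivative_transform_within_open[where s="- closure {x. f x \<noteq> 0}"])
      (use assms closure_subset[of "{x. f x \<noteq> 0}"] in auto)
  from frechet_derivative_at[OF this] show ?thesis by metis
qed

lemma support_pd: "{x. pd b f x \<noteq> 0} \<subseteq> closure {x. f x \<noteq> 0}"
  using pd_eq_0_outside_closure by blast

lemma bounded_support_pd: "bounded {x. f x \<noteq> 0} \<Longrightarrow> bounded {x. pd b f x \<noteq> 0}"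
  by (rule bounded_subset[OF bounded_closure support_pd])

lemma integrable_bounded_support:
  fixes f :: "'a::euclidean_space \<Rightarrow> 'b::euclidean_space"
  assumes "continuous_on UNIV f" "bounded {x. f x \<noteq> 0}"
  shows "integrable lebesgue f"
proof -
  obtain a where a: "{x. f x \<noteq> 0} \<subseteq> cbox (-a) a"
    using bounded_subset_cbox_symmetric[OF assms(2)] by blast
  have "f absolutely_integrable_on cbox (-a) a"
    using assms(1) by (intro absolutely_integrable_continuous) (auto intro: continuous_on_subset)
  moreover have "(\<lambda>x. indicat_real (cbox (-a) a) x *\<^sub>R f x) = f"
    using a by (fastforce simp: indicator_def)
  ultimately show ?thesis by (simp add: set_integrable_def)
qed

lemma integral_translation:
  fixes f :: "'a::euclidean_space \<Rightarrow> real"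
  assumes "continuous_on UNIV f"
  shows "(LINT x|lebesgue. f (x + c)) = (LINT x|lebesgue. f x)"
proof -
  have [measurable]: "f \<in> borel_measurable borel"
    using assms by (simp add: borel_measurable_continuous_onI)
  have "(LINT x|lborel. f x) = (LINT x|distr lborel borel ((+) c). f x)"
    by (simp add: lborel_distr_plus)
  also have "\<dots> = (LINT x|lborel. f (c + x))"
    by (subst integral_distr) auto
  finally show ?thesis
    by (subst (1 2) integral_completion) (auto simp: add.commute)
qed

lemma bounded_support_bound:
  fixes f :: "'a::euclidean_space \<Rightarrow> real"
  assumes "continuous_on UNIV f" "bounded {x. f x \<noteq> 0}"
  obtains M where "M > 0" "\<And>x. \<bar>f x\<bar> \<le> M"
proof -
  have "compact (f ` closure {x. f x \<noteq> 0})"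
    using assms by (intro compact_continuous_image) (auto intro: continuous_on_subset simp: compact_closure)
  then obtain M where M: "\<And>x. x \<in> closure {x. f x \<noteq> 0} \<Longrightarrow> \<bar>f x\<bar> \<le> M" "M > 0"
    by (force dest!: compact_imp_bounded simp: bounded_pos)
  have "\<bar>f x\<bar> \<le> M" for x
    using M closure_subset[of "{x. f x \<noteq> 0}"] by (cases "f x = 0") auto
  then show ?thesis using that M(2) by blast
qed

lemma line_has_real_derivative:
  assumes "Ck (Suc k) f"
  shows "((\<lambda>t. f (x + t *\<^sub>R b)) has_real_derivative pd b f (x + t *\<^sub>R b)) (at t)"
proof -
  have lin: "linear (frechet_derivative f (at (x + t *\<^sub>R b)))"
    using Ck_Suc_has_derivative[OF assms] has_derivative_linear by blast
  have "((\<lambda>t. x + t *\<^sub>R b) has_derivative (\<lambda>h. h *\<^sub>R b)) (at t)"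
    by (auto intro!: derivative_eq_intros)
  from has_derivative_compose[OF this Ck_Suc_has_derivative[OF assms]]
  show ?thesis
    using lin by (simp add: has_field_derivative_def linear_cmul mult.commute[of "pd b f _"] mult_commute_abs)
qed

text \<open>The integral of \<open>x \<mapsto> f (x + t *\<^sub>R b)\<close> does not depend on \<open>t\<close>; differentiate at \<open>t = 0\<close>.\<close>

lemma integral_pd_eq_0:
  assumes f: "Ck 1 f" "bounded {x. f x \<noteq> 0}" and b: "b \<in> Basis"
  shows "(LINT x|lebesgue. pd b f x) = 0"
proof -
  define s where "s n = 1 / real (Suc n)" for n
  define D where "D n x = (f (x + s n *\<^sub>R b) - f x) / s n" for n x
  have f1: "Ck (Suc 0) f" using f by simp
  have cf: "continuous_on UNIV f" by (rule Ck_continuous_on[OF f(1)])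
  have cpd: "continuous_on UNIV (pd b f)"
    using Ck_continuous_on[OF Ck_pd[OF f1 b]] .
  obtain M where M: "M > 0" "\<And>x. \<bar>pd b f x\<bar> \<le> M"
    using bounded_support_bound[OF cpd bounded_support_pd[OF f(2)]] by blast
  obtain R where R: "\<And>x. f x \<noteq> 0 \<Longrightarrow> norm x \<le> R"
    using f(2) by (auto simp: bounded_iff)
  have s: "0 < s n" "s n \<le> 1" for n by (auto simp: s_def)
  have bn: "norm b = 1" using b by simp
  \<comment> \<open>The mean value theorem bounds the quotient by the derivative. The ball exceeds
    the support by 1 because the shifts \<open>s n\<close> are at most 1.\<close>
  have Dbound: "norm (D n x) \<le> M * indicator (cball 0 (R + 1)) x" for n x
  proof (cases "x \<in> cball 0 (R + 1)")
    case True
    have "\<exists>z>0. z < s n \<and> f (x + s n *\<^sub>R b) - f (x + 0 *\<^sub>R b) = (s n - 0) * pd b f (x + z *\<^sub>R b)"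
      by (rule MVT2[OF s(1)]) (rule line_has_real_derivative[OF f1])
    then obtain z where "f (x + s n *\<^sub>R b) - f x = s n * pd b f (x + z *\<^sub>R b)" by auto
    then have "D n x = pd b f (x + z *\<^sub>R b)"
      using s(1)[of n] by (simp add: D_def)
    then show ?thesis using True M(2) by simp
  next
    case False
    have "norm x \<le> norm (x + s n *\<^sub>R b) + norm (s n *\<^sub>R b)"
      by (metis add_diff_cancel_right' norm_triangle_ineq4)
    then have "norm x \<le> norm (x + s n *\<^sub>R b) + 1"
      using s[of n] bn by simp
    then have "f x = 0" "f (x + s n *\<^sub>R b) = 0"
      using False R[of x] R[of "x + s n *\<^sub>R b"] by force+
    then show ?thesis using M(1) by (simp add: D_def)
  qed
  have s0: "s \<longlonglongrightarrow> 0" unfolding s_def by (rule LIMSEQ_Suc[OF lim_1_over_n])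
  then have s_at: "filterlim s (at 0) sequentially"
    using s(1) by (intro filterlim_atI) (auto intro!: always_eventually simp: less_imp_neq[symmetric])
  have lim: "(\<lambda>n. D n x) \<longlonglongrightarrow> pd b f x" for x
  proof -
    have "(\<lambda>h. (f (x + h *\<^sub>R b) - f x) / h) \<midarrow>0\<rightarrow> pd b f x"
      using line_has_real_derivative[OF f1, of x b 0] by (simp add: DERIV_def)
    from filterlim_compose[OF this s_at] show ?thesis by (simp add: D_def)
  qed
  have shift: "continuous_on UNIV (\<lambda>x. f (x + s n *\<^sub>R b))" for n
    by (intro continuous_on_compose2[OF cf] continuous_intros) auto
  have int_f: "integrable lebesgue f"
    by (rule integrable_bounded_support[OF cf f(2)])
  have int_fs: "integrable lebesgue (\<lambda>x. f (x + s n *\<^sub>R b))" for n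
  proof (rule integrable_bounded_support[OF shift])
    have "{x. f (x + s n *\<^sub>R b) \<noteq> 0} \<subseteq> (\<lambda>x. (- (s n *\<^sub>R b)) + x) ` {x. f x \<noteq> 0}"
      by (auto simp: image_iff intro!: exI[of _ "_ + s n *\<^sub>R b"])
    then show "bounded {x. f (x + s n *\<^sub>R b) \<noteq> 0}"
      by (rule bounded_subset[rotated]) (rule bounded_translation[OF f(2)])
  qed
  have D0: "(LINT x|lebesgue. D n x) = 0" for n
    unfolding D_def using int_f int_fs integral_translation[OF cf] by simp
  have "(\<lambda>n. LINT x|lebesgue. D n x) \<longlonglongrightarrow> (LINT x|lebesgue. pd b f x)"
  proof (rule integral_dominated_convergence)
    show "pd b f \<in> borel_measurable lebesgue"
      using integrable_bounded_support[OF cpd bounded_support_pd[OF f(2)]] by (rule borel_measurable_integrable)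
    show "D n \<in> borel_measurable lebesgue" for n
      unfolding D_def using int_f int_fs by (auto dest!: borel_measurable_integrable)
    show "integrable lebesgue (\<lambda>x. M * indicator (cball 0 (R + 1)) x)"
      using emeasure_bounded_finite[OF bounded_cball, of 0 "R + 1"] by (auto intro!: integrable_real_indicator)
    show "AE x in lebesgue. (\<lambda>n. D n x) \<longlonglongrightarrow> pd b f x" using lim by simp
    show "AE x in lebesgue. norm (D n x) \<le> M * indicator (cball 0 (R + 1)) x" for n using Dbound by simp
  qed
  then show ?thesis by (simp add: D0 LIMSEQ_const_iff)
qed

lemma integrable_mult_bounded_support:
  fixes f g :: "'a::euclidean_space \<Rightarrow> real"
  assumes "continuous_on UNIV f" "continuous_on UNIV g" "bounded {x. f x \<noteq> 0}"
  shows "integrable lebesgue (\<lambda>x. f x * g x)"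
  using assms by (intro integrable_bounded_support continuous_intros) (auto elim: bounded_subset)

text \<open>The product inherits bounded support from \<open>f\<close>, so its derivative integrates
  to 0. Leaving the support of \<open>g\<close> free allows \<open>g\<close> to be a coordinate
  function, as in \<open>poincare_inequality\<close>.\<close>

lemma integration_by_parts:
  assumes f: "Ck 1 f" "bounded {x. f x \<noteq> 0}" and g: "Ck 1 g" and b: "b \<in> Basis"
  shows "(LINT x|lebesgue. f x * pd b g x) = - (LINT x|lebesgue. pd b f x * g x)"
proof -
  have f1: "Ck (Suc 0) f" and g1: "Ck (Suc 0) g" using f g by auto
  have "0 = (LINT x|lebesgue. pd b (\<lambda>x. f x * g x) x)"
    by (rule integral_pd_eq_0[symmetric])
      (use f g b in \<open>auto intro!: Ck_mult elim!: bounded_subset simp del: Ck.simps\<close>)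
  also have "\<dots> = (LINT x|lebesgue. f x * pd b g x + pd b f x * g x)"
    by (subst pd_mult[OF f1 g1]) simp
  also have "\<dots> = (LINT x|lebesgue. f x * pd b g x) + (LINT x|lebesgue. pd b f x * g x)"
    using Ck_continuous_on[OF f1] Ck_continuous_on[OF g1] Ck_continuous_on[OF Ck_pd[OF f1 b]]
      Ck_continuous_on[OF Ck_pd[OF g1 b]] f(2) bounded_support_pd[OF f(2)]
    by (intro Bochner_Integration.integral_add integrable_mult_bounded_support)
  finally show ?thesis by simp
qed

section \<open>Test functions and the fundamental lemma\<close>

lemma test_functionsI:
  assumes "\<And>k. Ck k \<phi>" "compact K" "{x. \<phi> x \<noteq> 0} \<subseteq> K" "K \<subseteq> \<Omega>"
  shows "\<phi> \<in> test_functions \<Omega>"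
proof -
  have "closure {x. \<phi> x \<noteq> 0} \<subseteq> K"
    using assms by (simp add: closure_minimal compact_imp_closed)
  then show ?thesis
    using assms compact_Int_closed[of K "closure {x. \<phi> x \<noteq> 0}"]
    by (auto simp: test_functions_def Int_absorb1)
qed

lemma test_functionsD:
  assumes "\<phi> \<in> test_functions \<Omega>"
  shows "Ck k \<phi>" "compact (closure {x. \<phi> x \<noteq> 0})" "bounded {x. \<phi> x \<noteq> 0}" "closure {x. \<phi> x \<noteq> 0} \<subseteq> \<Omega>"
    "x \<notin> \<Omega> \<Longrightarrow> \<phi> x = 0" "continuous_on UNIV \<phi>"
  using assms closure_subset[of "{x. \<phi> x \<noteq> 0}"] Ck_continuous_on[of 0 \<phi>]
  by (auto simp: test_functions_def intro: bounded_subset[OF compact_imp_bounded] simp del: Ck.simps)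

lemma test_functions_pd:
  assumes "\<phi> \<in> test_functions \<Omega>" "b \<in> Basis"
  shows "pd b \<phi> \<in> test_functions \<Omega>"
  by (rule test_functionsI[of _ "closure {x. \<phi> x \<noteq> 0}"])
    (use test_functionsD[OF assms(1)] assms(2) support_pd[of \<phi> b] in \<open>auto intro!: Ck_pd simp del: Ck.simps\<close>)

lemma test_functions_0: "(\<lambda>x. 0) \<in> test_functions \<Omega>"
  by (rule test_functionsI[of _ "{}"]) (auto intro: Ck_const simp del: Ck.simps)

lemma test_functions_add:
  assumes "\<phi> \<in> test_functions \<Omega>" "\<psi> \<in> test_functions \<Omega>"
  shows "(\<lambda>x. \<phi> x + \<psi> x) \<in> test_functions \<Omega>"
proof (rule test_functionsI)
  show "{x. \<phi> x + \<psi> x \<noteq> 0} \<subseteq> closure {x. \<phi> x \<noteq> 0} \<union> closure {x. \<psi> x \<noteq> 0}"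
    using closure_subset[of "{x. \<phi> x \<noteq> 0}"] closure_subset[of "{x. \<psi> x \<noteq> 0}"] by force
qed (use test_functionsD[OF assms(1)] test_functionsD[OF assms(2)] in \<open>auto intro!: Ck_add simp del: Ck.simps\<close>)

lemma test_functions_cmult:
  assumes "\<phi> \<in> test_functions \<Omega>"
  shows "(\<lambda>x. c * \<phi> x) \<in> test_functions \<Omega>"
  by (rule test_functionsI[of _ "closure {x. \<phi> x \<noteq> 0}"])
    (use test_functionsD[OF assms] closure_subset[of "{x. \<phi> x \<noteq> 0}"] in \<open>auto intro!: Ck_cmult simp del: Ck.simps\<close>)

lemma test_functions_sum:
  "(\<And>i. i \<in> I \<Longrightarrow> \<phi> i \<in> test_functions \<Omega>) \<Longrightarrow> (\<lambda>x. \<Sum>i\<in>I. \<phi> i x) \<in> test_functions \<Omega>"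
  by (induction I rule: infinite_finite_induct) (auto intro: test_functions_0 test_functions_add)

lemma test_functions_diff:
  assumes "\<phi> \<in> test_functions \<Omega>" "\<psi> \<in> test_functions \<Omega>"
  shows "(\<lambda>x. \<phi> x - \<psi> x) \<in> test_functions \<Omega>"
  using test_functions_add[OF assms(1) test_functions_cmult[OF assms(2), of "-1"]] by simp

text \<open>Test functions and their derivatives vanish outside the domain, so their integrals can
  be moved to the whole space, where translations and dilations are available.\<close>

lemma
  fixes f :: "'a::euclidean_space \<Rightarrow> 'b::euclidean_space"
  assumes "S \<in> sets lebesgue" "\<And>x. x \<notin> S \<Longrightarrow> f x = 0"
  shows integral_lebesgue_on_vanishing: "(LINT x|lebesgue_on S. f x) = (LINT x|lebesgue. f x)"
    and integrable_lebesgue_on_vanishing: "integrable (lebesgue_on S) f \<longleftrightarrow> integrable lebesgue f"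
proof -
  have "(\<lambda>x. indicat_real S x *\<^sub>R f x) = f"
    using assms(2) by (auto simp: indicator_def)
  then show "(LINT x|lebesgue_on S. f x) = (LINT x|lebesgue. f x)"
    "integrable (lebesgue_on S) f \<longleftrightarrow> integrable lebesgue f"
    using assms(1) by (simp_all add: integral_restrict_space integrable_restrict_space)
qed

section \<open>From test functions to null functions: the fundamental lemma of the calculus of
  variations\<close>

lemma flat_0_tendsto_1: "(flat 0 \<longlongrightarrow> 1) at_top"
proof -
  have "((\<lambda>t::real. exp (- inverse t)) \<longlongrightarrow> exp (- 0)) at_top"
    by (intro tendsto_intros tendsto_inverse_0_at_top filterlim_ident)
  moreover have "eventually (\<lambda>t. exp (- inverse t) = flat 0 t) at_top"
    using eventually_gt_at_top[of "0::real"] by eventually_elim (simp add: flat_def inverse_eq_divide)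
  ultimately show ?thesis
    by (simp add: Lim_transform_eventually)
qed

text \<open>A smooth function \<open>p\<close> that is positive exactly on the open box is cut off
  at height 1 / n: the support then lies in the compact set where \<open>1 \<le> n * p\<close>,
  while at a fixed point of the box the argument of \<open>flat 0\<close> tends to infinity.\<close>

lemma indicator_box_approx:
  fixes a b :: "'a::euclidean_space"
  assumes "cbox a b \<subseteq> \<Omega>"
  obtains \<phi> where "\<And>n::nat. \<phi> n \<in> test_functions \<Omega>" "\<And>n x. 0 \<le> \<phi> n x \<and> \<phi> n x \<le> indicator (box a b) x"
    "\<And>x. (\<lambda>n. \<phi> n x) \<longlonglongrightarrow> indicator (box a b) x"
proof -
  define p where "p x = (\<Prod>i\<in>Basis. flat 0 (x \<bullet> i - a \<bullet> i) * flat 0 (b \<bullet> i - x \<bullet> i))" for x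
  define \<phi> where "\<phi> n x = flat 0 (real n * p x - 1)" for n x
  have p0: "p x = 0" if "x \<notin> box a b" for x
    using that flat_eq_0[of "x \<bullet> i - a \<bullet> i" for i] flat_eq_0[of "b \<bullet> i - x \<bullet> i" for i]
    by (fastforce simp: p_def mem_box not_less intro!: prod_zero)
  have p1: "p x > 0" if "x \<in> box a b" for x
    using that by (auto simp: p_def mem_box intro!: prod_pos mult_pos_pos flat_pos)
  have Ckp: "Ck k p" for k
    unfolding p_def by (intro Ck_prod Ck_mult Ck_compose[OF Ck_flat] Ck_diff Ck_const Ck_inner)
  show ?thesis
  proof
    fix n
    have cl: "closed {x. 1 \<le> real n * p x}"
      by (intro closed_Collect_le continuous_intros Ck_continuous_on[OF Ckp])
    have sub: "{x. 1 \<le> real n * p x} \<subseteq> cbox a b"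
      using p0 box_subset_cbox[of a b] by force
    show "\<phi> n \<in> test_functions \<Omega>"
    proof (rule test_functionsI)
      show "Ck k (\<phi> n)" for k
        unfolding \<phi>_def by (intro Ck_compose[OF Ck_flat] Ck_diff Ck_const Ck_cmult Ckp)
      show "compact {x. 1 \<le> real n * p x}"
        using compact_Int_closed[OF compact_cbox[of a b] cl] sub by (simp add: Int_absorb1)
      show "{x. \<phi> n x \<noteq> 0} \<subseteq> {x. 1 \<le> real n * p x}"
        using flat_eq_0[of "real n * p x - 1" 0 for x] by (force simp: \<phi>_def)
    qed (use sub assms in auto)
    show "0 \<le> \<phi> n x \<and> \<phi> n x \<le> indicator (box a b) x" for x
      using flat_0_le_1 flat_nonneg p0[of x] by (auto simp: \<phi>_def indicator_def flat_eq_0)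
  next
    show "(\<lambda>n. \<phi> n x) \<longlonglongrightarrow> indicator (box a b) x" for x
    proof (cases "x \<in> box a b")
      case True
      have "filterlim (\<lambda>n. p x * real n) at_top sequentially"
        using p1[OF True] by (intro filterlim_tendsto_pos_mult_at_top[OF tendsto_const] filterlim_real_sequentially)
      from filterlim_tendsto_add_at_top[OF tendsto_const[of "-1"] this]
      have "filterlim (\<lambda>n. real n * p x - 1) at_top sequentially"
        by (simp add: mult.commute algebra_simps)
      from filterlim_compose[OF flat_0_tendsto_1 this] show ?thesis
        using True by (simp add: \<phi>_def)
    next
      case False
      then show ?thesis by (simp add: \<phi>_def p0 flat_eq_0)
    qed
  qed
qed

text \<open>Boxes form an intersection-stable generator of the Borel sets, so vanishing integrals
  spread to all Borel sets and, up to null sets, to all Lebesgue sets. The whole space is not a box;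
  the assumption \<open>all\<close> supplies it for the complement step.\<close>

lemma AE_eq_0_if_box_integrals_eq_0:
  fixes H :: "'a::euclidean_space \<Rightarrow> 'b::euclidean_space"
  assumes H: "integrable lebesgue H"
    and box: "\<And>c d. (LINT x|lebesgue. indicat_real (box c d) x *\<^sub>R H x) = 0"
    and all: "(LINT x|lebesgue. H x) = 0"
  shows "AE x in lebesgue. H x = 0"
proof -
  \<comment> \<open>The completion is sigma-finite with the same exhausting sets as
    \<open>lborel\<close>; \<open>density_zero\<close> is available only for sigma-finite
    measures.\<close>
  obtain A :: "'a set set" where A: "countable A" "A \<subseteq> sets lborel" "\<Union>A = space lborel" "\<forall>a\<in>A. emeasure lborel a \<noteq> \<infinity>"
    using lborel.sigma_finite_countable by blast
  then interpret lebesgue: sigma_finite_measure "lebesgue :: 'a measure"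
    by unfold_locales (auto intro!: exI[of _ A])
  show ?thesis
  proof (rule lebesgue.density_zero[OF H])
  have borel: "set_lebesgue_integral lebesgue A H = 0" if "A \<in> sets borel" for A
  proof -
    have intA: "set_integrable lebesgue A H" if "A \<in> sets borel" for A
      unfolding set_integrable_def using that by (intro integrable_mult_indicator H) auto
    let ?G = "range (\<lambda>(a, b). box a b :: 'a set)"
    have gen: "sets borel = sigma_sets UNIV ?G"
      unfolding borel_eq_box by (rule sets_measure_of) auto
    have "Int_stable ?G"
      by (auto simp: Int_stable_def box_Int_box)
    moreover have "?G \<subseteq> Pow UNIV" by auto
    moreover have "A \<in> sigma_sets UNIV ?G" using that gen by simp
    ultimately show ?thesis
    proof (induction rule: sigma_sets_induct_disjoint)
      case (basic A)
      then show ?case using box by (auto simp: set_lebesgue_integral_def)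
    next
      case empty
      show ?case by (simp add: set_lebesgue_integral_def)
    next
      case (compl A)
      have "set_lebesgue_integral lebesgue (UNIV - A) H =
          (LINT x|lebesgue. H x - indicat_real A x *\<^sub>R H x)"
        unfolding set_lebesgue_integral_def
        by (intro Bochner_Integration.integral_cong) (auto simp: indicator_def)
      also have "\<dots> = 0"
        using intA[of A] compl H all gen
        by (subst Bochner_Integration.integral_diff) (auto simp: set_integrable_def set_lebesgue_integral_def)
      finally show ?case .
    next
      case (union A)
      have A: "A i \<in> sets borel" for i
        using union gen by blast
      then have "set_lebesgue_integral lebesgue (\<Union>i. A i) H = (\<Sum>i. set_lebesgue_integral lebesgue (A i) H)"
        using union by (intro lebesgue_integral_countable_add intA) (auto simp: disjoint_family_on_def)
      then show ?case using union by simp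
    qed
  qed
  fix A :: "'a set" assume "A \<in> sets lebesgue"
  then obtain B N N' where B: "A = B \<union> N" "N \<subseteq> N'" "N' \<in> null_sets lborel" "B \<in> sets lborel"
    by (rule sets_completionE)
  have "AE x in lebesgue. x \<notin> N'"
    using AE_not_in[OF null_sets_completionI[OF B(3)]] .
  then have "AE x in lebesgue. indicat_real A x *\<^sub>R H x = indicat_real B x *\<^sub>R H x"
    by eventually_elim (use B in \<open>auto simp: indicator_def\<close>)
  moreover have "B \<in> sets lebesgue" using B(4) by simp
  ultimately have "set_lebesgue_integral lebesgue A H = set_lebesgue_integral lebesgue B H"
    unfolding set_lebesgue_integral_def using \<open>A \<in> sets lebesgue\<close> H
    by (intro integral_cong_AE borel_measurable_scaleR)
      (auto dest: borel_measurable_integrable intro!: borel_measurable_indicator)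
  then show "set_lebesgue_integral lebesgue A H = 0"
    using borel B(4) by simp
  qed
qed

text \<open>Dominated convergence replaces test functions by indicators of boxes whose closure lies
  in the domain. This gives a null function on each such closed box, and countably many of them fill
  the open set.\<close>

lemma fundamental_lemma:
  fixes G :: "'a::euclidean_space \<Rightarrow> 'b::euclidean_space"
  assumes \<Omega>: "open \<Omega>" and G: "G locally_integrable_on \<Omega>"
    and 0: "\<And>\<phi>. \<phi> \<in> test_functions \<Omega> \<Longrightarrow> (LINT x|lebesgue_on \<Omega>. \<phi> x *\<^sub>R G x) = 0"
  shows "AE x in lebesgue_on \<Omega>. G x = 0"
proof -
  have box0: "(LINT x|lebesgue. indicat_real (box a b) x *\<^sub>R G x) = 0" if ab: "cbox a b \<subseteq> \<Omega>" for a b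
  proof -
    obtain \<phi> where \<phi>: "\<And>n::nat. \<phi> n \<in> test_functions \<Omega>" "\<And>n x. 0 \<le> \<phi> n x \<and> \<phi> n x \<le> indicator (box a b) x"
      "\<And>x. (\<lambda>n. \<phi> n x) \<longlonglongrightarrow> indicator (box a b) x"
      using indicator_box_approx[OF ab] by metis
    have int: "integrable lebesgue (\<lambda>x. indicat_real (cbox a b) x *\<^sub>R G x)"
      using G ab by (auto simp: locally_integrable_on_def set_integrable_def)
    have *: "indicat_real (box a b) x *\<^sub>R G x = indicat_real (box a b) x *\<^sub>R (indicat_real (cbox a b) x *\<^sub>R G x)" for x
      using box_subset_cbox[of a b] by (auto simp: indicator_def)
    \<comment> \<open>Cutting \<open>G\<close> off to the closed box changes nothing, as
      \<open>\<phi> n\<close> vanishes outside it, and turns local into global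
      integrability.\<close>
    have \<phi>G: "\<phi> n x *\<^sub>R G x = \<phi> n x *\<^sub>R (indicat_real (cbox a b) x *\<^sub>R G x)" for n x
      using \<phi>(2)[of n x] box_subset_cbox[of a b] by (cases "x \<in> box a b") (auto simp: indicator_def)
    have "(\<lambda>n. LINT x|lebesgue. \<phi> n x *\<^sub>R G x) \<longlonglongrightarrow> (LINT x|lebesgue. indicat_real (box a b) x *\<^sub>R G x)"
    proof (rule integral_dominated_convergence)
      show "(\<lambda>x. indicat_real (box a b) x *\<^sub>R G x) \<in> borel_measurable lebesgue"
        by (subst *, rule borel_measurable_scaleR[OF _ borel_measurable_integrable[OF int]])
          (auto intro!: borel_measurable_indicator)
      have "\<phi> n \<in> borel_measurable lebesgue" for n
        using integrable_bounded_support[OF test_functionsD(6,3)[OF \<phi>(1)]] by (rule borel_measurable_integrable)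
      then show "(\<lambda>x. \<phi> n x *\<^sub>R G x) \<in> borel_measurable lebesgue" for n
        by (subst \<phi>G, intro borel_measurable_scaleR[OF _ borel_measurable_integrable[OF int]])
      show "integrable lebesgue (\<lambda>x. norm (indicat_real (cbox a b) x *\<^sub>R G x))"
        using int by (rule integrable_norm)
      show "AE x in lebesgue. (\<lambda>n. \<phi> n x *\<^sub>R G x) \<longlonglongrightarrow> indicat_real (box a b) x *\<^sub>R G x"
        using \<phi>(3) by (intro always_eventually allI tendsto_intros)
      have "\<phi> n x \<le> 1" for n x
        using \<phi>(2)[of n x] by (auto simp: indicator_def split: if_splits intro: order_trans)
      then show "AE x in lebesgue. norm (\<phi> n x *\<^sub>R G x) \<le> norm (indicat_real (cbox a b) x *\<^sub>R G x)" for n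
        using \<phi>(2)[of n] by (subst \<phi>G) (auto intro!: always_eventually mult_right_mono mult_left_le_one_le)
    qed
    moreover have "(LINT x|lebesgue. \<phi> n x *\<^sub>R G x) = 0" for n
      using 0[OF \<phi>(1)] integral_lebesgue_on_vanishing[of \<Omega> "\<lambda>x. \<phi> n x *\<^sub>R G x"] test_functionsD(5)[OF \<phi>(1)] \<Omega>
      by simp
    ultimately show ?thesis by (simp add: LIMSEQ_const_iff)
  qed
  have cell: "AE x in lebesgue. x \<in> cbox a b \<longrightarrow> G x = 0" if ab: "cbox a b \<subseteq> \<Omega>" for a b
  proof -
    have int: "integrable lebesgue (\<lambda>x. indicat_real (cbox a b) x *\<^sub>R G x)"
      using G ab by (auto simp: locally_integrable_on_def set_integrable_def)
    have "integrable lebesgue (\<lambda>x. indicat_real (box a b) x *\<^sub>R (indicat_real (cbox a b) x *\<^sub>R G x))"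
      by (rule integrable_mult_indicator[OF _ int]) simp
    moreover have "(\<lambda>x. indicat_real (box a b) x *\<^sub>R (indicat_real (cbox a b) x *\<^sub>R G x)) = (\<lambda>x. indicat_real (box a b) x *\<^sub>R G x)"
      using box_subset_cbox[of a b] by (intro ext) (auto simp: indicator_def)
    ultimately have int': "integrable lebesgue (\<lambda>x. indicat_real (box a b) x *\<^sub>R G x)" by simp
    have "AE x in lebesgue. indicat_real (box a b) x *\<^sub>R G x = 0"
    proof (rule AE_eq_0_if_box_integrals_eq_0[OF int' _ box0[OF ab]])
      \<comment> \<open>An arbitrary box meets \<open>box a b\<close> in a box that still has its
        closure inside the domain, so \<open>box0\<close> applies to it.\<close>
      fix c d
      obtain a' b' where I: "box c d \<inter> box a b = box a' b'" "cbox a' b' \<subseteq> cbox a b"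
      proof
        show "box c d \<inter> box a b = box (\<Sum>i\<in>Basis. max (c \<bullet> i) (a \<bullet> i) *\<^sub>R i) (\<Sum>i\<in>Basis. min (d \<bullet> i) (b \<bullet> i) *\<^sub>R i)"
          by (rule box_Int_box)
      qed (auto simp: mem_box)
      have "(\<lambda>x. indicat_real (box c d) x *\<^sub>R indicat_real (box a b) x *\<^sub>R G x) = (\<lambda>x. indicat_real (box a' b') x *\<^sub>R G x)"
        unfolding I(1)[symmetric] by (auto simp: indicator_def)
      then show "(LINT x|lebesgue. indicat_real (box c d) x *\<^sub>R indicat_real (box a b) x *\<^sub>R G x) = 0"
        using box0[of a' b'] I(2) ab by simp
    qed
    moreover have "AE x in lebesgue. x \<notin> cbox a b - box a b"
      using negligible_frontier_interval[of a b] by (intro AE_not_in) (simp add: negligible_iff_null_sets)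
    ultimately show ?thesis
      by eventually_elim (auto simp: indicator_def split: if_splits)
  qed
  obtain D where D: "countable D" "D \<subseteq> Pow \<Omega>" "\<And>X. X \<in> D \<Longrightarrow> \<exists>a b. X = cbox a b" "\<Union>D = \<Omega>"
    using open_countable_Union_open_cbox[OF \<Omega>] by metis
  have "AE x in lebesgue. x \<in> X \<longrightarrow> G x = 0" if "X \<in> D" for X
  proof -
    obtain a b where "X = cbox a b" using D(3) \<open>X \<in> D\<close> by blast
    then show ?thesis using cell[of a b] D(2) \<open>X \<in> D\<close> by auto
  qed
  then have "AE x in lebesgue. \<forall>X\<in>D. x \<in> X \<longrightarrow> G x = 0"
    using D(1) by (subst AE_ball_countable) auto
  then have "AE x in lebesgue. x \<in> \<Omega> \<longrightarrow> G x = 0"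
    by eventually_elim (use D(4) in auto)
  then show ?thesis
    using \<Omega> by (subst AE_restrict_space_iff) auto
qed

lemma locally_integrable_on_diff:
  "f locally_integrable_on \<Omega> \<Longrightarrow> g locally_integrable_on \<Omega> \<Longrightarrow> (\<lambda>x. f x - g x) locally_integrable_on \<Omega>"
  by (auto simp: locally_integrable_on_def intro: set_integral_diff)

lemma integrable_test_mult:
  fixes G :: "'a::euclidean_space \<Rightarrow> 'b::euclidean_space"
  assumes \<Omega>: "open \<Omega>" and G: "G locally_integrable_on \<Omega>" and \<phi>: "\<phi> \<in> test_functions \<Omega>"
  shows "integrable (lebesgue_on \<Omega>) (\<lambda>x. \<phi> x *\<^sub>R G x)"
proof -
  let ?K = "closure {x. \<phi> x \<noteq> 0}"
  have int: "integrable lebesgue (\<lambda>x. indicat_real ?K x *\<^sub>R G x)"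
    using G test_functionsD[OF \<phi>] by (auto simp: locally_integrable_on_def set_integrable_def)
  obtain M where M: "\<And>x. \<bar>\<phi> x\<bar> \<le> M"
    using bounded_support_bound test_functionsD[OF \<phi>] by metis
  have "\<phi> \<in> borel_measurable lebesgue"
    using integrable_bounded_support[OF test_functionsD(6,3)[OF \<phi>]] by (rule borel_measurable_integrable)
  then have "integrable lebesgue (\<lambda>x. \<phi> x *\<^sub>R (indicat_real ?K x *\<^sub>R G x))"
  proof (rule Bochner_Integration.integrable_bound[OF integrable_scaleR_right[OF int, of M]
      borel_measurable_scaleR[OF _ borel_measurable_integrable[OF int]]])
    show "AE x in lebesgue. norm (\<phi> x *\<^sub>R indicat_real ?K x *\<^sub>R G x) \<le> norm (M *\<^sub>R indicat_real ?K x *\<^sub>R G x)"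
      using order_trans[OF M abs_ge_self] by (auto simp: abs_mult intro!: mult_right_mono)
  qed
  moreover have "(\<lambda>x. \<phi> x *\<^sub>R (indicat_real ?K x *\<^sub>R G x)) = (\<lambda>x. \<phi> x *\<^sub>R G x)"
    using closure_subset[of "{x. \<phi> x \<noteq> 0}"] by (fastforce simp: indicator_def)
  ultimately have "integrable lebesgue (\<lambda>x. \<phi> x *\<^sub>R G x)" by simp
  then show ?thesis
    using \<Omega> test_functionsD(5)[OF \<phi>] by (subst integrable_lebesgue_on_vanishing) auto
qed

section \<open>Series of square integrable functions\<close>

definition square_integrable :: "'a measure \<Rightarrow> ('a \<Rightarrow> 'b::euclidean_space) \<Rightarrow> bool" where
  "square_integrable M f \<longleftrightarrow> f \<in> borel_measurable M \<and> integrable M (\<lambda>x. (norm (f x))\<^sup>2)"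

lemma L2_on_iff: "f \<in> L2_on \<Omega> \<longleftrightarrow> square_integrable (lebesgue_on \<Omega>) f"
  by (simp add: L2_on_def square_integrable_def)

lemma square_integrableI:
  assumes "f \<in> borel_measurable M" "integrable M h" "AE x in M. (norm (f x))\<^sup>2 \<le> h x"
  shows "square_integrable M f"
proof -
  have "integrable M (\<lambda>x. (norm (f x))\<^sup>2)"
    by (rule Bochner_Integration.integrable_bound[OF assms(2)])
      (use assms in \<open>auto intro!: borel_measurable_power borel_measurable_norm elim: order_trans\<close>)
  then show ?thesis using assms(1) by (simp add: square_integrable_def)
qed

lemma norm_diff_sq_le: "(norm (x - y))\<^sup>2 \<le> 2 * (norm x)\<^sup>2 + 2 * (norm (y::'a::real_normed_vector))\<^sup>2"
proof -
  have "(norm (x - y))\<^sup>2 \<le> (norm x + norm y)\<^sup>2"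
    by (intro power_mono norm_triangle_ineq4) auto
  also have "\<dots> \<le> 2 * (norm x)\<^sup>2 + 2 * (norm y)\<^sup>2"
    using sum_squares_bound[of "norm x" "norm y"] by (simp add: power2_sum)
  finally show ?thesis .
qed

lemma square_integrable_diff:
  assumes "square_integrable M f" "square_integrable M g"
  shows "square_integrable M (\<lambda>x. f x - g x)"
  by (rule square_integrableI[where h="\<lambda>x. 2 * (norm (f x))\<^sup>2 + 2 * (norm (g x))\<^sup>2"])
    (use assms norm_diff_sq_le in \<open>auto simp: square_integrable_def\<close>)

lemma integral_norm_diff_sq_le:
  assumes "square_integrable M f" "square_integrable M g"
  shows "(LINT x|M. (norm (f x - g x))\<^sup>2) \<le> 2 * (LINT x|M. (norm (f x))\<^sup>2) + 2 * (LINT x|M. (norm (g x))\<^sup>2)"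
proof -
  have "(LINT x|M. (norm (f x - g x))\<^sup>2) \<le> (LINT x|M. 2 * (norm (f x))\<^sup>2 + 2 * (norm (g x))\<^sup>2)"
    using assms square_integrable_diff[OF assms] norm_diff_sq_le
    by (intro integral_mono) (auto simp: square_integrable_def)
  also have "\<dots> = 2 * (LINT x|M. (norm (f x))\<^sup>2) + 2 * (LINT x|M. (norm (g x))\<^sup>2)"
    using assms by (simp add: square_integrable_def)
  finally show ?thesis .
qed

lemma mult_le_sum_squares: "a * b \<le> a\<^sup>2 + (b::real)\<^sup>2"
proof -
  have "0 \<le> (a - b)\<^sup>2 + (a\<^sup>2 + b\<^sup>2)" by simp
  then show ?thesis by (simp add: power2_diff)
qed

lemma abs_inner_le_sq: "\<bar>x \<bullet> y\<bar> \<le> (norm x)\<^sup>2 + (norm (y::'a::real_inner))\<^sup>2"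
proof -
  have "\<bar>x \<bullet> y\<bar> \<le> norm x * norm y" by (rule Cauchy_Schwarz_ineq2)
  also have "\<dots> \<le> (norm x)\<^sup>2 + (norm y)\<^sup>2"
    by (rule mult_le_sum_squares)
  finally show ?thesis .
qed

lemma integrable_inner_square_integrable:
  assumes "square_integrable M f" "square_integrable M g"
  shows "integrable M (\<lambda>x. f x \<bullet> g x)"
  by (rule Bochner_Integration.integrable_bound[where f="\<lambda>x. (norm (f x))\<^sup>2 + (norm (g x))\<^sup>2"])
    (use assms in \<open>auto simp: square_integrable_def intro!: abs_inner_le_sq always_eventually\<close>)

lemma square_integrable_integral_eq_0_iff:
  assumes "square_integrable M f"
  shows "(LINT x|M. (norm (f x))\<^sup>2) = 0 \<longleftrightarrow> (AE x in M. f x = 0)"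
  using assms by (subst integral_nonneg_eq_0_iff_AE) (auto simp: square_integrable_def)

lemma sum_sq_le_weighted:
  fixes a \<omega> :: "nat \<Rightarrow> real"
  assumes "finite I" "\<And>n. \<omega> n > 0"
  shows "(\<Sum>n\<in>I. a n)\<^sup>2 \<le> (\<Sum>n\<in>I. \<omega> n) * (\<Sum>n\<in>I. (a n)\<^sup>2 / \<omega> n)"
proof -
  have "(\<Sum>n\<in>I. a n)\<^sup>2 = (\<Sum>n\<in>I. sqrt (\<omega> n) * (a n / sqrt (\<omega> n)))\<^sup>2"
    using assms(2) by (simp add: less_imp_neq[symmetric])
  also have "\<dots> \<le> (\<Sum>n\<in>I. (sqrt (\<omega> n))\<^sup>2) * (\<Sum>n\<in>I. (a n / sqrt (\<omega> n))\<^sup>2)"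
    by (rule Cauchy_Schwarz_ineq_sum)
  also have "\<dots> = (\<Sum>n\<in>I. \<omega> n) * (\<Sum>n\<in>I. (a n)\<^sup>2 / \<omega> n)"
    using assms(2) by (simp add: power_divide less_imp_le)
  finally show ?thesis .
qed

text \<open>Weighted Cauchy-Schwarz bounds the squared sum of norms by
  \<open>suminf \<omega>\<close> times the sum of \<open>(norm (f n x))^2 / \<omega> n\<close>,
  whose n-th term has integral at most \<open>\<omega> n\<close>. This yields one integrable
  majorant for all squared partial sums and takes the place of the completeness of the space of
  square integrable functions.\<close>

lemma square_integrable_series_bound:
  fixes f :: "nat \<Rightarrow> 'a \<Rightarrow> 'b::euclidean_space"
  assumes f: "\<And>n. square_integrable M (f n)" "\<And>n. (LINT x|M. (norm (f n x))\<^sup>2) \<le> (\<omega> n)\<^sup>2"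
    and \<omega>: "\<And>n. \<omega> n > 0" "summable \<omega>"
  obtains h where "integrable M h"
    "AE x in M. summable (\<lambda>n. norm (f n x)) \<and> (\<Sum>n. norm (f n x))\<^sup>2 \<le> h x"
proof
  let ?q = "\<lambda>n x. (norm (f n x))\<^sup>2 / \<omega> n"
  define h where "h x = suminf \<omega> * (\<Sum>n. ?q n x)" for x
  have q0: "0 \<le> ?q n x" for n x using \<omega>(1)[of n] by simp
  have int_q: "integrable M (?q n)" for n
    using f(1) by (simp add: square_integrable_def)
  have q\<omega>: "(LINT x|M. ?q n x) \<le> \<omega> n" for n
    using f(2)[of n] \<omega>(1)[of n] by (simp add: field_simps power2_eq_square)
  have sum_q: "summable (\<lambda>n. LINT x|M. norm (?q n x))"
    using q0 q\<omega> \<omega>(1)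
    by (intro summable_comparison_test'[OF \<omega>(2), of 0]) (auto simp: less_imp_le abs_of_pos)
  have "(\<integral>\<^sup>+x. (\<Sum>n. ennreal (?q n x)) \<partial>M) = (\<Sum>n. \<integral>\<^sup>+x. ennreal (?q n x) \<partial>M)"
    using int_q by (intro nn_integral_suminf) auto
  also have "\<dots> = (\<Sum>n. ennreal (LINT x|M. ?q n x))"
    using int_q q0 by (intro suminf_cong nn_integral_eq_integral) auto
  also have "\<dots> = ennreal (\<Sum>n. LINT x|M. ?q n x)"
  proof (rule suminf_ennreal2)
    show "0 \<le> (LINT x|M. ?q n x)" for n using q0 by (intro Bochner_Integration.integral_nonneg)
    show "summable (\<lambda>n. LINT x|M. ?q n x)" using sum_q unfolding real_norm_def abs_of_nonneg[OF q0] .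
  qed
  finally have "(\<integral>\<^sup>+x. (\<Sum>n. ennreal (?q n x)) \<partial>M) \<noteq> \<infinity>" by simp
  then have "AE x in M. (\<Sum>n. ennreal (?q n x)) \<noteq> \<infinity>"
    using int_q by (intro nn_integral_PInf_AE) auto
  then have AE_q: "AE x in M. summable (\<lambda>n. ?q n x)"
    by eventually_elim (use q0 in \<open>auto intro!: summable_suminf_not_top\<close>)
  show "integrable M h"
    unfolding h_def
  proof (intro integrable_mult_right integrable_suminf)
    show "AE x in M. summable (\<lambda>n. norm (?q n x))"
      using AE_q unfolding real_norm_def abs_of_nonneg[OF q0] .
  qed (use sum_q int_q in auto)
  show "AE x in M. summable (\<lambda>n. norm (f n x)) \<and> (\<Sum>n. norm (f n x))\<^sup>2 \<le> h x"
    using AE_q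
  proof eventually_elim
    case (elim x)
    \<comment> \<open>Summability of the weighted squares gives absolute summability at the point,
      by the inequality between a product and the sum of squares.\<close>
    have "norm (f n x) \<le> ?q n x + \<omega> n" for n
    proof -
      have "\<omega> n * norm (f n x) \<le> (norm (f n x))\<^sup>2 + (\<omega> n)\<^sup>2"
        using mult_le_sum_squares[of "norm (f n x)" "\<omega> n"] by (simp add: mult.commute)
      then show ?thesis using \<omega>(1)[of n] by (simp add: field_simps power2_eq_square)
    qed
    then have s: "summable (\<lambda>n. norm (f n x))"
      by (intro summable_comparison_test'[OF summable_add[OF elim \<omega>(2)], of 0]) auto
    have "(\<Sum>n<m. norm (f n x))\<^sup>2 \<le> h x" for m
    proof -
      have "(\<Sum>n<m. norm (f n x))\<^sup>2 \<le> (\<Sum>n<m. \<omega> n) * (\<Sum>n<m. ?q n x)"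
        using \<omega>(1) by (intro sum_sq_le_weighted) auto
      also have "\<dots> \<le> h x"
        unfolding h_def using \<omega> elim q0
        by (intro mult_mono sum_le_suminf sum_nonneg suminf_nonneg) (auto simp: less_imp_le)
      finally show ?thesis .
    qed
    moreover have "(\<lambda>m. (\<Sum>n<m. norm (f n x))\<^sup>2) \<longlonglongrightarrow> (\<Sum>n. norm (f n x))\<^sup>2"
      by (intro tendsto_power summable_LIMSEQ s)
    ultimately have "(\<Sum>n. norm (f n x))\<^sup>2 \<le> h x"
      by (intro LIMSEQ_le_const2) auto
    with s show ?case by simp
  qed
qed

text \<open>The majorant of the preceding lemma dominates both limits: \<open>2 * h + 2 * h\<close>
  for the convergence in mean square, and \<open>h + (norm g)^2\<close> for the pairing with a fixed
  \<open>g\<close>. On the null set where the series diverges, \<open>suminf\<close> has an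
  unspecified value that no integral sees.\<close>

lemma square_integrable_series:
  fixes f :: "nat \<Rightarrow> 'a \<Rightarrow> 'b::euclidean_space"
  assumes f: "\<And>n. square_integrable M (f n)" "\<And>n. (LINT x|M. (norm (f n x))\<^sup>2) \<le> (\<omega> n)\<^sup>2"
    and \<omega>: "\<And>n. \<omega> n > 0" "summable \<omega>"
  defines "s \<equiv> \<lambda>x. \<Sum>n. f n x"
  shows "AE x in M. summable (\<lambda>n. norm (f n x))"
    and "square_integrable M s"
    and "(\<lambda>m. LINT x|M. (norm ((\<Sum>n<m. f n x) - s x))\<^sup>2) \<longlonglongrightarrow> 0"
    and "\<And>g. square_integrable M g \<Longrightarrow> (\<lambda>m. LINT x|M. (\<Sum>n<m. f n x) \<bullet> g x) \<longlonglongrightarrow> (LINT x|M. s x \<bullet> g x)"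
proof -
  obtain h where h: "integrable M h"
    "AE x in M. summable (\<lambda>n. norm (f n x)) \<and> (\<Sum>n. norm (f n x))\<^sup>2 \<le> h x"
    using square_integrable_series_bound[OF f \<omega>] by blast
  have [measurable]: "f n \<in> borel_measurable M" for n
    using f(1) by (simp add: square_integrable_def)
  have s_meas[measurable]: "s \<in> borel_measurable M"
    unfolding s_def by measurable
  have le: "norm (\<Sum>n<m. f n x) \<le> (\<Sum>n. norm (f n x))" "norm (s x) \<le> (\<Sum>n. norm (f n x))"
    if "summable (\<lambda>n. norm (f n x))" for m x
    using that by (auto simp: s_def intro!: summable_norm order_trans[OF norm_sum] sum_le_suminf)
  show "AE x in M. summable (\<lambda>n. norm (f n x))"
    using h(2) by eventually_elim auto
  have s_le: "AE x in M. (norm (s x))\<^sup>2 \<le> h x"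
    using h(2)
  proof eventually_elim
    case (elim x)
    then show ?case using power_mono[OF le(2)[of x], of 2] by simp
  qed
  show "square_integrable M s"
    by (rule square_integrableI[OF s_meas h(1) s_le])
  have part_le: "AE x in M. (norm (\<Sum>n<m. f n x))\<^sup>2 \<le> h x" for m
    using h(2)
  proof eventually_elim
    case (elim x)
    then show ?case using power_mono[OF le(1)[of x m], of 2] by simp
  qed
  have lim: "AE x in M. (\<lambda>m. \<Sum>n<m. f n x) \<longlonglongrightarrow> s x"
    using h(2) by eventually_elim (auto simp: s_def intro: summable_LIMSEQ summable_norm_cancel)
  have "(\<lambda>m. LINT x|M. (norm ((\<Sum>n<m. f n x) - s x))\<^sup>2) \<longlonglongrightarrow> (LINT x|M. 0)"
  proof (rule integral_dominated_convergence[where w = "\<lambda>x. 2 * h x + 2 * h x"])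
    show "integrable M (\<lambda>x. 2 * h x + 2 * h x)" using h(1) by simp
    show "AE x in M. (\<lambda>m. (norm ((\<Sum>n<m. f n x) - s x))\<^sup>2) \<longlonglongrightarrow> 0"
      using lim
    proof eventually_elim
      case (elim x)
      have "(\<lambda>m. (norm ((\<Sum>n<m. f n x) - s x))\<^sup>2) \<longlonglongrightarrow> (norm (s x - s x))\<^sup>2"
        by (intro tendsto_intros elim)
      then show ?case by simp
    qed
    show "AE x in M. norm ((norm ((\<Sum>n<m. f n x) - s x))\<^sup>2) \<le> 2 * h x + 2 * h x" for m
      using s_le part_le[of m]
    proof eventually_elim
      case (elim x)
      then show ?case using norm_diff_sq_le[of "\<Sum>n<m. f n x" "s x"] by simp
    qed
  qed auto
  then show "(\<lambda>m. LINT x|M. (norm ((\<Sum>n<m. f n x) - s x))\<^sup>2) \<longlonglongrightarrow> 0" by simp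
  fix g :: "'a \<Rightarrow> 'b" assume g: "square_integrable M g"
  then have [measurable]: "g \<in> borel_measurable M" by (simp add: square_integrable_def)
  show "(\<lambda>m. LINT x|M. (\<Sum>n<m. f n x) \<bullet> g x) \<longlonglongrightarrow> (LINT x|M. s x \<bullet> g x)"
  proof (rule integral_dominated_convergence[where w = "\<lambda>x. h x + (norm (g x))\<^sup>2"])
    show "integrable M (\<lambda>x. h x + (norm (g x))\<^sup>2)" using h(1) g by (simp add: square_integrable_def)
    show "AE x in M. (\<lambda>m. (\<Sum>n<m. f n x) \<bullet> g x) \<longlonglongrightarrow> s x \<bullet> g x"
      using lim by eventually_elim (intro tendsto_intros)
    show "AE x in M. norm ((\<Sum>n<m. f n x) \<bullet> g x) \<le> h x + (norm (g x))\<^sup>2" for m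
      using part_le[of m]
    proof eventually_elim
      case (elim x)
      then show ?case using abs_inner_le_sq[of "\<Sum>n<m. f n x" "g x"] by simp
    qed
  qed auto
qed

section \<open>Weak gradients\<close>

abbreviation laplacian :: "('a::euclidean_space \<Rightarrow> real) \<Rightarrow> 'a \<Rightarrow> real" where
  "laplacian f \<equiv> (\<lambda>x. \<Sum>b\<in>Basis. pd b (pd b f) x)"

lemma grad_inner: "b \<in> Basis \<Longrightarrow> grad \<phi> x \<bullet> b = pd b \<phi> x"
  by (simp add: grad_def inner_sum_left inner_Basis if_distrib cong: if_cong)

lemma norm_grad_sq: "(norm (grad \<phi> x))\<^sup>2 = (\<Sum>b\<in>Basis. (pd b \<phi> x)\<^sup>2)"
  unfolding power2_norm_eq_inner by (subst euclidean_inner) (simp add: grad_inner power2_eq_square)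

lemma test_functions_laplacian:
  "\<phi> \<in> test_functions \<Omega> \<Longrightarrow> laplacian \<phi> \<in> test_functions \<Omega>"
  by (intro test_functions_sum test_functions_pd)

lemma continuous_on_grad: "\<phi> \<in> test_functions \<Omega> \<Longrightarrow> continuous_on UNIV (grad \<phi>)"
  unfolding grad_def by (intro continuous_intros test_functionsD(6)[OF test_functions_pd])

lemma grad_outside_support:
  assumes "x \<notin> closure {x. \<phi> x \<noteq> 0}"
  shows "grad \<phi> x = 0"
  unfolding grad_def using pd_eq_0_outside_closure[OF assms] by simp

lemma bounded_support_grad: "bounded {x. \<phi> x \<noteq> 0} \<Longrightarrow> bounded {x. grad \<phi> x \<noteq> 0}"
  by (rule bounded_subset[OF bounded_closure]) (use grad_outside_support in auto)

lemma grad_outside: "\<phi> \<in> test_functions \<Omega> \<Longrightarrow> x \<notin> \<Omega> \<Longrightarrow> grad \<phi> x = 0"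
  using test_functionsD(4) grad_outside_support by blast

lemma grad_diff:
  assumes "Ck (Suc k) \<phi>" "Ck (Suc k) \<psi>"
  shows "grad (\<lambda>x. \<phi> x - \<psi> x) = (\<lambda>x. grad \<phi> x - grad \<psi> x)"
proof
  fix x
  have "pd b (\<lambda>x. \<phi> x - \<psi> x) x = pd b \<phi> x - pd b \<psi> x" for b
    using pd_add[OF assms(1) Ck_cmult[OF assms(2), of "-1"], where b=b] pd_cmult[OF assms(2), where b=b and c="-1"]
    by (simp add: fun_eq_iff)
  then show "grad (\<lambda>x. \<phi> x - \<psi> x) x = grad \<phi> x - grad \<psi> x"
    by (simp add: grad_def scaleR_diff_left sum_subtractf)
qed

lemma grad_sum:
  assumes "\<And>i. i \<in> I \<Longrightarrow> Ck (Suc k) (f i)"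
  shows "grad (\<lambda>x. \<Sum>i\<in>I. f i x) = (\<lambda>x. \<Sum>i\<in>I. grad (f i) x)"
proof
  fix x
  have "pd b (\<lambda>x. \<Sum>i\<in>I. f i x) x = (\<Sum>i\<in>I. pd b (f i) x)" for b
    using pd_sum[of I k f b] assms by (meson fun_cong)
  then show "grad (\<lambda>x. \<Sum>i\<in>I. f i x) x = (\<Sum>i\<in>I. grad (f i) x)"
    by (simp add: grad_def scaleR_sum_left sum.swap[of _ I])
qed

lemma laplacian_sum:
  assumes "\<And>i. i \<in> I \<Longrightarrow> Ck (Suc (Suc k)) (f i)"
  shows "laplacian (\<lambda>x. \<Sum>i\<in>I. f i x) = (\<lambda>x. \<Sum>i\<in>I. laplacian (f i) x)"
proof -
  have "pd b (pd b (\<lambda>x. \<Sum>i\<in>I. f i x)) = (\<lambda>x. \<Sum>i\<in>I. pd b (pd b (f i)) x)" if "b \<in> Basis" for b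
    using pd_sum[of I "Suc k" f b] pd_sum[of I k "\<lambda>i. pd b (f i)" b] assms that by (simp del: Ck.simps add: Ck_pd)
  then show ?thesis by (simp add: fun_eq_iff sum.swap[of _ I])
qed

lemma square_integrable_bounded_support:
  fixes f :: "'a::euclidean_space \<Rightarrow> 'b::euclidean_space"
  assumes "open \<Omega>" "continuous_on UNIV f" "bounded {x. f x \<noteq> 0}" "\<And>x. x \<notin> \<Omega> \<Longrightarrow> f x = 0"
  shows "square_integrable (lebesgue_on \<Omega>) f"
    and "(LINT x|lebesgue_on \<Omega>. (norm (f x))\<^sup>2) = (LINT x|lebesgue. (norm (f x))\<^sup>2)"
proof -
  have "integrable lebesgue (\<lambda>x. (norm (f x))\<^sup>2)"
    using assms by (intro integrable_bounded_support continuous_intros) auto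
  moreover have "integrable lebesgue f"
    using assms by (intro integrable_bounded_support)
  ultimately show "square_integrable (lebesgue_on \<Omega>) f"
    using assms integrable_lebesgue_on_vanishing[of \<Omega> "\<lambda>x. (norm (f x))\<^sup>2"] integrable_lebesgue_on_vanishing[of \<Omega> f]
    by (auto simp: square_integrable_def dest: borel_measurable_integrable)
  show "(LINT x|lebesgue_on \<Omega>. (norm (f x))\<^sup>2) = (LINT x|lebesgue. (norm (f x))\<^sup>2)"
    using assms by (intro integral_lebesgue_on_vanishing) auto
qed

lemma compact_in_sets_lebesgue: "compact K \<Longrightarrow> K \<in> sets lebesgue"
  using lmeasurable_compact fmeasurableD by blast

lemma locally_integrable_on_integrable:
  fixes f :: "'a::euclidean_space \<Rightarrow> 'b::euclidean_space"
  assumes "integrable lebesgue f"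
  shows "f locally_integrable_on \<Omega>"
  unfolding locally_integrable_on_def set_integrable_def
  using assms by (auto intro!: integrable_mult_indicator compact_in_sets_lebesgue)

text \<open>A compact set has finite measure and \<open>norm y \<le> 1 + (norm y)^2\<close>.\<close>

lemma locally_integrable_on_L2_on:
  fixes f :: "'a::euclidean_space \<Rightarrow> 'b::euclidean_space"
  assumes \<Omega>: "open \<Omega>" and f: "f \<in> L2_on \<Omega>"
  shows "f locally_integrable_on \<Omega>"
  unfolding locally_integrable_on_def set_integrable_def
proof (intro allI impI)
  fix K assume K: "compact K \<and> K \<subseteq> \<Omega>"
  have meas: "(\<lambda>x. indicat_real \<Omega> x *\<^sub>R f x) \<in> borel_measurable lebesgue"
    using f \<Omega> by (subst borel_measurable_restrict_space_iff[symmetric]) (auto simp: L2_on_def)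
  have int: "integrable lebesgue (\<lambda>x. indicat_real \<Omega> x *\<^sub>R (norm (f x))\<^sup>2)"
    using f \<Omega> by (subst integrable_restrict_space[symmetric]) (auto simp: L2_on_def)
  have Kleb: "K \<in> sets lebesgue" using K by (simp add: compact_in_sets_lebesgue)
  have K1: "integrable lebesgue (indicat_real K)"
    using emeasure_compact_finite[of K] K Kleb by (intro integrable_real_indicator) (auto simp: borel_compact)
  have eq: "indicat_real K x *\<^sub>R f x = indicat_real K x *\<^sub>R (indicat_real \<Omega> x *\<^sub>R f x)" for x
    using K by (auto simp: indicator_def)
  show "integrable lebesgue (\<lambda>x. indicat_real K x *\<^sub>R f x)"
  proof (rule Bochner_Integration.integrable_bound[OF Bochner_Integration.integrable_add[OF K1 int]])
    show "(\<lambda>x. indicat_real K x *\<^sub>R f x) \<in> borel_measurable lebesgue"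
      unfolding eq by (rule borel_measurable_scaleR[OF borel_measurable_indicator[OF Kleb] meas])
    have "norm y \<le> 1 + (norm y)\<^sup>2" for y :: 'b
      using mult_le_sum_squares[of 1 "norm y"] by simp
    then show "AE x in lebesgue. norm (indicat_real K x *\<^sub>R f x) \<le> norm (indicat_real K x + indicat_real \<Omega> x *\<^sub>R (norm (f x))\<^sup>2)"
      using K by (intro always_eventually) (auto simp: indicator_def)
  qed
qed

section \<open>Weak gradients by components: characterisation, uniqueness and differences\<close>

lemma integral_grad_inner:
  fixes u :: "'a::euclidean_space \<Rightarrow> real"
  assumes \<Omega>: "open \<Omega>" and u: "u locally_integrable_on \<Omega>" and \<phi>: "\<phi> \<in> test_functions \<Omega>" and b: "b \<in> Basis"
  shows "(LINT x|lebesgue_on \<Omega>. u x *\<^sub>R grad \<phi> x) \<bullet> b = (LINT x|lebesgue_on \<Omega>. pd b \<phi> x * u x)"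
proof -
  have "integrable (lebesgue_on \<Omega>) (\<lambda>x. \<Sum>c\<in>Basis. (pd c \<phi> x *\<^sub>R u x) *\<^sub>R c)"
    using integrable_test_mult[OF \<Omega> u test_functions_pd[OF \<phi>]]
    by (intro Bochner_Integration.integrable_sum integrable_scaleR_left) auto
  also have "(\<lambda>x. \<Sum>c\<in>Basis. (pd c \<phi> x *\<^sub>R u x) *\<^sub>R c) = (\<lambda>x. u x *\<^sub>R grad \<phi> x)"
    by (simp add: grad_def scaleR_sum_right mult.commute)
  finally show ?thesis
    using b by (subst integral_inner_left[symmetric]) (auto simp: grad_inner mult.commute)
qed

lemma integral_test_mult_inner:
  fixes G :: "'a::euclidean_space \<Rightarrow> 'b::euclidean_space"
  assumes "open \<Omega>" "G locally_integrable_on \<Omega>" "\<phi> \<in> test_functions \<Omega>"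
  shows "(LINT x|lebesgue_on \<Omega>. \<phi> x *\<^sub>R G x) \<bullet> b = (LINT x|lebesgue_on \<Omega>. \<phi> x * (G x \<bullet> b))"
  using integrable_test_mult[OF assms] by (subst integral_inner_left[symmetric]) auto

text \<open>The definition compares vector-valued integrals, whereas integration by parts and limits
  are handled one component at a time. Together with \<open>has_weak_gradI\<close> this translates
  between the two forms; local integrability permits taking inner products inside the
  integrals.\<close>

lemma has_weak_gradD:
  assumes \<Omega>: "open \<Omega>" and G: "has_weak_grad \<Omega> u G" and \<phi>: "\<phi> \<in> test_functions \<Omega>" and b: "b \<in> Basis"
  shows "(LINT x|lebesgue_on \<Omega>. pd b \<phi> x * u x) = - (LINT x|lebesgue_on \<Omega>. \<phi> x * (G x \<bullet> b))"
proof -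
  have l: "u locally_integrable_on \<Omega>" "G locally_integrable_on \<Omega>"
    and eq: "(LINT x|lebesgue_on \<Omega>. u x *\<^sub>R grad \<phi> x) = - (LINT x|lebesgue_on \<Omega>. \<phi> x *\<^sub>R G x)"
    using G \<phi> by (auto simp: has_weak_grad_def)
  from arg_cong[OF eq, of "\<lambda>v. v \<bullet> b"] show ?thesis
    unfolding inner_minus_left integral_grad_inner[OF \<Omega> l(1) \<phi> b] integral_test_mult_inner[OF \<Omega> l(2) \<phi>] .
qed

lemma has_weak_gradI:
  assumes \<Omega>: "open \<Omega>" and u: "u locally_integrable_on \<Omega>" and G: "G locally_integrable_on \<Omega>"
    and eq: "\<And>\<phi> b. \<phi> \<in> test_functions \<Omega> \<Longrightarrow> b \<in> Basis \<Longrightarrow>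
      (LINT x|lebesgue_on \<Omega>. pd b \<phi> x * u x) = - (LINT x|lebesgue_on \<Omega>. \<phi> x * (G x \<bullet> b))"
  shows "has_weak_grad \<Omega> u G"
  unfolding has_weak_grad_def
proof (intro conjI u G ballI, rule euclidean_eqI)
  fix \<phi> b assume \<phi>: "\<phi> \<in> test_functions \<Omega>" and b: "b \<in> (Basis :: 'a set)"
  show "(LINT x|lebesgue_on \<Omega>. u x *\<^sub>R grad \<phi> x) \<bullet> b = (- (LINT x|lebesgue_on \<Omega>. \<phi> x *\<^sub>R G x)) \<bullet> b"
    unfolding inner_minus_left integral_grad_inner[OF \<Omega> u \<phi> b] integral_test_mult_inner[OF \<Omega> G \<phi>]
    by (rule eq[OF \<phi> b])
qed

lemma has_weak_grad_unique:
  assumes \<Omega>: "open \<Omega>" and G: "has_weak_grad \<Omega> u G" and G': "has_weak_grad \<Omega> u G'"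
  shows "AE x in lebesgue_on \<Omega>. G x = G' x"
proof -
  have l: "G locally_integrable_on \<Omega>" "G' locally_integrable_on \<Omega>"
    using G G' by (auto simp: has_weak_grad_def)
  have "AE x in lebesgue_on \<Omega>. G x - G' x = 0"
  proof (rule fundamental_lemma[OF \<Omega> locally_integrable_on_diff[OF l]])
    fix \<phi> assume \<phi>: "\<phi> \<in> test_functions \<Omega>"
    then have "(LINT x|lebesgue_on \<Omega>. \<phi> x *\<^sub>R G x) = (LINT x|lebesgue_on \<Omega>. \<phi> x *\<^sub>R G' x)"
      using G G' by (simp add: has_weak_grad_def)
    then show "(LINT x|lebesgue_on \<Omega>. \<phi> x *\<^sub>R (G x - G' x)) = 0"
      using integrable_test_mult[OF \<Omega> l(1) \<phi>] integrable_test_mult[OF \<Omega> l(2) \<phi>]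
      unfolding scaleR_diff_right by (subst Bochner_Integration.integral_diff) auto
  qed
  then show ?thesis by simp
qed

lemma has_weak_grad_diff:
  assumes \<Omega>: "open \<Omega>" and u: "has_weak_grad \<Omega> u G" and v: "has_weak_grad \<Omega> v H"
  shows "has_weak_grad \<Omega> (\<lambda>x. u x - v x) (\<lambda>x. G x - H x)"
proof -
  have l: "u locally_integrable_on \<Omega>" "v locally_integrable_on \<Omega>"
    "G locally_integrable_on \<Omega>" "H locally_integrable_on \<Omega>"
    using u v by (auto simp: has_weak_grad_def)
  show ?thesis
  proof (rule has_weak_gradI[OF \<Omega> locally_integrable_on_diff[OF l(1,2)] locally_integrable_on_diff[OF l(3,4)]])
    fix \<phi> b assume \<phi>: "\<phi> \<in> test_functions \<Omega>" and b: "b \<in> (Basis :: 'a set)"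
    have i: "integrable (lebesgue_on \<Omega>) (\<lambda>x. pd b \<phi> x * u x)" "integrable (lebesgue_on \<Omega>) (\<lambda>x. pd b \<phi> x * v x)"
      using integrable_test_mult[OF \<Omega> l(1) test_functions_pd[OF \<phi> b]]
        integrable_test_mult[OF \<Omega> l(2) test_functions_pd[OF \<phi> b]] unfolding real_scaleR_def .
    have j: "integrable (lebesgue_on \<Omega>) (\<lambda>x. \<phi> x * (G x \<bullet> b))" "integrable (lebesgue_on \<Omega>) (\<lambda>x. \<phi> x * (H x \<bullet> b))"
      using integrable_inner_left[OF integrable_test_mult[OF \<Omega> l(3) \<phi>], of b]
        integrable_inner_left[OF integrable_test_mult[OF \<Omega> l(4) \<phi>], of b] unfolding inner_scaleR_left .
    show "(LINT x|lebesgue_on \<Omega>. pd b \<phi> x * (u x - v x)) = - (LINT x|lebesgue_on \<Omega>. \<phi> x * ((G x - H x) \<bullet> b))"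
      unfolding right_diff_distrib inner_diff_left Bochner_Integration.integral_diff[OF i]
        Bochner_Integration.integral_diff[OF j] has_weak_gradD[OF \<Omega> u \<phi> b] has_weak_gradD[OF \<Omega> v \<phi> b]
      by (simp only: minus_diff_eq diff_minus_eq_add add.commute uminus_add_conv_diff)
  qed
qed

lemma has_weak_grad_test_function:
  assumes \<Omega>: "open \<Omega>" and \<phi>: "\<phi> \<in> test_functions \<Omega>"
  shows "has_weak_grad \<Omega> \<phi> (grad \<phi>)"
proof (rule has_weak_gradI[OF \<Omega>])
  show "\<phi> locally_integrable_on \<Omega>"
    by (intro locally_integrable_on_integrable integrable_bounded_support test_functionsD(6,3)[OF \<phi>])
  show "grad \<phi> locally_integrable_on \<Omega>"
    by (intro locally_integrable_on_integrable integrable_bounded_support continuous_on_grad[OF \<phi>]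
        bounded_support_grad test_functionsD(3)[OF \<phi>])
  fix \<psi> b assume \<psi>: "\<psi> \<in> test_functions \<Omega>" and b: "b \<in> (Basis :: 'a set)"
  have "(LINT x|lebesgue. \<psi> x * pd b \<phi> x) = - (LINT x|lebesgue. pd b \<psi> x * \<phi> x)"
    by (rule integration_by_parts[OF test_functionsD(1,3)[OF \<psi>] test_functionsD(1)[OF \<phi>] b])
  moreover have "(LINT x|lebesgue_on \<Omega>. pd b \<psi> x * \<phi> x) = (LINT x|lebesgue. pd b \<psi> x * \<phi> x)"
    "(LINT x|lebesgue_on \<Omega>. \<psi> x * pd b \<phi> x) = (LINT x|lebesgue. \<psi> x * pd b \<phi> x)"
    by (rule integral_lebesgue_on_vanishing; use \<Omega> test_functionsD(5)[OF \<phi>] test_functionsD(5)[OF \<psi>] in simp)+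
  ultimately show "(LINT x|lebesgue_on \<Omega>. pd b \<psi> x * \<phi> x) = - (LINT x|lebesgue_on \<Omega>. \<psi> x * (grad \<phi> x \<bullet> b))"
    unfolding grad_inner[OF b] by (simp only: minus_minus)
qed

lemma test_function_L2_on:
  assumes \<Omega>: "open \<Omega>" and \<phi>: "\<phi> \<in> test_functions \<Omega>"
  shows "\<phi> \<in> L2_on \<Omega>" "grad \<phi> \<in> L2_on \<Omega>"
proof -
  show "\<phi> \<in> L2_on \<Omega>"
    unfolding L2_on_iff
    by (rule square_integrable_bounded_support(1)[OF \<Omega>]) (fact test_functionsD[OF \<phi>])+
  show "grad \<phi> \<in> L2_on \<Omega>"
    unfolding L2_on_iff
    by (rule square_integrable_bounded_support(1)[OF \<Omega> continuous_on_grad[OF \<phi>]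
          bounded_support_grad[OF test_functionsD(3)[OF \<phi>]]]) (fact grad_outside[OF \<phi>])
qed

text \<open>Completeness of Lebesgue measure, carried over to the restricted measure by multiplying
  with the indicator of the domain.\<close>

lemma borel_measurable_AE_lebesgue_on:
  fixes f g :: "'a::euclidean_space \<Rightarrow> 'b::euclidean_space"
  assumes "open \<Omega>" "f \<in> borel_measurable (lebesgue_on \<Omega>)" "AE x in lebesgue_on \<Omega>. f x = g x"
  shows "g \<in> borel_measurable (lebesgue_on \<Omega>)"
proof -
  have "(\<lambda>x. indicat_real \<Omega> x *\<^sub>R f x) \<in> borel_measurable lebesgue"
    using assms(1,2) by (subst borel_measurable_restrict_space_iff[symmetric]) auto
  moreover have "AE x in lebesgue. x \<in> \<Omega> \<longrightarrow> f x = g x"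
    using assms(1,3) by (subst AE_restrict_space_iff[symmetric]) auto
  then have "AE x in lebesgue. indicat_real \<Omega> x *\<^sub>R f x = indicat_real \<Omega> x *\<^sub>R g x"
    by eventually_elim (auto simp: indicator_def)
  ultimately have "(\<lambda>x. indicat_real \<Omega> x *\<^sub>R g x) \<in> borel_measurable lebesgue"
    by (rule borel_measurable_AE)
  then show ?thesis
    using assms(1) by (subst borel_measurable_restrict_space_iff) auto
qed

lemma square_integrable_AE_cong:
  fixes f g :: "'a::euclidean_space \<Rightarrow> 'b::euclidean_space"
  assumes "open \<Omega>" "square_integrable (lebesgue_on \<Omega>) f" "AE x in lebesgue_on \<Omega>. f x = g x"
  shows "square_integrable (lebesgue_on \<Omega>) g"
    and "(LINT x|lebesgue_on \<Omega>. (norm (g x))\<^sup>2) = (LINT x|lebesgue_on \<Omega>. (norm (f x))\<^sup>2)"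
proof -
  have g: "g \<in> borel_measurable (lebesgue_on \<Omega>)"
    using assms by (auto simp: square_integrable_def intro: borel_measurable_AE_lebesgue_on)
  have "AE x in lebesgue_on \<Omega>. (norm (g x))\<^sup>2 \<le> (norm (f x))\<^sup>2"
    using assms(3) by eventually_elim simp
  with g assms(2) show "square_integrable (lebesgue_on \<Omega>) g"
    by (intro square_integrableI) (auto simp: square_integrable_def)
  show "(LINT x|lebesgue_on \<Omega>. (norm (g x))\<^sup>2) = (LINT x|lebesgue_on \<Omega>. (norm (f x))\<^sup>2)"
    using assms(2,3) g by (intro integral_cong_AE) (auto simp: square_integrable_def)
qed

text \<open>This frees all later arguments from the choice in \<open>weak_grad\<close>: under
  integrals over the domain, any explicit weak gradient may stand in for it.\<close>

lemma weak_grad_AE: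
  assumes \<Omega>: "open \<Omega>" and u: "has_weak_grad \<Omega> u G"
  shows "has_weak_grad \<Omega> u (weak_grad \<Omega> u)" "AE x in lebesgue_on \<Omega>. G x = weak_grad \<Omega> u x"
proof -
  show "has_weak_grad \<Omega> u (weak_grad \<Omega> u)"
    unfolding weak_grad_def using u by (rule someI[where P="has_weak_grad \<Omega> u"])
  from has_weak_grad_unique[OF \<Omega> u this] show "AE x in lebesgue_on \<Omega>. G x = weak_grad \<Omega> u x" .
qed

lemma H1D:
  assumes \<Omega>: "open \<Omega>" and u: "u \<in> H1 \<Omega>"
  shows "square_integrable (lebesgue_on \<Omega>) u" "has_weak_grad \<Omega> u (weak_grad \<Omega> u)"
    "square_integrable (lebesgue_on \<Omega>) (weak_grad \<Omega> u)"
proof -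
  obtain G where G: "G \<in> L2_on \<Omega>" "has_weak_grad \<Omega> u G" using u by (auto simp: H1_def)
  show "square_integrable (lebesgue_on \<Omega>) u" using u by (simp add: H1_def L2_on_iff)
  show "has_weak_grad \<Omega> u (weak_grad \<Omega> u)" using weak_grad_AE(1)[OF \<Omega> G(2)] .
  show "square_integrable (lebesgue_on \<Omega>) (weak_grad \<Omega> u)"
    using square_integrable_AE_cong(1)[OF \<Omega> _ weak_grad_AE(2)[OF \<Omega> G(2)]] G(1) by (simp add: L2_on_iff)
qed

lemma H1_norm_eq:
  assumes \<Omega>: "open \<Omega>" and G: "square_integrable (lebesgue_on \<Omega>) G" "has_weak_grad \<Omega> u G"
  shows "H1_norm \<Omega> u = sqrt ((LINT x|lebesgue_on \<Omega>. (norm (u x))\<^sup>2) + (LINT x|lebesgue_on \<Omega>. (norm (G x))\<^sup>2))"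
  unfolding H1_norm_def using square_integrable_AE_cong(2)[OF \<Omega> G(1) weak_grad_AE(2)[OF \<Omega> G(2)]] by simp

lemma tendsto_H1_norm_iff:
  assumes \<Omega>: "open \<Omega>" and G: "\<And>n. square_integrable (lebesgue_on \<Omega>) (G n)" "\<And>n. has_weak_grad \<Omega> (w n) (G n)"
  shows "(\<lambda>n. H1_norm \<Omega> (w n)) \<longlonglongrightarrow> 0 \<longleftrightarrow>
    (\<lambda>n. LINT x|lebesgue_on \<Omega>. (norm (w n x))\<^sup>2) \<longlonglongrightarrow> 0 \<and> (\<lambda>n. LINT x|lebesgue_on \<Omega>. (norm (G n x))\<^sup>2) \<longlonglongrightarrow> 0"
    (is "?L \<longleftrightarrow> ?a \<longlonglongrightarrow> 0 \<and> ?b \<longlonglongrightarrow> 0")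
proof
  have eq: "H1_norm \<Omega> (w n) = sqrt (?a n + ?b n)" for n
    using H1_norm_eq[OF \<Omega> G] .
  have nonneg: "0 \<le> ?a n" "0 \<le> ?b n" for n by (auto intro: Bochner_Integration.integral_nonneg)
  {
    assume ?L
    then have "(\<lambda>n. (sqrt (?a n + ?b n))\<^sup>2) \<longlonglongrightarrow> 0\<^sup>2" unfolding eq by (rule tendsto_power)
    then have ab: "(\<lambda>n. ?a n + ?b n) \<longlonglongrightarrow> 0" using nonneg by (simp add: add_nonneg_nonneg)
    show "?a \<longlonglongrightarrow> 0 \<and> ?b \<longlonglongrightarrow> 0"
      using nonneg by (auto intro!: tendsto_sandwich[OF _ _ tendsto_const ab] always_eventually)
  }
  assume "?a \<longlonglongrightarrow> 0 \<and> ?b \<longlonglongrightarrow> 0"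
  then have "(\<lambda>n. sqrt (?a n + ?b n)) \<longlonglongrightarrow> sqrt (0 + 0)"
    by (intro tendsto_intros) auto
  then show ?L unfolding eq by simp
qed

section \<open>Weak solutions\<close>

text \<open>Integration by parts turns the left-hand side into the integral of
  \<open>- \<phi> * laplacian \<phi>\<close>, which is at most half the sum of the two squares.
  Hence gradients of the blocks never have to be estimated separately.\<close>

lemma integral_grad_sq_le:
  assumes \<phi>: "\<phi> \<in> test_functions \<Omega>"
    and le: "(LINT x|lebesgue. (\<phi> x)\<^sup>2) \<le> c" "(LINT x|lebesgue. (laplacian \<phi> x)\<^sup>2) \<le> c"
  shows "(LINT x|lebesgue. (norm (grad \<phi> x))\<^sup>2) \<le> c"
proof -
  have int: "integrable lebesgue (\<lambda>x. f x * g x)" if "f \<in> test_functions \<Omega>" "g \<in> test_functions \<Omega>" for f g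
    using test_functionsD(3,6)[OF that(1)] test_functionsD(6)[OF that(2)] by (intro integrable_mult_bounded_support)
  have l: "laplacian \<phi> \<in> test_functions \<Omega>" by (rule test_functions_laplacian[OF \<phi>])
  have pdpd: "pd b (pd b \<phi>) \<in> test_functions \<Omega>" if "b \<in> Basis" for b
    using that by (intro test_functions_pd \<phi>)
  have "(LINT x|lebesgue. (norm (grad \<phi> x))\<^sup>2) = (\<Sum>b\<in>Basis. LINT x|lebesgue. pd b \<phi> x * pd b \<phi> x)"
    unfolding norm_grad_sq unfolding power2_eq_square
    by (intro Bochner_Integration.integral_sum int test_functions_pd \<phi>)
  also have "\<dots> = (\<Sum>b\<in>Basis. - (LINT x|lebesgue. \<phi> x * pd b (pd b \<phi>) x))"
  proof (rule sum.cong[OF refl])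
    fix b :: 'a assume b: "b \<in> Basis"
    show "(LINT x|lebesgue. pd b \<phi> x * pd b \<phi> x) = - (LINT x|lebesgue. \<phi> x * pd b (pd b \<phi>) x)"
      unfolding integration_by_parts[OF test_functionsD(1,3)[OF \<phi>] test_functionsD(1)[OF test_functions_pd[OF \<phi> b]] b]
      by (simp only: minus_minus)
  qed
  also have "\<dots> = - (LINT x|lebesgue. \<phi> x * laplacian \<phi> x)"
    unfolding sum_negf sum_distrib_left
    by (subst Bochner_Integration.integral_sum) (auto intro!: int[OF \<phi> pdpd])
  also have "\<dots> = (LINT x|lebesgue. - (\<phi> x * laplacian \<phi> x))"
    by (rule Bochner_Integration.integral_minus[symmetric])
  also have "\<dots> \<le> (LINT x|lebesgue. (\<phi> x * \<phi> x + laplacian \<phi> x * laplacian \<phi> x) / 2)"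
  proof (rule integral_mono)
    show "integrable lebesgue (\<lambda>x. - (\<phi> x * laplacian \<phi> x))"
      by (rule Bochner_Integration.integrable_minus[OF int[OF \<phi> l]])
    show "integrable lebesgue (\<lambda>x. (\<phi> x * \<phi> x + laplacian \<phi> x * laplacian \<phi> x) / 2)"
      by (rule integrable_divide[OF Bochner_Integration.integrable_add[OF int[OF \<phi> \<phi>] int[OF l l]]])
    show "- (\<phi> x * laplacian \<phi> x) \<le> (\<phi> x * \<phi> x + laplacian \<phi> x * laplacian \<phi> x) / 2" for x
    proof -
      have "- (p * q) \<le> (p * p + q * q) / 2" for p q :: real
        using zero_le_power2[of "p + q"] by (simp add: power2_eq_square algebra_simps)
      then show ?thesis .
    qed
  qed
  also have "\<dots> = ((LINT x|lebesgue. \<phi> x * \<phi> x) + (LINT x|lebesgue. laplacian \<phi> x * laplacian \<phi> x)) / 2"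
    using Bochner_Integration.integral_add[OF int[OF \<phi> \<phi>] int[OF l l]] by (simp only: integral_divide_zero)
  also have "\<dots> \<le> c"
  proof -
    have "(p + q) / 2 \<le> c" if "p \<le> c" "q \<le> c" for p q :: real
      using that by simp
    from this[OF le] show ?thesis unfolding power2_eq_square .
  qed
  finally show ?thesis .
qed

text \<open>The coordinate function \<open>x \<bullet> b\<close> has derivative 1 in direction
  \<open>b\<close> and is bounded on the domain. Inserting that derivative as a factor and
  integrating by parts leaves \<open>\<phi> * pd b \<phi>\<close> times a bounded factor; half of
  the left-hand side is then absorbed.\<close>

lemma poincare_inequality:
  assumes \<Omega>: "bounded \<Omega>"
  obtains C where "\<And>\<phi>. \<phi> \<in> test_functions \<Omega> \<Longrightarrow>
    (LINT x|lebesgue. (\<phi> x)\<^sup>2) \<le> C * (LINT x|lebesgue. (norm (grad \<phi> x))\<^sup>2)"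
proof -
  obtain b :: 'a where b: "b \<in> Basis" using nonempty_Basis by blast
  obtain R where R: "\<And>x. x \<in> \<Omega> \<Longrightarrow> norm x \<le> R" using \<Omega> by (auto simp: bounded_iff)
  have "(LINT x|lebesgue. (\<phi> x)\<^sup>2) \<le> (4 * R\<^sup>2) * (LINT x|lebesgue. (norm (grad \<phi> x))\<^sup>2)" if \<phi>: "\<phi> \<in> test_functions \<Omega>" for \<phi>
  proof -
    have int: "integrable lebesgue (\<lambda>x. (f x)\<^sup>2)" if "f \<in> test_functions \<Omega>" for f
      unfolding power2_eq_square
      using test_functionsD(3,6)[OF that] by (intro integrable_mult_bounded_support)
    have int_grad: "integrable lebesgue (\<lambda>x. (norm (grad \<phi> x))\<^sup>2)"
      using bounded_support_grad[OF test_functionsD(3)[OF \<phi>]]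
      by (intro integrable_bounded_support continuous_intros continuous_on_grad[OF \<phi>]) simp
    have eq: "(LINT x|lebesgue. (\<phi> x * \<phi> x) * pd b (\<lambda>x. x \<bullet> b) x) = - (LINT x|lebesgue. pd b (\<lambda>x. \<phi> x * \<phi> x) x * (x \<bullet> b))"
    proof (rule integration_by_parts[OF _ _ _ b])
      show "Ck 1 (\<lambda>x. \<phi> x * \<phi> x)" by (intro Ck_mult test_functionsD(1)[OF \<phi>])
      show "bounded {x. \<phi> x * \<phi> x \<noteq> 0}" using test_functionsD(3)[OF \<phi>] by simp
      show "Ck 1 (\<lambda>x. x \<bullet> b)" by (rule Ck_inner)
    qed
    have "(LINT x|lebesgue. (\<phi> x)\<^sup>2) = (LINT x|lebesgue. (\<phi> x * \<phi> x) * pd b (\<lambda>x. x \<bullet> b) x)"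
      using b by (simp add: power2_eq_square fun_cong[OF pd_inner])
    also have "\<dots> = (LINT x|lebesgue. - (pd b (\<lambda>x. \<phi> x * \<phi> x) x * (x \<bullet> b)))"
      unfolding eq by (rule Bochner_Integration.integral_minus[symmetric])
    also have "\<dots> \<le> (LINT x|lebesgue. (\<phi> x)\<^sup>2 / 2 + 2 * R\<^sup>2 * (norm (grad \<phi> x))\<^sup>2)"
    proof (rule integral_mono)
      have "continuous_on UNIV (pd b (\<lambda>x. \<phi> x * \<phi> x))"
        by (rule Ck_continuous_on[OF Ck_pd[OF Ck_mult[OF test_functionsD(1)[OF \<phi>] test_functionsD(1)[OF \<phi>], of "Suc 0"] b]])
      moreover have "bounded {x. pd b (\<lambda>x. \<phi> x * \<phi> x) x \<noteq> 0}"
        using test_functionsD(3)[OF \<phi>] by (intro bounded_support_pd) simp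
      ultimately show "integrable lebesgue (\<lambda>x. - (pd b (\<lambda>x. \<phi> x * \<phi> x) x * (x \<bullet> b)))"
        by (intro Bochner_Integration.integrable_minus integrable_mult_bounded_support continuous_intros)
      show "integrable lebesgue (\<lambda>x. (\<phi> x)\<^sup>2 / 2 + 2 * R\<^sup>2 * (norm (grad \<phi> x))\<^sup>2)"
        by (intro Bochner_Integration.integrable_add integrable_divide integrable_mult_right int[OF \<phi>] int_grad)
      fix x
      have pd2: "pd b (\<lambda>x. \<phi> x * \<phi> x) x = \<phi> x * pd b \<phi> x + pd b \<phi> x * \<phi> x"
        using fun_cong[OF pd_mult[OF test_functionsD(1)[OF \<phi>] test_functionsD(1)[OF \<phi>], where b=b]] .
      show "- (pd b (\<lambda>x. \<phi> x * \<phi> x) x * (x \<bullet> b)) \<le> (\<phi> x)\<^sup>2 / 2 + 2 * R\<^sup>2 * (norm (grad \<phi> x))\<^sup>2"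
      proof (cases "x \<in> \<Omega>")
        case True
        have "\<bar>x \<bullet> b\<bar> \<le> R"
          using R[OF True] Basis_le_norm[OF b, of x] by linarith
        then have r: "(x \<bullet> b)\<^sup>2 \<le> R\<^sup>2" by (rule abs_le_square_iff[THEN iffD1, OF order_trans[OF _ abs_ge_self]])
        have g: "(pd b \<phi> x)\<^sup>2 \<le> (norm (grad \<phi> x))\<^sup>2"
          using Basis_le_norm[OF b, of "grad \<phi> x"] unfolding grad_inner[OF b] by (metis abs_le_square_iff abs_norm_cancel)
        \<comment> \<open>The coefficient 2 is what leaves exactly \<open>(\<phi> x)^2 / 2\<close>
          to be absorbed.\<close>
        have "0 \<le> (\<phi> x + 2 * (pd b \<phi> x * (x \<bullet> b)))\<^sup>2" by simp
        also have "\<dots> = (\<phi> x)\<^sup>2 + 4 * (\<phi> x * pd b \<phi> x * (x \<bullet> b)) + 4 * ((pd b \<phi> x)\<^sup>2 * (x \<bullet> b)\<^sup>2)"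
          by (simp add: power2_eq_square algebra_simps)
        finally have "- 4 * (\<phi> x * pd b \<phi> x * (x \<bullet> b)) \<le> (\<phi> x)\<^sup>2 + 4 * ((pd b \<phi> x)\<^sup>2 * (x \<bullet> b)\<^sup>2)" by simp
        moreover have "(pd b \<phi> x)\<^sup>2 * (x \<bullet> b)\<^sup>2 \<le> (norm (grad \<phi> x))\<^sup>2 * R\<^sup>2"
          using g r by (intro mult_mono) auto
        ultimately show ?thesis unfolding pd2 by (simp add: algebra_simps)
      next
        case False
        then show ?thesis unfolding pd2 using test_functionsD(5)[OF \<phi>] by simp
      qed
    qed
    also have "\<dots> = (LINT x|lebesgue. (\<phi> x)\<^sup>2) / 2 + 2 * R\<^sup>2 * (LINT x|lebesgue. (norm (grad \<phi> x))\<^sup>2)"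
      using int[OF \<phi>] int_grad by simp
    finally show ?thesis by simp
  qed
  then show ?thesis by (rule that)
qed

text \<open>Every component of \<open>grad \<phi>\<close> is itself a test function, so the weak
  gradient of \<open>v\<close> can be tested against each of them.\<close>

lemma integral_grad_inner_weak_grad:
  assumes \<Omega>: "open \<Omega>" and \<phi>: "\<phi> \<in> test_functions \<Omega>" and V: "has_weak_grad \<Omega> v V"
  shows "(LINT x|lebesgue_on \<Omega>. grad \<phi> x \<bullet> V x) = - (LINT x|lebesgue_on \<Omega>. laplacian \<phi> x * v x)"
proof -
  have lv: "v locally_integrable_on \<Omega>" and lV: "V locally_integrable_on \<Omega>"
    using V by (auto simp: has_weak_grad_def)
  have intV: "integrable (lebesgue_on \<Omega>) (\<lambda>x. pd b \<phi> x * (V x \<bullet> b))" if "b \<in> Basis" for b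
    using integrable_inner_left[OF integrable_test_mult[OF \<Omega> lV test_functions_pd[OF \<phi> that]], of b]
    unfolding inner_scaleR_left .
  have intv: "integrable (lebesgue_on \<Omega>) (\<lambda>x. pd b (pd b \<phi>) x * v x)" if "b \<in> Basis" for b
    using integrable_test_mult[OF \<Omega> lv test_functions_pd[OF test_functions_pd[OF \<phi> that] that]]
    unfolding real_scaleR_def .
  have "(LINT x|lebesgue_on \<Omega>. grad \<phi> x \<bullet> V x) = (LINT x|lebesgue_on \<Omega>. (\<Sum>b\<in>Basis. pd b \<phi> x * (V x \<bullet> b)))"
    by (subst euclidean_inner) (simp add: grad_inner)
  also have "\<dots> = (\<Sum>b\<in>Basis. LINT x|lebesgue_on \<Omega>. pd b \<phi> x * (V x \<bullet> b))"
    by (rule Bochner_Integration.integral_sum[OF intV])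
  also have "\<dots> = (\<Sum>b\<in>Basis. - (LINT x|lebesgue_on \<Omega>. pd b (pd b \<phi>) x * v x))"
  proof (rule sum.cong[OF refl])
    fix b :: 'a assume b: "b \<in> Basis"
    show "(LINT x|lebesgue_on \<Omega>. pd b \<phi> x * (V x \<bullet> b)) = - (LINT x|lebesgue_on \<Omega>. pd b (pd b \<phi>) x * v x)"
      unfolding has_weak_gradD[OF \<Omega> V test_functions_pd[OF \<phi> b] b] by (simp only: minus_minus)
  qed
  also have "\<dots> = - (LINT x|lebesgue_on \<Omega>. laplacian \<phi> x * v x)"
    unfolding sum_negf sum_distrib_right by (subst Bochner_Integration.integral_sum[OF intv]) auto
  finally show ?thesis .
qed

text \<open>Function, gradient and Laplacian series all converge in mean square, the gradients by
  \<open>integral_grad_sq_le\<close>, so identities for the partial sums pass to the limit. The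
  summability statement is exported because pointwise lower bounds for \<open>suminf\<close> require
  it.\<close>

lemma weak_solution_series:
  fixes \<phi> :: "nat \<Rightarrow> 'a::euclidean_space \<Rightarrow> real"
  assumes \<Omega>: "open \<Omega>" and \<phi>: "\<And>n. \<phi> n \<in> test_functions \<Omega>"
    and le: "\<And>n. (LINT x|lebesgue. (\<phi> n x)\<^sup>2) \<le> (\<omega> n)\<^sup>2" "\<And>n. (LINT x|lebesgue. (laplacian (\<phi> n) x)\<^sup>2) \<le> (\<omega> n)\<^sup>2"
    and \<omega>: "\<And>n. \<omega> n > 0" "summable \<omega>"
  obtains F where "F \<in> L2_on \<Omega>" "weak_solution \<Omega> F (\<lambda>x. \<Sum>n. \<phi> n x)"
    "AE x in lebesgue_on \<Omega>. summable (\<lambda>n. \<phi> n x)"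
proof -
  let ?M = "lebesgue_on \<Omega>"
  define u where "u x = (\<Sum>n. \<phi> n x)" for x
  define G where "G x = (\<Sum>n. grad (\<phi> n) x)" for x
  define L where "L x = (\<Sum>n. laplacian (\<phi> n) x)" for x
  define S where "S m x = (\<Sum>n<m. \<phi> n x)" for m x
  have S: "S m \<in> test_functions \<Omega>" for m
    unfolding S_def by (intro test_functions_sum \<phi>)
  have gradS: "grad (S m) = (\<lambda>x. \<Sum>n<m. grad (\<phi> n) x)" for m
    unfolding S_def by (rule grad_sum[OF test_functionsD(1)[OF \<phi>]])
  have lapS: "laplacian (S m) = (\<lambda>x. \<Sum>n<m. laplacian (\<phi> n) x)" for m
    unfolding S_def by (rule laplacian_sum[OF test_functionsD(1)[OF \<phi>]])
  have sq: "square_integrable ?M f" "(LINT x|?M. (norm (f x))\<^sup>2) = (LINT x|lebesgue. (f x)\<^sup>2)"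
    if "f \<in> test_functions \<Omega>" for f
    using square_integrable_bounded_support[OF \<Omega> test_functionsD(6,3)[OF that] test_functionsD(5)[OF that]] by simp_all
  have sqg: "square_integrable ?M (grad f)" "(LINT x|?M. (norm (grad f x))\<^sup>2) = (LINT x|lebesgue. (norm (grad f x))\<^sup>2)"
    if "f \<in> test_functions \<Omega>" for f
    using square_integrable_bounded_support[OF \<Omega> continuous_on_grad[OF that]
        bounded_support_grad[OF test_functionsD(3)[OF that]] grad_outside[OF that]] by simp_all
  have lap: "laplacian (\<phi> n) \<in> test_functions \<Omega>" for n
    by (rule test_functions_laplacian[OF \<phi>])
  have le_u: "(LINT x|?M. (norm (\<phi> n x))\<^sup>2) \<le> (\<omega> n)\<^sup>2" for n
    unfolding sq(2)[OF \<phi>] by (rule le)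
  have le_g: "(LINT x|?M. (norm (grad (\<phi> n) x))\<^sup>2) \<le> (\<omega> n)\<^sup>2" for n
    unfolding sqg(2)[OF \<phi>] by (rule integral_grad_sq_le[OF \<phi> le])
  have le_l: "(LINT x|?M. (norm (laplacian (\<phi> n) x))\<^sup>2) \<le> (\<omega> n)\<^sup>2" for n
    unfolding sq(2)[OF lap] by (rule le)
  note U = square_integrable_series[OF sq(1)[OF \<phi>] le_u \<omega>, folded u_def, folded S_def]
  note GG = square_integrable_series[OF sqg(1)[OF \<phi>] le_g \<omega>, folded G_def]
  note LL = square_integrable_series[OF sq(1)[OF lap] le_l \<omega>, folded L_def]
  have wg: "has_weak_grad \<Omega> u G"
  proof (rule has_weak_gradI[OF \<Omega>])
    show "u locally_integrable_on \<Omega>" "G locally_integrable_on \<Omega>"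
      using U(2) GG(2) by (auto intro!: locally_integrable_on_L2_on[OF \<Omega>] simp: L2_on_iff)
    fix \<psi> b assume \<psi>: "\<psi> \<in> test_functions \<Omega>" and b: "b \<in> (Basis :: 'a set)"
    have "(\<lambda>m. LINT x|?M. S m x \<bullet> pd b \<psi> x) \<longlonglongrightarrow> (LINT x|?M. u x \<bullet> pd b \<psi> x)"
      by (rule U(4)[OF sq(1)[OF test_functions_pd[OF \<psi> b]]])
    then have 1: "(\<lambda>m. LINT x|?M. pd b \<psi> x * S m x) \<longlonglongrightarrow> (LINT x|?M. pd b \<psi> x * u x)"
      by (simp only: inner_real_def mult.commute)
    have \<psi>b: "square_integrable ?M (\<lambda>x. \<psi> x *\<^sub>R b)"
      using sq(1)[OF \<psi>] b by (simp add: square_integrable_def borel_measurable_scaleR)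
    have "(\<lambda>m. LINT x|?M. (\<Sum>n<m. grad (\<phi> n) x) \<bullet> (\<psi> x *\<^sub>R b)) \<longlonglongrightarrow> (LINT x|?M. G x \<bullet> (\<psi> x *\<^sub>R b))"
      by (rule GG(4)[OF \<psi>b])
    then have "(\<lambda>m. LINT x|?M. \<psi> x * (grad (S m) x \<bullet> b)) \<longlonglongrightarrow> (LINT x|?M. \<psi> x * (G x \<bullet> b))"
      unfolding gradS by (simp only: inner_scaleR_right)
    then have "(\<lambda>m. - (LINT x|?M. \<psi> x * (grad (S m) x \<bullet> b))) \<longlonglongrightarrow> - (LINT x|?M. \<psi> x * (G x \<bullet> b))"
      by (rule tendsto_minus)
    then have 2: "(\<lambda>m. LINT x|?M. pd b \<psi> x * S m x) \<longlonglongrightarrow> - (LINT x|?M. \<psi> x * (G x \<bullet> b))"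
      unfolding has_weak_gradD[OF \<Omega> has_weak_grad_test_function[OF \<Omega> S] \<psi> b] .
    show "(LINT x|?M. pd b \<psi> x * u x) = - (LINT x|?M. \<psi> x * (G x \<bullet> b))"
      by (rule LIMSEQ_unique[OF 1 2])
  qed
  have uH1: "u \<in> H1 \<Omega>"
    using U(2) GG(2) wg by (auto simp: H1_def L2_on_iff)
  \<comment> \<open>The partial sums themselves are the approximating test functions demanded by
    \<open>H10\<close>.\<close>
  have "(\<lambda>m. H1_norm \<Omega> (\<lambda>x. S m x - u x)) \<longlonglongrightarrow> 0"
  proof (subst tendsto_H1_norm_iff[OF \<Omega>])
    show "square_integrable ?M (\<lambda>x. grad (S m) x - G x)" for m
      by (rule square_integrable_diff[OF sqg(1)[OF S] GG(2)])
    show "has_weak_grad \<Omega> (\<lambda>x. S m x - u x) (\<lambda>x. grad (S m) x - G x)" for m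
      by (rule has_weak_grad_diff[OF \<Omega> has_weak_grad_test_function[OF \<Omega> S] wg])
    show "(\<lambda>m. LINT x|?M. (norm (S m x - u x))\<^sup>2) \<longlonglongrightarrow> 0 \<and> (\<lambda>m. LINT x|?M. (norm (grad (S m) x - G x))\<^sup>2) \<longlonglongrightarrow> 0"
      unfolding gradS using U(3) GG(3) by (rule conjI)
  qed
  then have uH10: "u \<in> H10 \<Omega>"
    using S uH1 unfolding H10_def by blast
  \<comment> \<open>For fixed \<open>v\<close> the equation holds for each partial sum, and both
    sides are mean square pairings whose limits are known.\<close>
  have eq: "(LINT x|?M. weak_grad \<Omega> u x \<bullet> weak_grad \<Omega> v x) = (LINT x|?M. (- L x) * v x)" if v: "v \<in> H10 \<Omega>" for v
  proof -
    have vH1: "v \<in> H1 \<Omega>" using v by (simp add: H10_def)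
    note V = H1D[OF \<Omega> vH1]
    note GU = H1D[OF \<Omega> uH1]
    have "AE x in ?M. G x \<bullet> weak_grad \<Omega> v x = weak_grad \<Omega> u x \<bullet> weak_grad \<Omega> v x"
      using weak_grad_AE(2)[OF \<Omega> wg] by eventually_elim simp
    then have "(LINT x|?M. weak_grad \<Omega> u x \<bullet> weak_grad \<Omega> v x) = (LINT x|?M. G x \<bullet> weak_grad \<Omega> v x)"
      using integrable_inner_square_integrable[OF GG(2) V(3)] integrable_inner_square_integrable[OF GU(3) V(3)]
      by (intro integral_cong_AE) (auto dest: borel_measurable_integrable)
    moreover have 1: "(\<lambda>m. LINT x|?M. grad (S m) x \<bullet> weak_grad \<Omega> v x) \<longlonglongrightarrow> (LINT x|?M. G x \<bullet> weak_grad \<Omega> v x)"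
      unfolding gradS by (rule GG(4)[OF V(3)])
    moreover have "(\<lambda>m. - (LINT x|?M. laplacian (S m) x \<bullet> v x)) \<longlonglongrightarrow> - (LINT x|?M. L x \<bullet> v x)"
      unfolding fun_cong[OF lapS] by (rule tendsto_minus[OF LL(4)[OF V(1)]])
    then have 2: "(\<lambda>m. LINT x|?M. grad (S m) x \<bullet> weak_grad \<Omega> v x) \<longlonglongrightarrow> - (LINT x|?M. L x * v x)"
      unfolding integral_grad_inner_weak_grad[OF \<Omega> S V(2)] inner_real_def .
    ultimately show ?thesis
      using LIMSEQ_unique[OF 1 2] by simp
  qed
  have "(\<lambda>x. - L x) \<in> L2_on \<Omega>"
    using LL(2) by (simp add: L2_on_iff square_integrable_def)
  moreover have "weak_solution \<Omega> (\<lambda>x. - L x) u"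
    unfolding weak_solution_def using uH10 eq by blast
  moreover have "AE x in ?M. summable (\<lambda>n. \<phi> n x)"
    using U(1) by eventually_elim (simp add: summable_rabs_cancel)
  ultimately show ?thesis
    using that unfolding u_def by blast
qed

text \<open>Testing both equations with the difference shows that its weak gradient vanishes. The
  Poincare inequality is known only for test functions, so it is applied to an approximating
  sequence, whose gradients then tend to 0.\<close>

lemma weak_solution_unique:
  assumes \<Omega>: "open \<Omega>" "bounded \<Omega>" and u: "weak_solution \<Omega> F u" and u': "weak_solution \<Omega> F u'"
  shows "AE x in lebesgue_on \<Omega>. u x = u' x"
proof -
  let ?M = "lebesgue_on \<Omega>"
  let ?G = "\<lambda>x. weak_grad \<Omega> u x - weak_grad \<Omega> u' x"
  let ?w = "\<lambda>x. u x - u' x"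
  have uH: "u \<in> H10 \<Omega>" and u'H: "u' \<in> H10 \<Omega>" using u u' by (auto simp: weak_solution_def)
  then have uH1: "u \<in> H1 \<Omega>" and u'H1: "u' \<in> H1 \<Omega>" by (auto simp: H10_def)
  note U = H1D[OF \<Omega>(1) uH1] and U' = H1D[OF \<Omega>(1) u'H1]
  have w: "square_integrable ?M ?w" by (rule square_integrable_diff[OF U(1) U'(1)])
  have Gs: "square_integrable ?M ?G" by (rule square_integrable_diff[OF U(3) U'(3)])
  have wg: "has_weak_grad \<Omega> ?w ?G" by (rule has_weak_grad_diff[OF \<Omega>(1) U(2) U'(2)])
  have wH1: "?w \<in> H1 \<Omega>" using w Gs wg by (auto simp: H1_def L2_on_iff)
  note W = H1D[OF \<Omega>(1) wH1]
  have approx: "\<exists>\<phi>. (\<forall>n::nat. \<phi> n \<in> test_functions \<Omega>) \<and> (\<lambda>n. LINT x|?M. (norm (\<phi> n x - v x))\<^sup>2) \<longlonglongrightarrow> 0 \<and>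
      (\<lambda>n. LINT x|?M. (norm (grad (\<phi> n) x - weak_grad \<Omega> v x))\<^sup>2) \<longlonglongrightarrow> 0" if "v \<in> H10 \<Omega>" for v
  proof -
    obtain \<phi> where \<phi>: "\<And>n::nat. \<phi> n \<in> test_functions \<Omega>" "(\<lambda>n. H1_norm \<Omega> (\<lambda>x. \<phi> n x - v x)) \<longlonglongrightarrow> 0"
      using \<open>v \<in> H10 \<Omega>\<close> by (auto simp: H10_def)
    have "v \<in> H1 \<Omega>" using \<open>v \<in> H10 \<Omega>\<close> by (auto simp: H10_def)
    note V = H1D[OF \<Omega>(1) this]
    have "square_integrable ?M (\<lambda>x. grad (\<phi> n) x - weak_grad \<Omega> v x)" for n
      using test_function_L2_on(2)[OF \<Omega>(1) \<phi>(1)] V(3) unfolding L2_on_iff by (rule square_integrable_diff)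
    moreover have "has_weak_grad \<Omega> (\<lambda>x. \<phi> n x - v x) (\<lambda>x. grad (\<phi> n) x - weak_grad \<Omega> v x)" for n
      by (rule has_weak_grad_diff[OF \<Omega>(1) has_weak_grad_test_function[OF \<Omega>(1) \<phi>(1)] V(2)])
    ultimately show ?thesis
      using tendsto_H1_norm_iff[OF \<Omega>(1), of "\<lambda>n x. grad (\<phi> n) x - weak_grad \<Omega> v x" "\<lambda>n x. \<phi> n x - v x"] \<phi> by blast
  qed
  obtain \<phi> where \<phi>: "\<And>n::nat. \<phi> n \<in> test_functions \<Omega>" "(\<lambda>n. LINT x|?M. (norm (\<phi> n x - u x))\<^sup>2) \<longlonglongrightarrow> 0"
      "(\<lambda>n. LINT x|?M. (norm (grad (\<phi> n) x - weak_grad \<Omega> u x))\<^sup>2) \<longlonglongrightarrow> 0"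
    using approx[OF uH] by blast
  obtain \<psi> where \<psi>: "\<And>n::nat. \<psi> n \<in> test_functions \<Omega>" "(\<lambda>n. LINT x|?M. (norm (\<psi> n x - u' x))\<^sup>2) \<longlonglongrightarrow> 0"
      "(\<lambda>n. LINT x|?M. (norm (grad (\<psi> n) x - weak_grad \<Omega> u' x))\<^sup>2) \<longlonglongrightarrow> 0"
    using approx[OF u'H] by blast
  \<comment> \<open>Differences of the two approximating sequences show that the difference of the
    solutions is an admissible test element.\<close>
  define \<eta> where "\<eta> n x = \<phi> n x - \<psi> n x" for n x
  have \<eta>: "\<eta> n \<in> test_functions \<Omega>" for n
    unfolding \<eta>_def by (rule test_functions_diff[OF \<phi>(1) \<psi>(1)])
  have grad_\<eta>: "grad (\<eta> n) = (\<lambda>x. grad (\<phi> n) x - grad (\<psi> n) x)" for n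
    unfolding \<eta>_def by (rule grad_diff[OF test_functionsD(1)[OF \<phi>(1)] test_functionsD(1)[OF \<psi>(1)]])
  have L2: "square_integrable ?M f" "square_integrable ?M (grad f)" if "f \<in> test_functions \<Omega>" for f
    using test_function_L2_on[OF \<Omega>(1) that] by (simp_all add: L2_on_iff)
  have lim_diff: "(\<lambda>n. LINT x|?M. (norm ((f n x - g n x) - (p x - q x)))\<^sup>2) \<longlonglongrightarrow> 0"
    if "(\<lambda>n. LINT x|?M. (norm (f n x - p x))\<^sup>2) \<longlonglongrightarrow> 0" "(\<lambda>n. LINT x|?M. (norm (g n x - q x))\<^sup>2) \<longlonglongrightarrow> 0"
      "\<And>n. square_integrable ?M (f n)" "\<And>n. square_integrable ?M (g n)" "square_integrable ?M p" "square_integrable ?M q"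
    for f g :: "nat \<Rightarrow> 'a \<Rightarrow> 'b::euclidean_space" and p q
  proof (rule tendsto_sandwich[OF _ _ tendsto_const])
    show "eventually (\<lambda>n. 0 \<le> (LINT x|?M. (norm ((f n x - g n x) - (p x - q x)))\<^sup>2)) sequentially"
      by (intro always_eventually allI Bochner_Integration.integral_nonneg) simp
    have "(LINT x|?M. (norm ((f n x - p x) - (g n x - q x)))\<^sup>2) \<le>
        2 * (LINT x|?M. (norm (f n x - p x))\<^sup>2) + 2 * (LINT x|?M. (norm (g n x - q x))\<^sup>2)" for n
      by (intro integral_norm_diff_sq_le square_integrable_diff that)
    moreover have "(f n x - p x) - (g n x - q x) = (f n x - g n x) - (p x - q x)" for n x by simp
    ultimately show "eventually (\<lambda>n. (LINT x|?M. (norm ((f n x - g n x) - (p x - q x)))\<^sup>2) \<le>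
        2 * (LINT x|?M. (norm (f n x - p x))\<^sup>2) + 2 * (LINT x|?M. (norm (g n x - q x))\<^sup>2)) sequentially"
      by (intro always_eventually allI) simp
    have "(\<lambda>n. 2 * (LINT x|?M. (norm (f n x - p x))\<^sup>2) + 2 * (LINT x|?M. (norm (g n x - q x))\<^sup>2)) \<longlonglongrightarrow> 2 * 0 + 2 * 0"
      by (intro tendsto_intros that)
    then show "(\<lambda>n. 2 * (LINT x|?M. (norm (f n x - p x))\<^sup>2) + 2 * (LINT x|?M. (norm (g n x - q x))\<^sup>2)) \<longlonglongrightarrow> 0" by simp
  qed
  have lim_\<eta>: "(\<lambda>n. LINT x|?M. (norm (\<eta> n x - ?w x))\<^sup>2) \<longlonglongrightarrow> 0"
    unfolding \<eta>_def by (rule lim_diff[OF \<phi>(2) \<psi>(2) L2(1)[OF \<phi>(1)] L2(1)[OF \<psi>(1)] U(1) U'(1)])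
  have lim_grad_\<eta>: "(\<lambda>n. LINT x|?M. (norm (grad (\<eta> n) x - ?G x))\<^sup>2) \<longlonglongrightarrow> 0"
    unfolding grad_\<eta> by (rule lim_diff[OF \<phi>(3) \<psi>(3) L2(2)[OF \<phi>(1)] L2(2)[OF \<psi>(1)] U(3) U'(3)])
  have "(\<lambda>n. H1_norm \<Omega> (\<lambda>x. \<eta> n x - ?w x)) \<longlonglongrightarrow> 0"
  proof (subst tendsto_H1_norm_iff[OF \<Omega>(1)])
    show "square_integrable ?M (\<lambda>x. grad (\<eta> n) x - ?G x)" for n
      by (rule square_integrable_diff[OF L2(2)[OF \<eta>] Gs])
    show "has_weak_grad \<Omega> (\<lambda>x. \<eta> n x - ?w x) (\<lambda>x. grad (\<eta> n) x - ?G x)" for n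
      by (rule has_weak_grad_diff[OF \<Omega>(1) has_weak_grad_test_function[OF \<Omega>(1) \<eta>] wg])
  qed (use lim_\<eta> lim_grad_\<eta> in blast)
  then have wH10: "?w \<in> H10 \<Omega>"
    using wH1 \<eta> unfolding H10_def by blast
  have "(LINT x|?M. weak_grad \<Omega> u x \<bullet> weak_grad \<Omega> ?w x) = (LINT x|?M. weak_grad \<Omega> u' x \<bullet> weak_grad \<Omega> ?w x)"
    using u u' wH10 unfolding weak_solution_def by metis
  then have "(LINT x|?M. ?G x \<bullet> weak_grad \<Omega> ?w x) = 0"
    unfolding inner_diff_left
    by (subst Bochner_Integration.integral_diff)
      (auto intro!: integrable_inner_square_integrable U(3) U'(3) W(3))
  moreover have ae: "AE x in ?M. (norm (?G x))\<^sup>2 = ?G x \<bullet> weak_grad \<Omega> ?w x"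
    using weak_grad_AE(2)[OF \<Omega>(1) wg] by eventually_elim (simp add: power2_norm_eq_inner)
  have "(LINT x|?M. (norm (?G x))\<^sup>2) = (LINT x|?M. ?G x \<bullet> weak_grad \<Omega> ?w x)"
    using ae Gs integrable_inner_square_integrable[OF Gs W(3)]
    by (intro integral_cong_AE) (auto simp: square_integrable_def dest: borel_measurable_integrable)
  ultimately have G0: "AE x in ?M. ?G x = 0"
    using square_integrable_integral_eq_0_iff[OF Gs] by simp
  \<comment> \<open>Because \<open>?G\<close> vanishes almost everywhere, the convergence of the
    gradients of \<open>\<eta> n\<close> to \<open>?G\<close> is convergence to 0.\<close>
  have grad_eq: "(LINT x|?M. (norm (grad (\<eta> n) x - ?G x))\<^sup>2) = (LINT x|?M. (norm (grad (\<eta> n) x))\<^sup>2)" for n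
  proof (rule square_integrable_AE_cong(2)[OF \<Omega>(1) L2(2)[OF \<eta>]])
    show "AE x in ?M. grad (\<eta> n) x = grad (\<eta> n) x - ?G x"
      using G0 by eventually_elim simp
  qed
  obtain C where C: "\<And>\<phi>. \<phi> \<in> test_functions \<Omega> \<Longrightarrow>
    (LINT x|lebesgue. (\<phi> x)\<^sup>2) \<le> C * (LINT x|lebesgue. (norm (grad \<phi> x))\<^sup>2)"
    using poincare_inequality[OF \<Omega>(2)] by blast
  have eq: "(LINT x|?M. (norm (\<eta> n x))\<^sup>2) = (LINT x|lebesgue. (\<eta> n x)\<^sup>2)"
    "(LINT x|?M. (norm (grad (\<eta> n) x))\<^sup>2) = (LINT x|lebesgue. (norm (grad (\<eta> n) x))\<^sup>2)" for n
    using square_integrable_bounded_support(2)[OF \<Omega>(1) test_functionsD(6,3)[OF \<eta>] test_functionsD(5)[OF \<eta>], of n]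
      square_integrable_bounded_support(2)[OF \<Omega>(1) continuous_on_grad[OF \<eta>]
        bounded_support_grad[OF test_functionsD(3)[OF \<eta>]] grad_outside[OF \<eta>], of n] by simp_all
  have le: "(LINT x|?M. (norm (?w x))\<^sup>2) \<le>
      2 * (C * (LINT x|?M. (norm (grad (\<eta> n) x - ?G x))\<^sup>2)) + 2 * (LINT x|?M. (norm (\<eta> n x - ?w x))\<^sup>2)" for n
  proof -
    have "(LINT x|?M. (norm (\<eta> n x - (\<eta> n x - ?w x)))\<^sup>2) \<le>
        2 * (LINT x|?M. (norm (\<eta> n x))\<^sup>2) + 2 * (LINT x|?M. (norm (\<eta> n x - ?w x))\<^sup>2)"
      by (intro integral_norm_diff_sq_le square_integrable_diff L2(1)[OF \<eta>] U(1) U'(1))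
    moreover have "(LINT x|?M. (norm (\<eta> n x))\<^sup>2) \<le> C * (LINT x|?M. (norm (grad (\<eta> n) x - ?G x))\<^sup>2)"
      unfolding grad_eq eq by (rule C[OF \<eta>])
    ultimately show ?thesis by simp
  qed
  have "(\<lambda>n. 2 * (C * (LINT x|?M. (norm (grad (\<eta> n) x - ?G x))\<^sup>2)) + 2 * (LINT x|?M. (norm (\<eta> n x - ?w x))\<^sup>2))
      \<longlonglongrightarrow> 2 * (C * 0) + 2 * 0"
    by (intro tendsto_intros lim_grad_\<eta> lim_\<eta>)
  then have "(LINT x|?M. (norm (?w x))\<^sup>2) \<le> 2 * (C * 0) + 2 * 0"
    using le by (intro LIMSEQ_le_const) auto
  moreover have "0 \<le> (LINT x|?M. (norm (?w x))\<^sup>2)"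
    by (rule Bochner_Integration.integral_nonneg) simp
  ultimately have "(LINT x|?M. (norm (?w x))\<^sup>2) = 0" by linarith
  then have "AE x in ?M. ?w x = 0"
    using square_integrable_integral_eq_0_iff[OF w] by blast
  then show ?thesis by simp
qed

section \<open>Hausdorff measure and dimension\<close>

text \<open>No bound on the diameters has to be checked: a cover whose total cost is below
  \<open>\<delta> powr t\<close> consists of sets of diameter at most
  \<open>\<delta>\<close>.\<close>

lemma hausdorff_measure_eq_0I:
  fixes A :: "'a::metric_space set"
  assumes t: "0 < t"
    and cover: "\<And>e::real. 0 < e \<Longrightarrow> \<exists>U::nat \<Rightarrow> 'a set. A \<subseteq> (\<Union>n. U n) \<and> (\<forall>n. bounded (U n)) \<and>
      (\<Sum>n. ennreal (diam_pow t (U n))) < ennreal e"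
  shows "hausdorff_measure t A = 0"
proof -
  have "hausdorff_premeasure t \<delta> A \<le> 0" if \<delta>: "0 < \<delta>" for \<delta>
  proof (rule ennreal_le_epsilon)
    fix e :: real assume e: "0 < e"
    obtain U :: "nat \<Rightarrow> 'a set" where U: "A \<subseteq> (\<Union>n. U n)" "\<And>n. bounded (U n)"
        "(\<Sum>n. ennreal (diam_pow t (U n))) < ennreal (min e (\<delta> powr t))"
      using cover[of "min e (\<delta> powr t)"] e \<delta> by auto
    have "diameter (U n) \<le> \<delta>" for n
    proof (cases "U n = {}")
      case False
      have "ennreal (diam_pow t (U n)) \<le> (\<Sum>n. ennreal (diam_pow t (U n)))"
        using sum_le_suminf[of "\<lambda>n. ennreal (diam_pow t (U n))" "{n}"] by simp
      also have "\<dots> < ennreal (\<delta> powr t)"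
        using U(3) by (rule less_le_trans) (simp add: ennreal_leI)
      finally have "diameter (U n) powr t < \<delta> powr t"
        using False t by (simp add: diam_pow_def ennreal_less_iff)
      then show ?thesis
        using t \<delta> powr_mono2[of t \<delta> "diameter (U n)"] by force
    qed (use \<delta> in simp)
    then have "hausdorff_premeasure t \<delta> A \<le> (\<Sum>n. ennreal (diam_pow t (U n)))"
      unfolding hausdorff_premeasure_def using U by (intro INF_lower) auto
    also have "\<dots> \<le> ennreal e"
      using U(3) by (intro less_imp_le, elim less_le_trans) (simp add: ennreal_leI)
    finally show "hausdorff_premeasure t \<delta> A \<le> 0 + ennreal e" by simp
  qed
  then show ?thesis
    unfolding hausdorff_measure_def by (simp add: SUP_eq_const)
qed

lemma hausdorff_measure_eq_0D:
  fixes A :: "'a::metric_space set"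
  assumes "hausdorff_measure t A = 0" "0 < (e::real)" "0 < \<delta>"
  obtains U :: "nat \<Rightarrow> 'a set" where "A \<subseteq> (\<Union>n. U n)" "\<And>n. bounded (U n)" "\<And>n. diameter (U n) \<le> \<delta>"
    "(\<Sum>n. ennreal (diam_pow t (U n))) < ennreal e"
proof -
  have "hausdorff_premeasure t \<delta> A \<le> hausdorff_measure t A"
    unfolding hausdorff_measure_def using assms(3) by (intro SUP_upper) auto
  then have "hausdorff_premeasure t \<delta> A < ennreal e"
    using assms by simp
  then show ?thesis
    using that unfolding hausdorff_premeasure_def INF_less_iff by blast
qed

lemma hausdorff_measure_UN_eq_0:
  fixes A :: "nat \<Rightarrow> 'a::metric_space set"
  assumes t: "0 < t" and A: "\<And>j. hausdorff_measure t (A j) = 0"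
  shows "hausdorff_measure t (\<Union>j. A j) = 0"
proof (rule hausdorff_measure_eq_0I[OF t])
  fix e :: real assume e: "0 < e"
  \<comment> \<open>The factor 1 / 4 makes the geometric series sum to e / 2, which keeps the final
    inequality strict.\<close>
  have "\<exists>U::nat \<Rightarrow> 'a set. A j \<subseteq> (\<Union>n. U n) \<and> (\<forall>n. bounded (U n)) \<and>
      (\<Sum>n. ennreal (diam_pow t (U n))) < ennreal (e / 4 * (1 / 2) ^ j)" for j
    by (rule hausdorff_measure_eq_0D[OF A[of j], of "e / 4 * (1 / 2) ^ j" 1]) (use e in auto)
  then obtain U :: "nat \<Rightarrow> nat \<Rightarrow> 'a set" where U: "\<And>j. A j \<subseteq> (\<Union>n. U j n)" "\<And>j n. bounded (U j n)"
      "\<And>j. (\<Sum>n. ennreal (diam_pow t (U j n))) < ennreal (e / 4 * (1 / 2) ^ j)"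
    by metis
  let ?V = "\<lambda>i. case prod_decode i of (j, n) \<Rightarrow> U j n"
  have "(\<Sum>i. ennreal (diam_pow t (?V i))) = (\<Sum>j n. ennreal (diam_pow t (U j n)))"
    using suminf_ennreal_2dimen[of "\<lambda>j. \<Sum>n. ennreal (diam_pow t (U j n))" "\<lambda>(j, n). ennreal (diam_pow t (U j n))"]
    by (simp add: prod.case_distrib)
  also have "\<dots> \<le> (\<Sum>j. ennreal (e / 4 * (1 / 2) ^ j))"
    using U(3) by (intro suminf_le summableI) (auto intro: less_imp_le)
  also have "\<dots> = ennreal (\<Sum>j. e / 4 * (1 / 2) ^ j)"
    using e by (intro suminf_ennreal2 summable_mult summable_geometric) auto
  also have "\<dots> = ennreal (e / 2)"
    by (subst suminf_mult) (auto simp: suminf_geometric)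
  also have "\<dots> < ennreal e" using e by (simp add: ennreal_less_iff)
  finally have "(\<Sum>i. ennreal (diam_pow t (?V i))) < ennreal e" .
  moreover have "(\<Union>j. A j) \<subseteq> (\<Union>i. ?V i)"
  proof
    fix x assume "x \<in> (\<Union>j. A j)"
    then obtain j n where "x \<in> U j n" using U(1) by blast
    then have "x \<in> ?V (prod_encode (j, n))" by simp
    then show "x \<in> (\<Union>i. ?V i)" by (rule UN_I[OF UNIV_I])
  qed
  moreover have "bounded (?V i)" for i
    using U(2) by (cases "prod_decode i") simp
  ultimately show "\<exists>U::nat \<Rightarrow> 'a set. (\<Union>j. A j) \<subseteq> (\<Union>n. U n) \<and> (\<forall>n. bounded (U n)) \<and>
      (\<Sum>n. ennreal (diam_pow t (U n))) < ennreal e"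
    by (intro exI[of _ ?V]) auto
qed

lemma hausdorff_measure_Un_eq_0:
  assumes "0 < t" "hausdorff_measure t A = 0" "hausdorff_measure t B = 0"
  shows "hausdorff_measure t (A \<union> B) = 0"
proof -
  have "hausdorff_measure t (\<Union>j. if j = (0::nat) then A else B) = 0"
    using assms by (intro hausdorff_measure_UN_eq_0) auto
  moreover have "A \<union> B \<subseteq> (\<Union>j. if j = (0::nat) then A else B)"
    by (auto split: if_splits intro: exI[of _ 0] exI[of _ 1])
  ultimately show ?thesis
    using hausdorff_measure_mono[of "A \<union> B" _ t] by (metis le_zero_eq)
qed

lemma hausdorff_measure_eq_0_finite_covers:
  fixes A :: "'a::metric_space set"
  assumes t: "0 < t"
    and cover: "\<And>e::real. 0 < e \<Longrightarrow> \<exists>\<F> d. finite \<F> \<and> A \<subseteq> \<Union>\<F> \<and> (\<forall>X\<in>\<F>. bounded X \<and> diameter X \<le> d) \<and>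
      0 \<le> d \<and> card \<F> * d powr t < e"
  shows "hausdorff_measure t A = 0"
proof (rule hausdorff_measure_eq_0I[OF t])
  fix e :: real assume e: "0 < e"
  obtain \<F> d where F: "finite \<F>" "A \<subseteq> \<Union>\<F>" "\<And>X. X \<in> \<F> \<Longrightarrow> bounded X" "\<And>X. X \<in> \<F> \<Longrightarrow> diameter X \<le> d"
      "0 \<le> d" "card \<F> * d powr t < e"
    using cover[OF e] by blast
  obtain h where h: "bij_betw h {..<card \<F>} \<F>"
    using ex_bij_betw_nat_finite[OF F(1)] by (auto simp: atLeast0LessThan)
  \<comment> \<open>Padding with empty sets is free, since \<open>diam_pow\<close> of the empty set
    is 0.\<close>
  define U where "U n = (if n < card \<F> then h n else {})" for n
  have hF: "h n \<in> \<F>" if "n < card \<F>" for n using h that by (auto simp: bij_betw_def)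
  have "(\<Sum>n. ennreal (diam_pow t (U n))) = (\<Sum>n<card \<F>. ennreal (diam_pow t (U n)))"
    by (rule suminf_finite) (auto simp: U_def diam_pow_def)
  also have "\<dots> \<le> (\<Sum>n<card \<F>. ennreal (d powr t))"
  proof (rule sum_mono)
    fix n assume "n \<in> {..<card \<F>}"
    then have "diameter (U n) \<le> d" "bounded (U n)" using F hF by (auto simp: U_def)
    then have "diam_pow t (U n) \<le> d powr t"
      using t diameter_ge_0[of "U n"] by (auto simp: diam_pow_def intro!: powr_mono2)
    then show "ennreal (diam_pow t (U n)) \<le> ennreal (d powr t)" by (rule ennreal_leI)
  qed
  also have "\<dots> = ennreal (card \<F> * d powr t)"
    by (simp add: ennreal_mult ennreal_of_nat_eq_real_of_nat)
  also have "\<dots> < ennreal e" using F(6) e by (simp add: ennreal_less_iff)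
  finally have "(\<Sum>n. ennreal (diam_pow t (U n))) < ennreal e" .
  moreover have "\<Union>\<F> = (\<Union>n\<in>{..<card \<F>}. h n)"
    using h by (simp add: bij_betw_def)
  then have "A \<subseteq> (\<Union>n. U n)" using F(2) by (fastforce simp: U_def)
  moreover have "bounded (U n)" for n using F(3) hF by (auto simp: U_def)
  ultimately show "\<exists>U::nat \<Rightarrow> 'a set. A \<subseteq> (\<Union>n. U n) \<and> (\<forall>n. bounded (U n)) \<and>
      (\<Sum>n. ennreal (diam_pow t (U n))) < ennreal e" by blast
qed

text \<open>Every tail of the sequence is a cover. For diameters at most 1 and
  \<open>t \<ge> 1\<close> the t-th power is at most the diameter itself, so the tails cost no more
  than tails of a geometric series.\<close>

lemma hausdorff_measure_eq_0_limsup: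
  fixes A :: "'a::metric_space set"
  assumes t: "1 \<le> t" and A: "\<And>J. A \<subseteq> (\<Union>j\<in>{J..}. B j)"
    and B: "\<And>j::nat. bounded (B j)" "\<And>j. diameter (B j) \<le> (1 / 2) ^ j"
  shows "hausdorff_measure t A = 0"
proof (rule hausdorff_measure_eq_0I)
  show "0 < t" using t by simp
  fix e :: real assume e: "0 < e"
  obtain J where J: "(1 / 2) ^ J < e / 2"
    using real_arch_pow_inv[of "e / 2" "1 / 2"] e by auto
  have le: "diam_pow t (B j) \<le> (1 / 2) ^ j" for j
  proof -
    have d: "0 \<le> diameter (B j)" "diameter (B j) \<le> 1"
      using B(2)[of j] power_le_one[of "1 / 2 :: real" j] diameter_ge_0[OF B(1)] by auto
    have "diameter (B j) powr t \<le> diameter (B j)"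
      using powr_mono'[of 1 t "diameter (B j)"] d t by (cases "diameter (B j) = 0") auto
    then show ?thesis using B(2)[of j] t by (auto simp: diam_pow_def)
  qed
  have "diam_pow t (B (n + J)) \<le> (1 / 2) ^ J * (1 / 2) ^ n" for n
    using le[of "n + J"] by (simp add: power_add mult.commute)
  then have "(\<Sum>n. ennreal (diam_pow t (B (n + J)))) \<le> (\<Sum>n. ennreal ((1 / 2) ^ J * (1 / 2) ^ n))"
    by (intro suminf_le summableI ennreal_leI)
  also have "\<dots> = ennreal (\<Sum>n. (1 / 2) ^ J * (1 / 2) ^ n)"
    by (intro suminf_ennreal2 summable_mult summable_geometric) auto
  also have "\<dots> = ennreal ((1 / 2) ^ J * 2)"
    by (subst suminf_mult) (auto simp: suminf_geometric)
  also have "\<dots> < ennreal e" using J e by (simp add: ennreal_less_iff)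
  finally have "(\<Sum>n. ennreal (diam_pow t (B (n + J)))) < ennreal e" .
  moreover have "A \<subseteq> (\<Union>n. B (n + J))"
  proof
    fix x assume "x \<in> A"
    then obtain j where "J \<le> j" "x \<in> B j" using A[of J] by blast
    then show "x \<in> (\<Union>n. B (n + J))" by (auto intro!: exI[of _ "j - J"])
  qed
  ultimately show "\<exists>U::nat \<Rightarrow> 'a set. A \<subseteq> (\<Union>n. U n) \<and> (\<forall>n. bounded (U n)) \<and>
      (\<Sum>n. ennreal (diam_pow t (U n))) < ennreal e"
    using B(1) by (intro exI[of _ "\<lambda>n. B (n + J)"]) auto
qed

section \<open>Upper and lower bounds for the Hausdorff dimension\<close>

lemma hausdorff_dim_le: "0 \<le> t \<Longrightarrow> hausdorff_measure t A = 0 \<Longrightarrow> hausdorff_dim A \<le> ereal t"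
  unfolding hausdorff_dim_def by (intro INF_lower) auto

lemma hausdorff_dim_ge:
  assumes "\<And>t. 0 \<le> t \<Longrightarrow> t < s \<Longrightarrow> hausdorff_measure t A \<noteq> 0"
  shows "ereal s \<le> hausdorff_dim A"
  unfolding hausdorff_dim_def using assms by (intro INF_greatest) (auto simp: not_less[symmetric])

text \<open>If the inverse of a parametrisation by the unit cube is Hoelder continuous, then a cover of the
  image by sets \<open>U n\<close> yields a cover of the cube by cubes of volume at most a multiple of
  \<open>diameter (U n) powr s\<close>.\<close>

lemma hausdorff_dim_ge_parametrisation:
  fixes G :: "'a::euclidean_space \<Rightarrow> 'b::metric_space"
  assumes s: "0 < s" and K: "0 < K"
    and G: "\<And>x y b. x \<in> D \<Longrightarrow> y \<in> D \<Longrightarrow> b \<in> Basis \<Longrightarrow>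
      \<bar>x \<bullet> b - y \<bullet> b\<bar> ^ DIM('a) \<le> K * dist (G x) (G y) powr s"
    and D: "box 0 One \<subseteq> D"
  shows "ereal s \<le> hausdorff_dim (G ` D)"
proof (rule hausdorff_dim_ge)
  fix t assume t: "0 \<le> t" "t < s"
  let ?N = "DIM('a)"
  show "hausdorff_measure t (G ` D) \<noteq> 0"
  proof
    assume "hausdorff_measure t (G ` D) = 0"
    \<comment> \<open>A cube around a preimage of \<open>U n\<close> has volume
      \<open>2 ^ ?N * K\<close> times a power of the diameter; the reciprocal of this factor makes
      the total volume smaller than 1, the volume of the unit cube.\<close>
    then obtain U where U: "G ` D \<subseteq> (\<Union>n::nat. U n)" "\<And>n. bounded (U n)" "\<And>n. diameter (U n) \<le> 1"
        "(\<Sum>n. ennreal (diam_pow t (U n))) < ennreal (1 / (2 ^ ?N * K))"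
      using hausdorff_measure_eq_0D[of t "G ` D" "1 / (2 ^ ?N * K)" 1] K by auto
    define r where "r n = root ?N (K * diameter (U n) powr s)" for n
    have r: "0 \<le> r n" "r n ^ ?N = K * diameter (U n) powr s" for n
      using K by (auto simp: r_def real_root_pow_pos2)
    \<comment> \<open>The choice is arbitrary when \<open>U n\<close> misses the image, which is why
      \<open>W n\<close> is then set to be empty.\<close>
    define p where "p n = (SOME x. x \<in> D \<and> G x \<in> U n)" for n
    define W where "W n = (if \<exists>x\<in>D. G x \<in> U n then cbox (p n - r n *\<^sub>R One) (p n + r n *\<^sub>R One) else {})" for n
    have W: "x \<in> W n" if x: "x \<in> D" "G x \<in> U n" for x n
    proof -
      have p: "p n \<in> D" "G (p n) \<in> U n"
        using someI[of "\<lambda>x. x \<in> D \<and> G x \<in> U n" x] x by (auto simp: p_def)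
      have "\<bar>x \<bullet> b - p n \<bullet> b\<bar> \<le> r n" if b: "b \<in> Basis" for b
      proof -
        have "\<bar>x \<bullet> b - p n \<bullet> b\<bar> ^ ?N \<le> K * dist (G x) (G (p n)) powr s"
          using G x p b by blast
        also have "\<dots> \<le> K * diameter (U n) powr s"
          using diameter_bounded_bound[OF U(2) x(2) p(2)] K s by (intro mult_left_mono powr_mono2) auto
        finally have "\<bar>x \<bullet> b - p n \<bullet> b\<bar> ^ ?N \<le> r n ^ ?N" by (simp add: r)
        then show ?thesis using r(1)[of n] by (simp add: power_mono_iff)
      qed
      then show ?thesis
        using x by (auto simp: W_def mem_box inner_diff_left inner_add_left abs_le_iff algebra_simps)
    qed
    have "box 0 One \<subseteq> (\<Union>n. W n)"
    proof
      fix x :: 'a assume "x \<in> box 0 One"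
      then have "x \<in> D" using D by blast
      then obtain n where "G x \<in> U n" using U(1) by blast
      then show "x \<in> (\<Union>n. W n)" using W[OF \<open>x \<in> D\<close>] by blast
    qed
    then have "emeasure lborel (box (0::'a) One) \<le> emeasure lborel (\<Union>n. W n)"
      by (intro emeasure_mono) (auto simp: W_def)
    also have "\<dots> \<le> (\<Sum>n. emeasure lborel (W n))"
      by (intro emeasure_subadditive_countably) (auto simp: W_def)
    also have "\<dots> \<le> (\<Sum>n. ennreal (2 ^ ?N * K) * ennreal (diam_pow t (U n)))"
    proof (intro suminf_le summableI)
      fix n
      show "emeasure lborel (W n) \<le> ennreal (2 ^ ?N * K) * ennreal (diam_pow t (U n))"
      proof (cases "\<exists>x\<in>D. G x \<in> U n")
        case True
        have "emeasure lborel (W n) = ennreal (\<Prod>b\<in>(Basis::'a set). 2 * r n)"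
          using True r(1)[of n]
          by (auto simp: W_def emeasure_lborel_cbox_eq inner_diff_left inner_add_left algebra_simps intro!: arg_cong[where f=ennreal] prod.cong)
        also have "(\<Prod>b\<in>(Basis::'a set). 2 * r n) = 2 ^ ?N * K * diameter (U n) powr s"
          by (simp add: power_mult_distrib r)
        \<comment> \<open>Diameters at most 1 and \<open>t < s\<close> give the comparison of
          powers.\<close>
        also have "diameter (U n) powr s \<le> diam_pow t (U n)"
        proof (cases "diameter (U n) = 0")
          case False
          have "0 < diameter (U n)" using False diameter_ge_0[OF U(2)[of n]] by simp
          then show ?thesis using t True powr_mono'[of t s "diameter (U n)"] U(3)[of n]
            by (auto simp: diam_pow_def)
        qed (use s in \<open>auto simp: diam_pow_def\<close>)
        then have "ennreal (2 ^ ?N * K * diameter (U n) powr s) \<le> ennreal (2 ^ ?N * K * diam_pow t (U n))"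
          using K by (intro ennreal_leI mult_left_mono) auto
        finally show ?thesis using K by (subst ennreal_mult'[symmetric]) auto
      qed (auto simp: W_def)
    qed
    also have "\<dots> = ennreal (2 ^ ?N * K) * (\<Sum>n. ennreal (diam_pow t (U n)))"
      by simp
    also have "\<dots> < ennreal (2 ^ ?N * K) * ennreal (1 / (2 ^ ?N * K))"
      using U(4) K by (intro ennreal_mult_strict_left_mono) auto
    also have "\<dots> = 1"
      using K by (subst ennreal_mult[symmetric]) auto
    finally show False by (simp add: emeasure_lborel_box_eq)
  qed
qed

section \<open>The Cantor map\<close>

lemma geometric_bracket:
  fixes d r :: real
  assumes "0 < d" "d \<le> 1" "0 < r" "r < 1"
  obtains k where "r ^ Suc k < d" "d \<le> r ^ k"
proof -
  obtain m where "r ^ m < d" using real_arch_pow_inv[OF assms(1,4)] by blast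
  define n where "n = (LEAST m. r ^ m < d)"
  have n: "r ^ n < d" unfolding n_def by (rule LeastI[of _ m]) fact
  then obtain k where k: "n = Suc k" using assms by (cases n) auto
  have "\<not> r ^ k < d" using not_less_Least[of k "\<lambda>m. r ^ m < d"] k by (simp add: n_def)
  then show ?thesis using that[of k] n k by simp
qed

text \<open>The first binary digit after the point, coded as a sign. Through \<open>frac\<close> it
  has period 1, so evaluating it at \<open>2 ^ i * x\<close> reads off the later digits.\<close>

definition cantor_sign :: "real \<Rightarrow> real" where
  "cantor_sign x = (if frac x < 1 / 2 then - 1 else 1)"

text \<open>The Cantor map replaces the base-2 digits 0 and 1 of a number by the digits \<open>-1\<close> and \<open>1\<close> to
  the base \<open>1 / l\<close>.\<close>

definition cantor_map :: "real \<Rightarrow> real \<Rightarrow> real" where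
  "cantor_map l x = (\<Sum>i. l ^ Suc i * cantor_sign (2 ^ i * x))"

lemma cantor_sign_cases: "cantor_sign x = 1 \<or> cantor_sign x = - 1"
  by (simp add: cantor_sign_def)

lemma cantor_sign_add_of_int: "cantor_sign (x + of_int n) = cantor_sign x"
  by (simp add: cantor_sign_def)

lemma cantor_map_add_of_int: "cantor_map l (x + of_int n) = cantor_map l x"
proof -
  have "cantor_sign (2 ^ i * (x + of_int n)) = cantor_sign (2 ^ i * x)" for i
    using cantor_sign_add_of_int[of "2 ^ i * x" "2 ^ i * n"] by (simp add: algebra_simps)
  then show ?thesis by (simp add: cantor_map_def)
qed

lemma abs_cantor_sign: "\<bar>cantor_sign x\<bar> = 1"
  by (simp add: cantor_sign_def)

context
  fixes l :: real
  assumes l: "0 < l" "l < 1 / 2"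
begin

lemma summable_cantor_map: "summable (\<lambda>i. l ^ Suc i * cantor_sign (2 ^ i * x))"
proof (rule summable_comparison_test'[of "\<lambda>i. l * l ^ i" 0])
  show "summable (\<lambda>i. l * l ^ i)" using l by (intro summable_mult summable_geometric) auto
  show "norm (l ^ Suc i * cantor_sign (2 ^ i * x)) \<le> l * l ^ i" for i
    using l by (simp add: abs_mult abs_cantor_sign)
qed

lemma cantor_map_rec: "cantor_map l x = l * (cantor_sign x + cantor_map l (2 * x))"
proof -
  have "cantor_map l x = (\<Sum>i. l ^ Suc (Suc i) * cantor_sign (2 ^ Suc i * x)) + l ^ Suc 0 * cantor_sign (2 ^ 0 * x)"
    unfolding cantor_map_def using suminf_split_head[OF summable_cantor_map[of x]] by simp
  also have "(\<Sum>i. l ^ Suc (Suc i) * cantor_sign (2 ^ Suc i * x)) = (\<Sum>i. l * (l ^ Suc i * cantor_sign (2 ^ i * (2 * x))))"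
    by (simp add: mult_ac)
  also have "\<dots> = l * cantor_map l (2 * x)"
    unfolding cantor_map_def by (rule suminf_mult[OF summable_cantor_map])
  finally show ?thesis by (simp add: algebra_simps)
qed

lemma abs_cantor_map_le: "\<bar>cantor_map l x\<bar> \<le> l / (1 - l)"
proof -
  have s: "summable (\<lambda>i. l * l ^ i)" using l by (intro summable_mult summable_geometric) auto
  have "\<bar>cantor_map l x\<bar> \<le> (\<Sum>i. \<bar>l ^ Suc i * cantor_sign (2 ^ i * x)\<bar>)"
    unfolding cantor_map_def
    by (rule summable_rabs) (use s l in \<open>simp add: abs_mult abs_cantor_sign\<close>)
  also have "\<dots> = (\<Sum>i. l * l ^ i)"
    using l by (simp add: abs_mult abs_cantor_sign)
  also have "\<dots> = l / (1 - l)"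
    using l by (subst suminf_mult) (auto simp: suminf_geometric)
  finally show ?thesis .
qed

text \<open>If the first digits agree, both points are doubled and reduced to the unit interval,
  which doubles their distance and divides the distance of the images by \<open>l\<close>. If they
  differ, the images lie in two pieces separated by a fixed gap. The case \<open>k = 0\<close> is
  void, as two points of the half-open interval have distance less than 1.\<close>

lemma cantor_map_separation:
  "0 \<le> x \<Longrightarrow> x < 1 \<Longrightarrow> 0 \<le> y \<Longrightarrow> y < 1 \<Longrightarrow> (1 / 2) ^ k \<le> \<bar>x - y\<bar> \<Longrightarrow>
    2 * l * (1 - 2 * l) * l ^ k \<le> \<bar>cantor_map l x - cantor_map l y\<bar>"
proof (induction k arbitrary: x y)
  case 0
  then show ?case by auto
next
  case (Suc k)
  have sgn: "cantor_sign z = (if z < 1 / 2 then - 1 else 1)" if "0 \<le> z" "z < 1" for z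
    using that by (simp add: cantor_sign_def frac_eq)
  have diff: "cantor_map l x - cantor_map l y = l * (cantor_sign x - cantor_sign y + (cantor_map l (2 * x) - cantor_map l (2 * y)))"
    using cantor_map_rec[of x] cantor_map_rec[of y] by (simp add: algebra_simps)
  show ?case
  proof (cases "cantor_sign x = cantor_sign y")
    case True
    \<comment> \<open>The common integer part of the doubled points; the Cantor map does not change
      when it is subtracted.\<close>
    define h :: int where "h = (if x < 1 / 2 then 0 else 1)"
    have h: "0 \<le> 2 * x - h" "2 * x - h < 1" "0 \<le> 2 * y - h" "2 * y - h < 1"
      using True Suc.prems sgn[of x] sgn[of y] by (auto simp: h_def split: if_splits)
    have "2 * l * (1 - 2 * l) * l ^ k \<le> \<bar>cantor_map l (2 * x - h) - cantor_map l (2 * y - h)\<bar>"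
      by (rule Suc.IH) (use h Suc.prems in \<open>auto simp: abs_if split: if_splits\<close>)
    then have "2 * l * (1 - 2 * l) * l ^ k \<le> \<bar>cantor_map l (2 * x) - cantor_map l (2 * y)\<bar>"
      using cantor_map_add_of_int[of l "2 * x" "- h"] cantor_map_add_of_int[of l "2 * y" "- h"] by simp
    then have "l * (2 * l * (1 - 2 * l) * l ^ k) \<le> l * \<bar>cantor_map l (2 * x) - cantor_map l (2 * y)\<bar>"
      using l by (intro mult_left_mono) auto
    then show ?thesis using True diff l by (simp add: abs_mult mult_ac)
  next
    case False
    \<comment> \<open>The signs differ by 2 and each tail is at most \<open>2 * l\<close> in
      absolute value, so a gap of \<open>2 - 4 * l\<close> remains before scaling by
      \<open>l\<close>.\<close>
    have e: "l / (1 - l) \<le> 2 * l" using l by (simp add: field_simps)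
    have "\<bar>cantor_sign x - cantor_sign y\<bar> = 2"
      using False cantor_sign_cases[of x] cantor_sign_cases[of y] by auto
    then have "2 - 4 * l \<le> \<bar>cantor_sign x - cantor_sign y + (cantor_map l (2 * x) - cantor_map l (2 * y))\<bar>"
      using abs_cantor_map_le[of "2 * x"] abs_cantor_map_le[of "2 * y"] e by linarith
    then have "l * (2 - 4 * l) \<le> \<bar>cantor_map l x - cantor_map l y\<bar>"
      unfolding diff abs_mult using l by simp
    moreover have "l * (2 - 4 * l) * l ^ Suc k \<le> l * (2 - 4 * l) * 1"
      using l by (intro mult_left_mono power_le_one) auto
    ultimately show ?thesis by (simp add: algebra_simps)
  qed
qed

text \<open>Bracketing the distance between consecutive powers of 1 / 2 reduces the claim to powers:
  \<open>l powr s = (1 / 2) ^ N\<close> converts the separation \<open>l ^ Suc k\<close> into the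
  N-th power of \<open>(1 / 2) ^ Suc k\<close>. The bracket is sharp up to a factor 2, whence
  \<open>2 ^ N\<close>.\<close>

lemma cantor_map_inverse_Hoelder:
  assumes s: "0 < s" and N: "l powr s = (1 / 2) ^ N" and xy: "0 \<le> x" "x < 1" "0 \<le> y" "y < 1"
    and N0: "0 < N"
  shows "\<bar>x - y\<bar> ^ N \<le> 2 ^ N / (2 * l * (1 - 2 * l)) powr s * \<bar>cantor_map l x - cantor_map l y\<bar> powr s"
proof (cases "x = y")
  case False
  define c where "c = 2 * l * (1 - 2 * l)"
  have c: "0 < c" using l by (simp add: c_def)
  have "0 < \<bar>x - y\<bar>" "\<bar>x - y\<bar> \<le> 1" using False xy by auto
  then obtain k where k: "(1 / 2) ^ Suc k < \<bar>x - y\<bar>" "\<bar>x - y\<bar> \<le> (1 / 2) ^ k"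
    by (rule geometric_bracket[where r = "1 / 2"]) auto
  have "c * l ^ Suc k \<le> \<bar>cantor_map l x - cantor_map l y\<bar>"
    unfolding c_def using k xy by (intro cantor_map_separation) auto
  then have "(c * l ^ Suc k) powr s \<le> \<bar>cantor_map l x - cantor_map l y\<bar> powr s"
    using c l s by (intro powr_mono2) auto
  also have "(c * l ^ Suc k) powr s = c powr s * (l powr s) ^ Suc k"
    using c l by (simp add: powr_mult powr_power powr_realpow[symmetric] powr_powr mult.commute del: power_Suc)
  also have "\<dots> = c powr s * ((1 / 2) ^ Suc k) ^ N"
    unfolding N by (simp add: power_mult[symmetric] mult.commute del: power_Suc)
  finally have le: "((1 / 2) ^ Suc k) ^ N \<le> \<bar>cantor_map l x - cantor_map l y\<bar> powr s / c powr s"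
    using c by (simp add: field_simps)
  have "\<bar>x - y\<bar> ^ N \<le> (2 * (1 / 2) ^ Suc k) ^ N"
    using k by (intro power_mono) auto
  also have "\<dots> \<le> 2 ^ N * (\<bar>cantor_map l x - cantor_map l y\<bar> powr s / c powr s)"
    unfolding power_mult_distrib using le by (intro mult_left_mono) auto
  finally show ?thesis by (simp add: c_def)
qed (use N0 in \<open>simp add: zero_power\<close>)

end

section \<open>Bumps around Cantor dust\<close>

definition cube :: "real \<Rightarrow> 'a::euclidean_space set" where
  "cube r = cbox (- (r *\<^sub>R One)) (r *\<^sub>R One)"

lemma mem_cube: "x \<in> cube r \<longleftrightarrow> (\<forall>b\<in>Basis. \<bar>x \<bullet> b\<bar> \<le> r)"
  by (auto simp: cube_def mem_box abs_le_iff minus_le_iff)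

lemma compact_cube: "compact (cube r)"
  by (simp add: cube_def)

text \<open>The vertices of the cube of half side 1; each gives one child in the construction of the
  dust.\<close>

definition signs :: "'a::euclidean_space set" where
  "signs = (\<lambda>S. \<Sum>b\<in>Basis. (if b \<in> S then 1 else - 1) *\<^sub>R b) ` Pow Basis"

lemma finite_signs: "finite signs"
  by (simp add: signs_def)

lemma card_signs: "card (signs :: 'a::euclidean_space set) \<le> 2 ^ DIM('a)"
  unfolding signs_def by (rule order_trans[OF card_image_le]) (auto simp: card_Pow)

lemma signs_inner:
  assumes "d \<in> signs" "b \<in> Basis"
  shows "d \<bullet> b = 1 \<or> d \<bullet> b = - 1"
proof -
  obtain S where "d = (\<Sum>b\<in>Basis. (if b \<in> S then 1 else - 1) *\<^sub>R b)"
    using assms(1) unfolding signs_def by blast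
  then have "d \<bullet> b = (if b \<in> S then 1 else - 1)"
    by (simp only: inner_sum_left_Basis[OF assms(2)])
  then show ?thesis by presburger
qed

lemma abs_signs_inner: "d \<in> signs \<Longrightarrow> b \<in> Basis \<Longrightarrow> \<bar>d \<bullet> b\<bar> = 1"
  using signs_inner[of d b] by auto

lemma signsI:
  assumes "\<And>b. b \<in> Basis \<Longrightarrow> d \<bullet> b = 1 \<or> d \<bullet> b = - 1"
  shows "d \<in> signs"
proof -
  let ?S = "{b\<in>Basis. d \<bullet> b = 1}"
  have "d = (\<Sum>b\<in>Basis. (if b \<in> ?S then 1 else - 1) *\<^sub>R b)"
  proof (rule euclidean_eqI)
    fix c :: 'a assume c: "c \<in> Basis"
    have "d \<bullet> c = (if c \<in> ?S then 1 else - 1)" using assms[OF c] c by auto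
    then show "d \<bullet> c = (\<Sum>b\<in>Basis. (if b \<in> ?S then 1 else - 1) *\<^sub>R b) \<bullet> c"
      unfolding inner_sum_left_Basis[OF c] .
  qed
  moreover have "?S \<in> Pow Basis" by blast
  ultimately show ?thesis unfolding signs_def by (rule image_eqI)
qed

text \<open>If \<open>f\<close> is supported in the cube of half side \<open>2 * l < 1\<close>, the summands live in different orthants.\<close>

definition refine :: "real \<Rightarrow> ('a::euclidean_space \<Rightarrow> real) \<Rightarrow> 'a \<Rightarrow> real" where
  "refine l f x = (\<Sum>d\<in>signs. f ((1 / l) *\<^sub>R x + (- d)))"

lemma integral_affine:
  fixes f :: "'a::euclidean_space \<Rightarrow> real"
  assumes "continuous_on UNIV f" "0 < c"
  shows "(LINT x|lebesgue. f (c *\<^sub>R x + d)) = (LINT x|lebesgue. f x) / c ^ DIM('a)"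
proof -
  have [measurable]: "f \<in> borel_measurable borel"
    using assms by (simp add: borel_measurable_continuous_onI)
  have "(LINT x|lborel. f x) = (LINT x|density (distr lborel borel (\<lambda>x. d + c *\<^sub>R x)) (\<lambda>_. ennreal (\<bar>c\<bar> ^ DIM('a))). f x)"
    using lborel_affine[of c d] assms(2) by (simp add: ennreal_power)
  also have "\<dots> = c ^ DIM('a) * (LINT x|lborel. f (d + c *\<^sub>R x))"
    using assms(2) by (subst integral_density) (auto simp: integral_distr)
  finally show ?thesis
    using assms(2) by (subst (1 2) integral_completion) (auto simp: add.commute)
qed

lemma sum_sq_disjoint:
  fixes f :: "'b \<Rightarrow> real"
  assumes "finite I" "\<And>i j. i \<in> I \<Longrightarrow> j \<in> I \<Longrightarrow> f i \<noteq> 0 \<Longrightarrow> f j \<noteq> 0 \<Longrightarrow> i = j"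
  shows "(\<Sum>i\<in>I. f i)\<^sup>2 = (\<Sum>i\<in>I. (f i)\<^sup>2)"
proof (cases "\<exists>i\<in>I. f i \<noteq> 0")
  case True
  then obtain i where i: "i \<in> I" "f i \<noteq> 0" by blast
  have "f j = 0" if "j \<in> I - {i}" for j using assms(2)[of i j] i that by blast
  then show ?thesis using assms(1) i by (simp add: sum.remove[of I i])
qed simp

lemma Ck_refine: "(\<And>k. Ck k f) \<Longrightarrow> Ck k (refine l f)"
  unfolding refine_def by (intro Ck_sum Ck_affine)

lemma pd_refine:
  assumes "\<And>k. Ck k f"
  shows "pd b (refine l f) = (\<lambda>x. (1 / l) * refine l (pd b f) x)"
proof
  fix x
  have "pd b (refine l f) x = (\<Sum>d\<in>signs. pd b (\<lambda>x. f ((1 / l) *\<^sub>R x + (- d))) x)"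
    unfolding refine_def by (rule fun_cong[OF pd_sum]) (rule Ck_affine[OF assms])
  also have "\<dots> = (\<Sum>d\<in>signs. (1 / l) * pd b f ((1 / l) *\<^sub>R x + (- d)))"
    by (intro sum.cong refl fun_cong[OF frechet_derivative_affine[OF assms]])
  finally show "pd b (refine l f) x = (1 / l) * refine l (pd b f) x"
    by (simp only: refine_def sum_distrib_left)
qed

lemma laplacian_refine:
  assumes "\<And>k. Ck k f"
  shows "laplacian (refine l f) = (\<lambda>x. (1 / l)\<^sup>2 * refine l (laplacian f) x)"
proof
  fix x
  have "pd b (pd b (refine l f)) x = (1 / l)\<^sup>2 * refine l (pd b (pd b f)) x" if b: "b \<in> Basis" for b
  proof -
    have *: "Ck k (pd b f)" for k using Ck_pd[OF assms b] .
    have "pd b (pd b (refine l f)) x = pd b (\<lambda>x. (1 / l) * refine l (pd b f) x) x"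
      unfolding pd_refine[OF assms] ..
    also have "\<dots> = (1 / l) * pd b (refine l (pd b f)) x"
      by (rule fun_cong[OF pd_cmult[OF Ck_refine[OF *]]])
    also have "pd b (refine l (pd b f)) x = (1 / l) * refine l (pd b (pd b f)) x"
      by (rule fun_cong[OF pd_refine[OF *]])
    finally show ?thesis by (simp add: power2_eq_square)
  qed
  then have "laplacian (refine l f) x = (\<Sum>b\<in>Basis. (1 / l)\<^sup>2 * refine l (pd b (pd b f)) x)"
    by (rule sum.cong[OF refl])
  also have "\<dots> = (1 / l)\<^sup>2 * refine l (laplacian f) x"
    unfolding refine_def sum_distrib_left[symmetric] by (subst sum.swap) simp
  finally show "laplacian (refine l f) x = (1 / l)\<^sup>2 * refine l (laplacian f) x" .
qed

text \<open>Squares in place of absolute values keep it smooth. The half side \<open>2 * l\<close>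
  exceeds \<open>l / (1 - l)\<close>, the bound for the coordinates of the dust, and is less than 1,
  which keeps the children apart.\<close>

definition base_bump :: "real \<Rightarrow> 'a::euclidean_space \<Rightarrow> real" where
  "base_bump l x = (\<Prod>b\<in>Basis. flat 0 ((2 * l)\<^sup>2 - (x \<bullet> b)\<^sup>2))"

primrec cantor_bump :: "real \<Rightarrow> nat \<Rightarrow> 'a::euclidean_space \<Rightarrow> real" where
  "cantor_bump l 0 = base_bump l"
| "cantor_bump l (Suc n) = refine l (cantor_bump l n)"

text \<open>Compact sets containing the supports of the bumps. They start from half side 1 instead
  of \<open>2 * l\<close> so that stage n is covered by cubes of half side exactly
  \<open>l ^ n\<close>.\<close>

primrec cantor_nbhd :: "real \<Rightarrow> nat \<Rightarrow> 'a::euclidean_space set" where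
  "cantor_nbhd l 0 = cube 1"
| "cantor_nbhd l (Suc n) = (\<Union>d\<in>signs. (\<lambda>x. l *\<^sub>R (x + d)) ` cantor_nbhd l n)"

lemma Ck_cantor_bump: "Ck k (cantor_bump l n)"
proof (induction n arbitrary: k)
  case 0
  show ?case
    unfolding cantor_bump.simps base_bump_def power2_eq_square
    by (intro Ck_prod Ck_compose[OF Ck_flat] Ck_diff Ck_const Ck_mult Ck_inner)
qed (auto intro: Ck_refine simp del: Ck.simps)

lemma cantor_bump_nonneg: "0 \<le> cantor_bump l n x"
  by (induction n arbitrary: x) (auto simp: base_bump_def refine_def intro!: prod_nonneg sum_nonneg flat_nonneg)

lemma flat_0_mono: "s \<le> t \<Longrightarrow> flat 0 s \<le> flat 0 t"
  by (auto simp: flat_def field_simps)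

context
  fixes l :: real
  assumes l: "0 < l" "l < 1 / 2"
begin

text \<open>In coordinates magnified by 1 / l, a child around a sign vector reaches out to at most
  \<open>1 + 2 * l\<close>, which is less than 2; hence the same support bound holds at every
  stage.\<close>

lemma refine_support:
  assumes f: "\<And>x. f x \<noteq> 0 \<Longrightarrow> x \<in> cube (2 * l)" and x: "refine l f x \<noteq> 0"
  shows "x \<in> cube (2 * l)"
proof -
  obtain d where d: "d \<in> signs" "f ((1 / l) *\<^sub>R x + (- d)) \<noteq> 0"
    using x sum.neutral unfolding refine_def by metis
  have "\<bar>x \<bullet> b\<bar> \<le> 2 * l" if b: "b \<in> Basis" for b
  proof -
    have "\<bar>(1 / l) * (x \<bullet> b) - d \<bullet> b\<bar> \<le> 2 * l"
      using f[OF d(2)] b by (simp add: mem_cube inner_add_left inner_diff_left)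
    then have "\<bar>(1 / l) * (x \<bullet> b)\<bar> \<le> 2"
      using abs_signs_inner[OF d(1) b] l by linarith
    then show ?thesis using l by (simp add: abs_mult field_simps)
  qed
  then show ?thesis by (simp add: mem_cube)
qed

lemma refine_sq:
  assumes f: "\<And>x. f x \<noteq> 0 \<Longrightarrow> x \<in> cube (2 * l)"
  shows "(refine l f x)\<^sup>2 = (\<Sum>d\<in>signs. (f ((1 / l) *\<^sub>R x + (- d)))\<^sup>2)"
  unfolding refine_def
proof (rule sum_sq_disjoint[OF finite_signs])
  fix d d' :: 'a assume d: "d \<in> signs" "d' \<in> signs" "f ((1 / l) *\<^sub>R x + (- d)) \<noteq> 0" "f ((1 / l) *\<^sub>R x + (- d')) \<noteq> 0"
  show "d = d'"
  proof (rule euclidean_eqI)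
    fix b :: 'a assume b: "b \<in> Basis"
    have "\<bar>(1 / l) * (x \<bullet> b) - d \<bullet> b\<bar> \<le> 2 * l" "\<bar>(1 / l) * (x \<bullet> b) - d' \<bullet> b\<bar> \<le> 2 * l"
      using f[OF d(3)] f[OF d(4)] b by (simp_all add: mem_cube inner_add_left inner_diff_left)
    then show "d \<bullet> b = d' \<bullet> b"
      using signs_inner[OF d(1) b] signs_inner[OF d(2) b] l by linarith
  qed
qed

text \<open>At most \<open>2 ^ N\<close> copies with disjoint supports, each with its volume scaled
  by \<open>l ^ N\<close>.\<close>

lemma integral_refine_sq_le:
  fixes f :: "'a::euclidean_space \<Rightarrow> real"
  assumes cont: "continuous_on UNIV f" and f: "\<And>x. f x \<noteq> 0 \<Longrightarrow> x \<in> cube (2 * l)"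
  shows "(LINT x|lebesgue. (refine l f x)\<^sup>2) \<le> (2 * l) ^ DIM('a) * (LINT x|lebesgue. (f x)\<^sup>2)"
proof -
  have cont2: "continuous_on UNIV (\<lambda>x. (f x)\<^sup>2)" by (intro continuous_intros cont)
  have bdd: "bounded {x. (f x)\<^sup>2 \<noteq> 0}"
    by (rule bounded_subset[OF compact_imp_bounded[OF compact_cube[of "2 * l"]]]) (use f in auto)
  have int: "integrable lebesgue (\<lambda>x. (f ((1 / l) *\<^sub>R x + (- d)))\<^sup>2)" for d
  proof (rule integrable_bounded_support)
    show "continuous_on UNIV (\<lambda>x. (f ((1 / l) *\<^sub>R x + (- d)))\<^sup>2)"
      by (intro continuous_intros continuous_on_compose2[OF cont]) auto
    have "{x. (f ((1 / l) *\<^sub>R x + (- d)))\<^sup>2 \<noteq> 0} \<subseteq> (\<lambda>x. l *\<^sub>R x + l *\<^sub>R d) ` {x. (f x)\<^sup>2 \<noteq> 0}"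
    proof
      fix x assume "x \<in> {x. (f ((1 / l) *\<^sub>R x + (- d)))\<^sup>2 \<noteq> 0}"
      then show "x \<in> (\<lambda>x. l *\<^sub>R x + l *\<^sub>R d) ` {x. (f x)\<^sup>2 \<noteq> 0}"
        using l by (intro image_eqI[of _ _ "(1 / l) *\<^sub>R x + (- d)"]) (auto simp: algebra_simps)
    qed
    moreover have "bounded ((\<lambda>x. l *\<^sub>R d + x) ` ((\<lambda>x. l *\<^sub>R x) ` {x. (f x)\<^sup>2 \<noteq> 0}))"
      by (intro bounded_translation bounded_scaling bdd)
    ultimately show "bounded {x. (f ((1 / l) *\<^sub>R x + (- d)))\<^sup>2 \<noteq> 0}"
      by (simp add: image_image add.commute bounded_subset)
  qed
  have "(LINT x|lebesgue. (refine l f x)\<^sup>2) = (LINT x|lebesgue. (\<Sum>d\<in>signs. (f ((1 / l) *\<^sub>R x + (- d)))\<^sup>2))"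
  proof -
    have "(refine l f x)\<^sup>2 = (\<Sum>d\<in>signs. (f ((1 / l) *\<^sub>R x + (- d)))\<^sup>2)" for x
      by (rule refine_sq) (rule f)
    then show ?thesis by (simp only:)
  qed
  also have "\<dots> = (\<Sum>d\<in>(signs :: 'a set). LINT x|lebesgue. (f ((1 / l) *\<^sub>R x + (- d)))\<^sup>2)"
    by (rule Bochner_Integration.integral_sum[OF int])
  also have "\<dots> = (\<Sum>d\<in>(signs :: 'a set). (LINT x|lebesgue. (f x)\<^sup>2) / (1 / l) ^ DIM('a))"
    using l by (intro sum.cong refl integral_affine[OF cont2]) simp
  also have "\<dots> = card (signs :: 'a set) * (l ^ DIM('a) * (LINT x|lebesgue. (f x)\<^sup>2))"
    by (simp add: power_divide mult_ac)
  also have "\<dots> \<le> 2 ^ DIM('a) * (l ^ DIM('a) * (LINT x|lebesgue. (f x)\<^sup>2))"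
  proof (rule mult_right_mono)
    show "real (card (signs :: 'a set)) \<le> 2 ^ DIM('a)"
      using card_signs[where 'a='a] by (metis of_nat_le_iff of_nat_numeral of_nat_power)
    show "0 \<le> l ^ DIM('a) * (LINT x|lebesgue. (f x)\<^sup>2)"
      using l by (intro mult_nonneg_nonneg Bochner_Integration.integral_nonneg) auto
  qed
  finally show ?thesis by (simp add: power_mult_distrib mult.assoc)
qed

lemma cantor_bump_support: "cantor_bump l n x \<noteq> 0 \<Longrightarrow> x \<in> cube (2 * l)"
proof (induction n arbitrary: x)
  case (0 x)
  show ?case
  proof (rule ccontr)
    assume "x \<notin> cube (2 * l)"
    then obtain b where b: "b \<in> Basis" "2 * l < \<bar>x \<bullet> b\<bar>" by (auto simp: mem_cube not_le)
    then have "(2 * l)\<^sup>2 \<le> (x \<bullet> b)\<^sup>2" using power_mono[of "2 * l" "\<bar>x \<bullet> b\<bar>" 2] l by simp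
    then have "cantor_bump l 0 x = 0"
      using b(1) flat_eq_0 by (auto simp: base_bump_def intro!: prod_zero bexI[of _ b])
    with 0 show False by simp
  qed
next
  case (Suc n)
  show ?case
    by (rule refine_support[of "cantor_bump l n"]) (use Suc in auto)
qed

lemma cantor_bump_support_nbhd: "cantor_bump l n x \<noteq> 0 \<Longrightarrow> x \<in> cantor_nbhd l n"
proof (induction n arbitrary: x)
  case 0
  then show ?case using cantor_bump_support[of 0 x] l by (force simp: mem_cube)
next
  case (Suc n)
  then obtain d where d: "d \<in> signs" "cantor_bump l n ((1 / l) *\<^sub>R x + (- d)) \<noteq> 0"
    using sum.neutral unfolding cantor_bump.simps refine_def by metis
  have "x = l *\<^sub>R ((1 / l) *\<^sub>R x + (- d) + d)" using l by simp
  with Suc.IH[OF d(2)] d(1) show ?case unfolding cantor_nbhd.simps by blast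
qed

lemma laplacian_cantor_bump_support: "laplacian (cantor_bump l n) x \<noteq> 0 \<Longrightarrow> x \<in> cube (2 * l)"
proof -
  let ?C = "cube (2 * l) :: 'a set"
  have cl: "closure {x. f x \<noteq> 0} \<subseteq> ?C" if "{x. f x \<noteq> 0} \<subseteq> ?C" for f :: "'a \<Rightarrow> real"
    using that compact_imp_closed[OF compact_cube[of "2 * l"]] by (rule closure_minimal)
  have "{x. cantor_bump l n x \<noteq> 0} \<subseteq> ?C" using cantor_bump_support by blast
  then have "{x. pd b (pd b (cantor_bump l n)) x \<noteq> 0} \<subseteq> ?C" for b
    by (intro subset_trans[OF support_pd cl])
  then show "x \<in> ?C" if "laplacian (cantor_bump l n) x \<noteq> 0" for x
    using that sum.neutral[of Basis "\<lambda>b. pd b (pd b (cantor_bump l n)) x"] by blast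
qed

lemma integral_cantor_bump_sq_le:
  "(LINT x|lebesgue. (cantor_bump l n (x::'a::euclidean_space))\<^sup>2) \<le>
    ((2 * l) ^ DIM('a)) ^ n * (LINT x|lebesgue. (cantor_bump l 0 (x::'a))\<^sup>2)"
proof (induction n)
  case (Suc n)
  have "(LINT x|lebesgue. (cantor_bump l (Suc n) (x::'a))\<^sup>2) \<le>
      (2 * l) ^ DIM('a) * (LINT x|lebesgue. (cantor_bump l n (x::'a))\<^sup>2)"
    unfolding cantor_bump.simps
    by (rule integral_refine_sq_le[OF Ck_continuous_on[OF Ck_cantor_bump[of 0]] cantor_bump_support])
  also have "\<dots> \<le> (2 * l) ^ DIM('a) * (((2 * l) ^ DIM('a)) ^ n * (LINT x|lebesgue. (cantor_bump l 0 (x::'a))\<^sup>2))"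
    using l by (intro mult_left_mono Suc) auto
  finally show ?case by (simp only: power_Suc mult.assoc)
qed simp

text \<open>Besides the factor for copies and volume, each stage magnifies second derivatives by
  \<open>1 / l^2\<close>, and their squares by \<open>1 / l ^ 4\<close>.\<close>

lemma integral_laplacian_cantor_bump_sq_le:
  "(LINT x|lebesgue. (laplacian (cantor_bump l n) (x::'a::euclidean_space))\<^sup>2) \<le>
    ((2 * l) ^ DIM('a) / l ^ 4) ^ n * (LINT x|lebesgue. (laplacian (cantor_bump l 0) (x::'a))\<^sup>2)"
proof (induction n)
  case (Suc n)
  have cont: "continuous_on UNIV (laplacian (cantor_bump l n :: 'a \<Rightarrow> real))"
    by (intro continuous_intros Ck_continuous_on[of 0] Ck_pd Ck_cantor_bump)
  have "(LINT x|lebesgue. (laplacian (cantor_bump l (Suc n)) (x::'a))\<^sup>2) =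
      (LINT x|lebesgue. (1 / l) ^ 4 * (refine l (laplacian (cantor_bump l n)) (x::'a))\<^sup>2)"
    unfolding cantor_bump.simps fun_cong[OF laplacian_refine[OF Ck_cantor_bump]]
    by (simp add: power_mult_distrib flip: power_mult)
  also have "\<dots> = (1 / l) ^ 4 * (LINT x|lebesgue. (refine l (laplacian (cantor_bump l n)) (x::'a))\<^sup>2)"
    by simp
  also have "\<dots> \<le> (1 / l) ^ 4 * ((2 * l) ^ DIM('a) * (LINT x|lebesgue. (laplacian (cantor_bump l n) (x::'a))\<^sup>2))"
    using l by (intro mult_left_mono integral_refine_sq_le[OF cont laplacian_cantor_bump_support]) auto
  also have "\<dots> = (2 * l) ^ DIM('a) / l ^ 4 * (LINT x|lebesgue. (laplacian (cantor_bump l n) (x::'a))\<^sup>2)"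
    by (simp add: power_divide)
  also have "\<dots> \<le> (2 * l) ^ DIM('a) / l ^ 4 * (((2 * l) ^ DIM('a) / l ^ 4) ^ n *
      (LINT x|lebesgue. (laplacian (cantor_bump l 0) (x::'a))\<^sup>2))"
    using l by (intro mult_left_mono Suc) auto
  finally show ?case by (simp only: power_Suc mult.assoc)
qed simp

text \<open>The binary digits of \<open>x\<close> name the child that sees \<open>y\<close>. Passing
  to it magnifies by 1 / l, replaces \<open>x\<close> by \<open>2 *\<^sub>R x\<close> and turns the
  tolerance \<open>h * l ^ Suc n\<close> into \<open>h * l ^ n\<close>; the remaining summands are
  nonnegative. At stage 0 the coordinates of \<open>y\<close> are at most
  \<open>l / (1 - l) + h\<close>, so the base bump is bounded below.\<close>

lemma cantor_bump_lower:
  fixes y :: "'a::euclidean_space"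
  assumes h: "l / (1 - l) + h \<le> r" "0 \<le> h"
  shows "(\<And>b. b \<in> Basis \<Longrightarrow> \<bar>y \<bullet> b - cantor_map l (x \<bullet> b)\<bar> \<le> h * l ^ n) \<Longrightarrow>
    flat 0 ((2 * l)\<^sup>2 - r\<^sup>2) ^ DIM('a) \<le> cantor_bump l n y"
proof (induction n arbitrary: x y)
  case (0 x y)
  have "flat 0 ((2 * l)\<^sup>2 - r\<^sup>2) \<le> flat 0 ((2 * l)\<^sup>2 - (y \<bullet> b)\<^sup>2)" if b: "b \<in> Basis" for b
  proof -
    have "\<bar>y \<bullet> b\<bar> \<le> r" using 0[OF b] abs_cantor_map_le[OF l, of "x \<bullet> b"] h by simp
    then have "(y \<bullet> b)\<^sup>2 \<le> r\<^sup>2" by (rule abs_le_square_iff[THEN iffD1, OF order_trans[OF _ abs_ge_self]])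
    then show ?thesis by (intro flat_0_mono) simp
  qed
  then have "(\<Prod>b\<in>(Basis::'a set). flat 0 ((2 * l)\<^sup>2 - r\<^sup>2)) \<le> base_bump l y"
    unfolding base_bump_def by (intro prod_mono) (auto simp: flat_nonneg)
  then show ?case by simp
next
  case (Suc n x y)
  \<comment> \<open>The child selected by the first digits of all coordinates.\<close>
  define d :: 'a where "d = (\<Sum>b\<in>Basis. cantor_sign (x \<bullet> b) *\<^sub>R b)"
  have db: "d \<bullet> b = cantor_sign (x \<bullet> b)" if "b \<in> Basis" for b
    using that by (simp add: d_def)
  have d: "d \<in> signs" by (rule signsI) (simp add: db cantor_sign_cases)
  have "flat 0 ((2 * l)\<^sup>2 - r\<^sup>2) ^ DIM('a) \<le> cantor_bump l n ((1 / l) *\<^sub>R y + (- d))"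
  proof (rule Suc.IH)
    fix b :: 'a assume b: "b \<in> Basis"
    have "\<bar>y \<bullet> b - l * (cantor_sign (x \<bullet> b) + cantor_map l (2 * (x \<bullet> b)))\<bar> \<le> h * l ^ Suc n"
      using Suc.prems[OF b] unfolding cantor_map_rec[OF l, of "x \<bullet> b"] .
    also have "y \<bullet> b - l * (cantor_sign (x \<bullet> b) + cantor_map l (2 * (x \<bullet> b))) =
        l * (((1 / l) *\<^sub>R y + (- d)) \<bullet> b - cantor_map l ((2 *\<^sub>R x) \<bullet> b))"
      using l db[OF b] by (simp add: inner_diff_left field_simps)
    finally show "\<bar>((1 / l) *\<^sub>R y + (- d)) \<bullet> b - cantor_map l ((2 *\<^sub>R x) \<bullet> b)\<bar> \<le> h * l ^ n"
      using l by (simp add: abs_mult)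
  qed
  also have "\<dots> \<le> cantor_bump l (Suc n) y"
    unfolding cantor_bump.simps refine_def
    using d by (intro member_le_sum cantor_bump_nonneg finite_signs)
  finally show ?case .
qed

section \<open>The neighbourhoods as nested compact sets with efficient covers\<close>

lemma compact_cantor_nbhd: "compact (cantor_nbhd l n)"
proof (induction n)
  case (Suc n)
  show ?case
    unfolding cantor_nbhd.simps
    by (intro compact_UN finite_signs compact_continuous_image continuous_intros Suc)
qed (simp add: compact_cube)

lemma cantor_nbhd_decreasing: "cantor_nbhd l (Suc n) \<subseteq> cantor_nbhd l n"
proof (induction n)
  case 0
  have "\<bar>(l *\<^sub>R (x + d)) \<bullet> b\<bar> \<le> 1" if "x \<in> cube 1" "d \<in> signs" "b \<in> Basis" for x d b :: 'a
  proof -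
    have "\<bar>x \<bullet> b + d \<bullet> b\<bar> \<le> 2"
      using that abs_signs_inner[of d b] by (simp add: mem_cube) (smt (verit))
    then have "l * \<bar>x \<bullet> b + d \<bullet> b\<bar> \<le> 1 / 2 * 2"
      using l by (intro mult_mono) auto
    then show ?thesis using l by (simp add: inner_add_left abs_mult)
  qed
  then show ?case by (auto simp: mem_cube)
next
  case (Suc n)
  have "(\<lambda>x. l *\<^sub>R (x + d)) ` cantor_nbhd l (Suc n) \<subseteq> (\<lambda>x. l *\<^sub>R (x + d)) ` cantor_nbhd l n" for d :: 'a
    by (rule image_mono[OF Suc])
  then show ?case unfolding cantor_nbhd.simps(2)[of l "Suc n"] cantor_nbhd.simps(2)[of l n]
    by (intro UN_mono) auto
qed

lemma cantor_nbhd_antimono: "m \<le> n \<Longrightarrow> cantor_nbhd l n \<subseteq> cantor_nbhd l m"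
  by (induction rule: dec_induct) (use cantor_nbhd_decreasing in blast)+

lemma cantor_nbhd_cover:
  "\<exists>P::'a::euclidean_space set. finite P \<and> card P \<le> (2 ^ DIM('a)) ^ n \<and> cantor_nbhd l n \<subseteq> (\<Union>p\<in>P. (+) p ` cube (l ^ n))"
proof (induction n)
  case 0
  show ?case by (intro exI[of _ "{0}"]) auto
next
  case (Suc n)
  then obtain P :: "'a set" where P: "finite P" "card P \<le> (2 ^ DIM('a)) ^ n" "cantor_nbhd l n \<subseteq> (\<Union>p\<in>P. (+) p ` cube (l ^ n))"
    by blast
  define Q where "Q = (\<lambda>(d, p). l *\<^sub>R (p + d)) ` (signs \<times> P)"
  have "finite Q" unfolding Q_def by (intro finite_imageI finite_cartesian_product finite_signs P(1))
  moreover have "card Q \<le> (2 ^ DIM('a)) ^ Suc n"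
  proof -
    have "card Q \<le> card ((signs :: 'a set) \<times> P)"
      unfolding Q_def by (intro card_image_le finite_cartesian_product finite_signs P(1))
    also have "\<dots> \<le> 2 ^ DIM('a) * (2 ^ DIM('a)) ^ n"
      unfolding card_cartesian_product by (intro mult_mono card_signs P(2)) auto
    finally show ?thesis by simp
  qed
  moreover have "cantor_nbhd l (Suc n) \<subseteq> (\<Union>p\<in>Q. (+) p ` cube (l ^ Suc n))"
  proof
    fix x :: 'a assume "x \<in> cantor_nbhd l (Suc n)"
    then obtain d y where d: "d \<in> signs" "y \<in> cantor_nbhd l n" "x = l *\<^sub>R (y + d)" by auto
    then obtain p z where p: "p \<in> P" "z \<in> cube (l ^ n)" "y = p + z" using P(3) by blast
    have "x = l *\<^sub>R (p + d) + l *\<^sub>R z" using d p by (simp add: algebra_simps)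
    moreover have "l *\<^sub>R (p + d) \<in> Q" using d p by (force simp: Q_def)
    moreover have "l *\<^sub>R z \<in> cube (l ^ Suc n)"
      using p(2) l by (auto simp: mem_cube abs_mult)
    ultimately show "x \<in> (\<Union>p\<in>Q. (+) p ` cube (l ^ Suc n))" by blast
  qed
  ultimately show ?case by blast
qed

end

section \<open>Singular blocks\<close>

lemma norm_le_cube:
  fixes x :: "'a::euclidean_space" and r :: real
  assumes "x \<in> cube r"
  shows "norm x \<le> DIM('a) * r"
proof -
  have "norm x \<le> (\<Sum>b\<in>Basis. \<bar>x \<bullet> b\<bar>)" by (rule norm_le_l1)
  also have "\<dots> \<le> (\<Sum>b\<in>(Basis::'a set). r)"
    using assms by (intro sum_mono) (simp add: mem_cube)
  finally show ?thesis by simp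
qed

lemma laplacian_affine:
  assumes f: "\<And>k. Ck k f"
  shows "laplacian (\<lambda>x. m * f (c *\<^sub>R x + d)) x = m * c\<^sup>2 * laplacian f (c *\<^sub>R x + d)"
proof -
  have aff: "pd b (\<lambda>x. g (c *\<^sub>R x + d)) = (\<lambda>x. c * pd b g (c *\<^sub>R x + d))" if "\<And>k. Ck k g" for g b
    by (rule ext, rule fun_cong[OF frechet_derivative_affine[OF that]])
  have "pd b (pd b (\<lambda>x. m * f (c *\<^sub>R x + d))) x = m * c\<^sup>2 * pd b (pd b f) (c *\<^sub>R x + d)" if b: "b \<in> Basis" for b
  proof -
    have f': "Ck k (pd b f)" for k using Ck_pd[OF f b] .
    have "pd b (\<lambda>x. m * f (c *\<^sub>R x + d)) = (\<lambda>x. m * pd b (\<lambda>x. f (c *\<^sub>R x + d)) x)"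
      by (rule pd_cmult[OF Ck_affine[OF f]])
    also have "\<dots> = (\<lambda>x. (m * c) * pd b f (c *\<^sub>R x + d))"
      by (simp only: fun_cong[OF aff[OF f]] mult.assoc)
    finally have "pd b (pd b (\<lambda>x. m * f (c *\<^sub>R x + d))) x = pd b (\<lambda>x. (m * c) * pd b f (c *\<^sub>R x + d)) x"
      by (simp only:)
    also have "\<dots> = (m * c) * pd b (\<lambda>x. pd b f (c *\<^sub>R x + d)) x"
      by (rule fun_cong[OF pd_cmult[OF Ck_affine[OF f']]])
    also have "pd b (\<lambda>x. pd b f (c *\<^sub>R x + d)) x = c * pd b (pd b f) (c *\<^sub>R x + d)"
      by (rule fun_cong[OF aff[OF f']])
    finally show ?thesis by (simp only: power2_eq_square mult.assoc)
  qed
  then show ?thesis unfolding sum_distrib_left by (rule sum.cong[OF refl])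
qed

definition cantor_vec :: "real \<Rightarrow> 'a::euclidean_space \<Rightarrow> 'a" where
  "cantor_vec l x = (\<Sum>b\<in>Basis. cantor_map l (x \<bullet> b) *\<^sub>R b)"

lemma cantor_vec_inner: "b \<in> Basis \<Longrightarrow> cantor_vec l x \<bullet> b = cantor_map l (x \<bullet> b)"
  unfolding cantor_vec_def by (rule inner_sum_left_Basis)

text \<open>The Hoelder estimate is needed for one coordinate at a time, and distances dominate
  coordinate differences. The parameter cube is half-open because \<open>cantor_map\<close> has
  period 1, so that opposite faces have the same image.\<close>

lemma hausdorff_dim_cantor_set:
  fixes q :: "'a::euclidean_space"
  assumes l: "0 < l" "l < 1 / 2" and s: "0 < s" "l powr s = (1 / 2) ^ DIM('a)" and \<epsilon>: "0 < \<epsilon>"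
  shows "ereal s \<le> hausdorff_dim ((\<lambda>x. q + \<epsilon> *\<^sub>R cantor_vec l x) ` {x. \<forall>b\<in>Basis. 0 \<le> x \<bullet> b \<and> x \<bullet> b < 1})"
proof (rule hausdorff_dim_ge_parametrisation[OF s(1)])
  let ?c = "2 * l * (1 - 2 * l)"
  let ?K = "2 ^ DIM('a) / ?c powr s"
  have c: "0 < ?c" using l by simp
  have "0 < ?c powr s" unfolding powr_gt_zero using l by simp
  then show "0 < ?K / \<epsilon> powr s" using \<epsilon> by (intro divide_pos_pos) auto
  show "box 0 One \<subseteq> {x::'a. \<forall>b\<in>Basis. 0 \<le> x \<bullet> b \<and> x \<bullet> b < 1}"
    by (auto simp: mem_box less_imp_le)
  fix x y b :: 'a
  assume x: "x \<in> {x. \<forall>b\<in>Basis. 0 \<le> x \<bullet> b \<and> x \<bullet> b < 1}" and y: "y \<in> {x. \<forall>b\<in>Basis. 0 \<le> x \<bullet> b \<and> x \<bullet> b < 1}"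
    and b: "b \<in> Basis"
  have "\<bar>x \<bullet> b - y \<bullet> b\<bar> ^ DIM('a) \<le> ?K * \<bar>cantor_map l (x \<bullet> b) - cantor_map l (y \<bullet> b)\<bar> powr s"
    using x y b by (intro cantor_map_inverse_Hoelder[OF l s]) auto
  also have "\<dots> \<le> ?K * (dist (q + \<epsilon> *\<^sub>R cantor_vec l x) (q + \<epsilon> *\<^sub>R cantor_vec l y) / \<epsilon>) powr s"
  proof (intro mult_left_mono powr_mono2)
    have "\<bar>cantor_map l (x \<bullet> b) - cantor_map l (y \<bullet> b)\<bar> = \<bar>(cantor_vec l x - cantor_vec l y) \<bullet> b\<bar>"
      by (simp only: inner_diff_left cantor_vec_inner[OF b])
    also have "\<dots> \<le> norm (cantor_vec l x - cantor_vec l y)"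
      by (rule Basis_le_norm[OF b])
    also have "\<dots> = dist (q + \<epsilon> *\<^sub>R cantor_vec l x) (q + \<epsilon> *\<^sub>R cantor_vec l y) / \<epsilon>"
      using \<epsilon> by (simp add: dist_norm scaleR_diff_right[symmetric])
    finally show "\<bar>cantor_map l (x \<bullet> b) - cantor_map l (y \<bullet> b)\<bar> \<le> dist (q + \<epsilon> *\<^sub>R cantor_vec l x) (q + \<epsilon> *\<^sub>R cantor_vec l y) / \<epsilon>" .
  qed (use s c in auto)
  also have "\<dots> = ?K / \<epsilon> powr s * dist (q + \<epsilon> *\<^sub>R cantor_vec l x) (q + \<epsilon> *\<^sub>R cantor_vec l y) powr s"
    using \<epsilon> by (subst powr_divide) auto
  finally show "\<bar>x \<bullet> b - y \<bullet> b\<bar> ^ DIM('a) \<le>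
    ?K / \<epsilon> powr s * dist (q + \<epsilon> *\<^sub>R cantor_vec l x) (q + \<epsilon> *\<^sub>R cantor_vec l y) powr s" .
qed

text \<open>Stage n is covered by at most \<open>2 ^ (N * n)\<close> balls of radius of order
  \<open>l ^ n\<close>, whose cost decays geometrically as soon as \<open>t\<close> exceeds
  \<open>s\<close>.\<close>

lemma hausdorff_measure_cantor_limit:
  fixes q :: "'a::euclidean_space"
  assumes l: "0 < l" "l < 1 / 2" and s: "l powr s = (1 / 2) ^ DIM('a)" and t: "0 < t" "s < t" and \<epsilon>: "0 < \<epsilon>"
  shows "hausdorff_measure t {x. \<forall>n. (1 / \<epsilon>) *\<^sub>R x + (- (1 / \<epsilon>) *\<^sub>R q) \<in> cantor_nbhd l n} = 0" (is "hausdorff_measure t ?Z = 0")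
proof (rule hausdorff_measure_eq_0_finite_covers[OF t(1)])
  fix e :: real assume e: "0 < e"
  let ?N = "DIM('a)"
  let ?\<rho> = "\<epsilon> * ?N"
  have \<rho>: "0 < ?\<rho>" using \<epsilon> by simp
  \<comment> \<open>The ratio of the costs of consecutive stages: \<open>2 ^ ?N\<close> times as
    many sets, each cheaper by \<open>l powr t\<close>.\<close>
  define \<kappa> where "\<kappa> = l powr (t - s)"
  have "\<kappa> < l powr 0" unfolding \<kappa>_def using l t by (intro powr_less_mono') auto
  then have \<kappa>: "0 < \<kappa>" "\<kappa> < 1" using l by (auto simp: \<kappa>_def)
  have \<kappa>_eq: "2 ^ ?N * l powr t = \<kappa>"
    unfolding \<kappa>_def powr_diff s by (simp add: power_divide)
  have \<rho>t: "0 < (2 * ?\<rho>) powr t" unfolding powr_gt_zero using \<epsilon> by simp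
  obtain n where n: "\<kappa> ^ n < e / (2 * ?\<rho>) powr t"
    using real_arch_pow_inv[OF divide_pos_pos[OF e \<rho>t] \<kappa>(2)] by blast
  obtain P :: "'a set" where P: "finite P" "card P \<le> (2 ^ ?N) ^ n" "cantor_nbhd l n \<subseteq> (\<Union>p\<in>P. (+) p ` cube (l ^ n))"
    using cantor_nbhd_cover[OF l] by blast
  define \<F> where "\<F> = (\<lambda>p. cball (q + \<epsilon> *\<^sub>R p) (?\<rho> * l ^ n)) ` P"
  have "?Z \<subseteq> \<Union>\<F>"
  proof
    fix x assume "x \<in> ?Z"
    then have "(1 / \<epsilon>) *\<^sub>R x + (- (1 / \<epsilon>) *\<^sub>R q) \<in> cantor_nbhd l n" by blast
    then obtain p z where p: "p \<in> P" "z \<in> cube (l ^ n)" "(1 / \<epsilon>) *\<^sub>R x + (- (1 / \<epsilon>) *\<^sub>R q) = p + z"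
      using P(3) by blast
    have "\<epsilon> *\<^sub>R (p + z) = x - q"
      unfolding p(3)[symmetric] using \<epsilon> by (simp add: algebra_simps)
    then have "x - (q + \<epsilon> *\<^sub>R p) = \<epsilon> *\<^sub>R z" by (simp add: algebra_simps)
    then have "dist (q + \<epsilon> *\<^sub>R p) x = \<epsilon> * norm z"
      using \<epsilon> by (simp add: dist_norm norm_minus_commute)
    also have "\<dots> \<le> \<epsilon> * (?N * l ^ n)"
      using \<epsilon> norm_le_cube[OF p(2)] by (intro mult_left_mono) auto
    finally have "x \<in> cball (q + \<epsilon> *\<^sub>R p) (?\<rho> * l ^ n)" by (simp add: mult.assoc)
    then show "x \<in> \<Union>\<F>" using p(1) unfolding \<F>_def by blast
  qed
  moreover have "finite \<F>" using P(1) by (simp add: \<F>_def)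
  moreover have "\<forall>X\<in>\<F>. bounded X \<and> diameter X \<le> 2 * ?\<rho> * l ^ n"
    using \<rho> l by (auto simp: \<F>_def diameter_cball)
  moreover have "card \<F> * (2 * ?\<rho> * l ^ n) powr t < e"
  proof -
    have "card \<F> \<le> (2 ^ ?N) ^ n"
      unfolding \<F>_def using card_image_le[OF P(1)] P(2) by (rule order_trans)
    then have "real (card \<F>) \<le> (2 ^ ?N) ^ n" by (metis of_nat_le_iff of_nat_numeral of_nat_power)
    then have "card \<F> * (2 * ?\<rho> * l ^ n) powr t \<le> (2 ^ ?N) ^ n * (2 * ?\<rho> * l ^ n) powr t"
      by (rule mult_right_mono) simp
    also have "\<dots> = (2 ^ ?N) ^ n * ((2 * ?\<rho>) powr t * (l powr t) ^ n)"
      using \<rho> l by (simp add: powr_mult powr_power powr_realpow[symmetric] powr_powr mult.commute)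
    also have "\<dots> = (2 * ?\<rho>) powr t * \<kappa> ^ n"
      unfolding \<kappa>_eq[symmetric] by (simp add: power_mult_distrib)
    also have "\<dots> < e" using n \<rho>t by (simp only: pos_less_divide_eq mult.commute)
    finally show ?thesis .
  qed
  moreover have "0 \<le> 2 * ?\<rho> * l ^ n" using \<rho> l by simp
  ultimately show "\<exists>\<F> d. finite \<F> \<and> ?Z \<subseteq> \<Union>\<F> \<and> (\<forall>X\<in>\<F>. bounded X \<and> diameter X \<le> d) \<and> 0 \<le> d \<and> card \<F> * d powr t < e"
    by blast
qed

text \<open>A sequence of smooth bumps \<open>\<psi> n\<close> such that \<open>\<Sum>n. \<psi> n\<close> converges in \<open>H\<^sup>2\<close> (with norms
  bounded by \<open>\<beta> n\<close>), is singular on \<open>A\<close>, and is locally a finite sum away from \<open>Z\<close>.\<close>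

definition singular_block ::
  "'a::euclidean_space \<Rightarrow> real \<Rightarrow> real \<Rightarrow> (nat \<Rightarrow> 'a \<Rightarrow> real) \<Rightarrow> (nat \<Rightarrow> real) \<Rightarrow> 'a set \<Rightarrow> 'a set \<Rightarrow> bool" where
  "singular_block q \<rho> s \<psi> \<beta> A Z \<longleftrightarrow>
    (\<forall>k n. Ck k (\<psi> n)) \<and> (\<forall>n x. 0 \<le> \<psi> n x) \<and> (\<forall>n x. \<psi> n x \<noteq> 0 \<longrightarrow> x \<in> cball q \<rho>) \<and>
    (\<forall>n. 0 < \<beta> n) \<and> summable \<beta> \<and>
    (\<forall>n. (LINT x|lebesgue. (\<psi> n x)\<^sup>2) \<le> (\<beta> n)\<^sup>2) \<and> (\<forall>n. (LINT x|lebesgue. (laplacian (\<psi> n) x)\<^sup>2) \<le> (\<beta> n)\<^sup>2) \<and>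
    A \<subseteq> cball q \<rho> \<and> ereal s \<le> hausdorff_dim A \<and>
    (\<forall>a\<in>A. \<exists>C>0. \<exists>\<gamma>>0. \<exists>r>0. \<forall>x\<in>ball a r - {a}. \<exists>n. C * norm (x - a) powr (- \<gamma>) \<le> \<psi> n x) \<and>
    hausdorff_measure (real DIM('a) - 4) Z = 0 \<and>
    (\<forall>a. a \<notin> Z \<longrightarrow> (\<exists>r>0. \<exists>m. \<forall>n\<ge>m. \<forall>x\<in>ball a r. \<psi> n x = 0))"

text \<open>The strict inequality \<open>s < N - 4\<close> leaves a spare exponent in the decay of
  the Laplacians; half of it is spent on letting the heights of the bumps grow.\<close>

lemma singular_block_exists:
  fixes q :: "'a::euclidean_space"
  assumes s: "0 < s" "s < real DIM('a) - 4" and \<rho>: "0 < \<rho>"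
  shows "\<exists>\<psi> \<beta> A Z. singular_block q \<rho> s \<psi> \<beta> A Z"
proof -
  let ?N = "DIM('a)"
  \<comment> \<open>Chosen so that \<open>l powr s\<close> is \<open>(1 / 2) ^ N\<close>; since
    \<open>s < N\<close>, this is below 1 / 2.\<close>
  define l where "l = 2 powr (- (?N / s))"
  have "l < 2 powr (- 1)"
    unfolding l_def using s by (intro powr_less_mono) (auto simp: field_simps)
  then have l: "0 < l" "l < 1 / 2"
    by (auto simp: l_def powr_minus)
  have ls: "l powr s = (1 / 2) ^ ?N"
  proof -
    have "- (?N / s) * s = - real ?N" using s by simp
    then have "l powr s = 2 powr (- real ?N)" unfolding l_def powr_powr by (simp only:)
    then show ?thesis by (simp add: powr_minus powr_realpow power_one_over inverse_eq_divide)
  qed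
  \<comment> \<open>A cube of half side \<open>\<epsilon>\<close> lies in a ball of radius N times
    \<open>\<epsilon>\<close>.\<close>
  define \<epsilon> where "\<epsilon> = \<rho> / ?N"
  have \<epsilon>: "0 < \<epsilon>" "\<epsilon> * ?N = \<rho>" using \<rho> by (auto simp: \<epsilon>_def)
  \<comment> \<open>Heights enter the norms squared, so a quarter of the spare exponent uses up half
    of it: the ratio \<open>\<tau>\<close> below equals
    \<open>l powr ((N - 4 - s) / 2)\<close>.\<close>
  define \<gamma> where "\<gamma> = (?N - 4 - s) / 4"
  have \<gamma>: "0 < \<gamma>" using s by (simp add: \<gamma>_def)
  define \<mu> where "\<mu> = l powr (- \<gamma>)"
  have \<mu>: "0 < \<mu>" using l by (simp add: \<mu>_def)
  define \<theta> where "\<theta> = (2 * l) ^ ?N / l ^ 4"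
  have \<theta>0: "0 < \<theta>" using l by (simp add: \<theta>_def)
  have \<theta>: "\<theta> = l powr (?N - 4 - s)"
  proof -
    have "4 \<le> ?N" using s by linarith
    then have "l ^ ?N = l ^ 4 * l ^ (?N - 4)" by (simp flip: power_add)
    then show ?thesis
      using l by (simp add: \<theta>_def powr_diff ls powr_realpow power_mult_distrib power_one_over field_simps)
  qed
  define \<tau> where "\<tau> = \<mu>\<^sup>2 * \<theta>"
  have "\<mu>\<^sup>2 = l powr (- (2 * \<gamma>))"
    using l by (simp add: \<mu>_def power2_eq_square powr_add[symmetric])
  then have "\<tau> = l powr (- (2 * \<gamma>) + (?N - 4 - s))"
    unfolding \<tau>_def \<theta> by (simp only: powr_add)
  also have "\<dots> < l powr 0"
    using l s by (intro powr_less_mono') (auto simp: \<gamma>_def)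
  finally have \<tau>: "0 < \<tau>" "\<tau> < 1" using \<mu> \<theta>0 l by (auto simp: \<tau>_def)
  let ?T = "\<lambda>x. (1 / \<epsilon>) *\<^sub>R x + (- (1 / \<epsilon>) *\<^sub>R q)"
  define \<psi> where "\<psi> n x = \<mu> ^ n * cantor_bump l n (?T x)" for n x
  define I where "I = (LINT x|lebesgue. (cantor_bump l 0 (x::'a))\<^sup>2)"
  define J where "J = (LINT x|lebesgue. (laplacian (cantor_bump l 0) (x::'a))\<^sup>2)"
  have IJ: "0 \<le> I" "0 \<le> J" by (auto simp: I_def J_def intro!: Bochner_Integration.integral_nonneg)
  \<comment> \<open>A common bound for both norms at stage 0 after rescaling by
    \<open>\<epsilon>\<close>; adding 1 makes it strictly positive.\<close>
  define C where "C = (\<epsilon> ^ ?N + \<epsilon> ^ ?N / \<epsilon> ^ 4) * (I + J) + 1"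
  have C: "0 < C" "\<epsilon> ^ ?N * I \<le> C" "\<epsilon> ^ ?N / \<epsilon> ^ 4 * J \<le> C"
  proof -
    define p r where "p = \<epsilon> ^ ?N" and "r = \<epsilon> ^ ?N / \<epsilon> ^ 4"
    have "0 \<le> p" "0 \<le> r" using \<epsilon>(1) by (simp_all add: p_def r_def)
    then have "0 \<le> p * I" "0 \<le> p * J" "0 \<le> r * I" "0 \<le> r * J" using IJ by simp_all
    moreover have "C = p * I + p * J + r * I + r * J + 1"
      unfolding C_def r_def[symmetric] unfolding p_def[symmetric] by (simp only: distrib_left distrib_right add.assoc)
    ultimately show "0 < C" "\<epsilon> ^ ?N * I \<le> C" "\<epsilon> ^ ?N / \<epsilon> ^ 4 * J \<le> C"
      unfolding r_def[symmetric] unfolding p_def[symmetric] by linarith+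
  qed
  define \<beta> where "\<beta> n = sqrt (C * \<tau> ^ n)" for n
  have \<beta>2: "(\<beta> n)\<^sup>2 = C * \<tau> ^ n" for n using C \<tau> by (simp add: \<beta>_def)
  define A where "A = (\<lambda>x. q + \<epsilon> *\<^sub>R cantor_vec l x) ` {x. \<forall>b\<in>Basis. 0 \<le> x \<bullet> b \<and> x \<bullet> b < 1}"
  define Z where "Z = {x. \<forall>n. ?T x \<in> cantor_nbhd l n}"
  have in_cball: "x \<in> cball q \<rho>" if "?T x \<in> cube 1" for x
  proof -
    have "x - q = \<epsilon> *\<^sub>R ?T x" using \<epsilon> by (simp add: algebra_simps)
    then have "norm (x - q) = \<epsilon> * norm (?T x)"
      using \<epsilon> by (metis abs_of_pos norm_scaleR)
    also have "\<dots> \<le> \<epsilon> * (real ?N * 1)"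
      by (rule mult_left_mono[OF norm_le_cube[OF that]]) (use \<epsilon> in simp)
    finally have "norm (x - q) \<le> \<epsilon> * ?N" by simp
    then show ?thesis using \<epsilon>(2) by (simp add: dist_norm norm_minus_commute)
  qed
  have "singular_block q \<rho> s \<psi> \<beta> A Z"
    unfolding singular_block_def
  proof (intro conjI allI ballI impI)
    show "Ck k (\<psi> n)" for k n
      unfolding \<psi>_def by (intro Ck_cmult Ck_affine Ck_cantor_bump)
    show "0 \<le> \<psi> n x" for n x
      unfolding \<psi>_def by (intro mult_nonneg_nonneg cantor_bump_nonneg) (use \<mu> in simp)
    show "x \<in> cball q \<rho>" if "\<psi> n x \<noteq> 0" for n x
    proof (rule in_cball)
      have "?T x \<in> cube (2 * l)"
        using that by (intro cantor_bump_support[OF l, of n]) (auto simp: \<psi>_def)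
      then show "?T x \<in> cube 1" using l by (force simp: mem_cube)
    qed
    show "0 < \<beta> n" for n using C \<tau> by (simp add: \<beta>_def)
    have "summable (\<lambda>n. sqrt C * sqrt \<tau> ^ n)"
      using \<tau> by (intro summable_mult summable_geometric) auto
    then show "summable \<beta>" unfolding \<beta>_def by (simp add: real_sqrt_mult real_sqrt_power)
    have \<mu>2: "(\<mu> ^ n)\<^sup>2 * \<theta> ^ n = \<tau> ^ n" for n
      by (simp add: \<tau>_def power_mult_distrib power_mult[symmetric] mult.commute)
    show "(LINT x|lebesgue. (\<psi> n x)\<^sup>2) \<le> (\<beta> n)\<^sup>2" for n
    proof -
      have "(LINT x|lebesgue. (cantor_bump l n (?T x))\<^sup>2) = (LINT x|lebesgue. (cantor_bump l n (x::'a))\<^sup>2) / (1 / \<epsilon>) ^ ?N"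
        using \<epsilon> by (intro integral_affine continuous_intros Ck_continuous_on[OF Ck_cantor_bump[of 0]]) auto
      also have "\<dots> \<le> (((2 * l) ^ ?N) ^ n * I) / (1 / \<epsilon>) ^ ?N"
        unfolding I_def using \<epsilon> by (intro divide_right_mono integral_cantor_bump_sq_le[OF l]) auto
      also have "\<dots> \<le> (\<theta> ^ n * I) / (1 / \<epsilon>) ^ ?N"
      proof (intro divide_right_mono mult_right_mono power_mono)
        \<comment> \<open>The bumps themselves decay at least as fast as their Laplacians, so one
          ratio serves both estimates.\<close>
        have "l ^ 4 \<le> 1" using l by (simp add: power_le_one)
        then show "(2 * l) ^ ?N \<le> \<theta>"
          unfolding \<theta>_def using l by (simp add: pos_le_divide_eq mult_left_le)
      qed (use IJ \<epsilon> l in auto)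
      finally have "(\<mu> ^ n)\<^sup>2 * (LINT x|lebesgue. (cantor_bump l n (?T x))\<^sup>2) \<le> (\<mu> ^ n)\<^sup>2 * ((\<theta> ^ n * I) / (1 / \<epsilon>) ^ ?N)"
        by (rule mult_left_mono) simp
      also have "\<dots> = \<tau> ^ n * (\<epsilon> ^ ?N * I)"
        unfolding \<mu>2[symmetric] by (simp add: power_divide)
      also have "\<dots> \<le> \<tau> ^ n * C" using C \<tau> by (intro mult_left_mono) auto
      also have "\<dots> = (\<beta> n)\<^sup>2" by (simp only: \<beta>2 mult.commute)
      also have "(\<mu> ^ n)\<^sup>2 * (LINT x|lebesgue. (cantor_bump l n (?T x))\<^sup>2) = (LINT x|lebesgue. (\<psi> n x)\<^sup>2)"
        unfolding \<psi>_def power_mult_distrib by (rule integral_mult_right_zero[symmetric])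
      finally show ?thesis .
    qed
    show "(LINT x|lebesgue. (laplacian (\<psi> n) x)\<^sup>2) \<le> (\<beta> n)\<^sup>2" for n
    proof -
      have "(LINT x|lebesgue. (laplacian (cantor_bump l n) (?T x))\<^sup>2) =
          (LINT x|lebesgue. (laplacian (cantor_bump l n) (x::'a))\<^sup>2) / (1 / \<epsilon>) ^ ?N"
      proof (rule integral_affine)
        show "continuous_on UNIV (\<lambda>x::'a. (laplacian (cantor_bump l n) x)\<^sup>2)"
          by (intro continuous_intros Ck_continuous_on[of 0] Ck_pd Ck_cantor_bump)
      qed (use \<epsilon> in simp)
      also have "\<dots> \<le> (\<theta> ^ n * J) / (1 / \<epsilon>) ^ ?N"
        unfolding J_def \<theta>_def using \<epsilon> by (intro divide_right_mono integral_laplacian_cantor_bump_sq_le[OF l]) auto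
      finally have "(\<mu> ^ n * (1 / \<epsilon>)\<^sup>2)\<^sup>2 * (LINT x|lebesgue. (laplacian (cantor_bump l n) (?T x))\<^sup>2) \<le>
          (\<mu> ^ n * (1 / \<epsilon>)\<^sup>2)\<^sup>2 * ((\<theta> ^ n * J) / (1 / \<epsilon>) ^ ?N)"
        by (rule mult_left_mono) simp
      also have "\<dots> = \<tau> ^ n * (\<epsilon> ^ ?N / \<epsilon> ^ 4 * J)"
        unfolding \<mu>2[symmetric] power_mult_distrib by (simp add: power_divide power_mult[symmetric])
      also have "\<dots> \<le> \<tau> ^ n * C" using C \<tau> by (intro mult_left_mono) auto
      also have "\<dots> = (\<beta> n)\<^sup>2" by (simp only: \<beta>2 mult.commute)
      also have "(\<mu> ^ n * (1 / \<epsilon>)\<^sup>2)\<^sup>2 * (LINT x|lebesgue. (laplacian (cantor_bump l n) (?T x))\<^sup>2) = (LINT x|lebesgue. (laplacian (\<psi> n) x)\<^sup>2)"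
      proof -
        have "laplacian (\<psi> n) x = (\<mu> ^ n * (1 / \<epsilon>)\<^sup>2) * laplacian (cantor_bump l n) (?T x)" for x
          using laplacian_affine[where f="cantor_bump l n" and m="\<mu> ^ n" and c="1 / \<epsilon>", OF Ck_cantor_bump]
          unfolding \<psi>_def .
        then show ?thesis by (simp only: power_mult_distrib integral_mult_right_zero)
      qed
      finally show ?thesis .
    qed
    show "A \<subseteq> cball q \<rho>"
    proof
      fix a assume "a \<in> A"
      then obtain x where x: "a = q + \<epsilon> *\<^sub>R cantor_vec l x" by (auto simp: A_def)
      have "?T a = cantor_vec l x" using \<epsilon> by (simp add: x algebra_simps)
      moreover have "cantor_vec l x \<in> cube 1"
      proof -
        have "l / (1 - l) \<le> 1" using l by (simp add: divide_le_eq_1)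
        then have "\<bar>cantor_map l y\<bar> \<le> 1" for y
          using abs_cantor_map_le[OF l, of y] by linarith
        then show ?thesis by (simp add: mem_cube cantor_vec_inner)
      qed
      ultimately show "a \<in> cball q \<rho>" by (intro in_cball) simp
    qed
    show "ereal s \<le> hausdorff_dim A"
      unfolding A_def by (rule hausdorff_dim_cantor_set[OF l s(1) ls \<epsilon>(1)])
    show "\<exists>C>0. \<exists>\<gamma>>0. \<exists>r>0. \<forall>x\<in>ball a r - {a}. \<exists>n. C * norm (x - a) powr (- \<gamma>) \<le> \<psi> n x" if aA: "a \<in> A" for a
    proof -
      obtain z where a: "a = q + \<epsilon> *\<^sub>R cantor_vec l z" using aA by (auto simp: A_def)
      \<comment> \<open>The midpoint between the bound for the dust and the half side of the base
        bump; \<open>h\<close> is half of that gap, so a perturbation by \<open>h\<close> stays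
        where the bump is bounded below.\<close>
      define r where "r = (2 * l + l / (1 - l)) / 2"
      define h where "h = (2 * l - l / (1 - l)) / 2"
      have "l / (1 - l) < 2 * l" using l by (simp add: field_simps)
      moreover have "0 < (2 * l - e) / 2 \<and> (2 * l + e) / 2 < 2 * l \<and> e + (2 * l - e) / 2 \<le> (2 * l + e) / 2"
        if "e < 2 * l" for e :: real
        using that by (auto simp: field_simps)
      ultimately have h: "0 < h" "r < 2 * l" "l / (1 - l) + h \<le> r"
        unfolding h_def r_def by blast+
      have r0: "0 < r" using l by (auto simp: r_def intro!: add_pos_pos)
      define m where "m = flat 0 ((2 * l)\<^sup>2 - r\<^sup>2) ^ ?N"
      have "r\<^sup>2 < (2 * l)\<^sup>2" using h r0 by (intro power_strict_mono) auto
      then have m: "0 < m" unfolding m_def by (intro zero_less_power flat_pos) simp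
      \<comment> \<open>The factor \<open>\<epsilon> * h\<close> is the unit of length used for
        \<open>d\<close>, and \<open>l\<close> pays for the index n being determined by
        \<open>d\<close> only up to one stage.\<close>
      let ?C = "m * (\<epsilon> * h * l) powr \<gamma>"
      have "\<exists>n. ?C * norm (x - a) powr (- \<gamma>) \<le> \<psi> n x" if x: "x \<in> ball a (\<epsilon> * h) - {a}" for x
      proof -
        \<comment> \<open>In this unit, \<open>d \<le> l ^ n\<close> is exactly the tolerance under
          which \<open>cantor_bump_lower\<close> applies at stage n.\<close>
        define d where "d = norm (x - a) / (\<epsilon> * h)"
        have d: "0 < d" "d \<le> 1" using x h \<epsilon> by (auto simp: d_def dist_norm norm_minus_commute)
        obtain n where n: "l ^ Suc n < d" "d \<le> l ^ n"
          by (rule geometric_bracket[OF d l(1)]) (use l in auto)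
        have "m \<le> cantor_bump l n (?T x)"
          unfolding m_def
        proof (rule cantor_bump_lower[OF l h(3), where x = z])
          show "0 \<le> h" using h by simp
          fix b :: 'a assume b: "b \<in> Basis"
          have "?T x - cantor_vec l z = (1 / \<epsilon>) *\<^sub>R (x - a)"
            using \<epsilon> by (simp add: a algebra_simps)
          then have "?T x \<bullet> b - cantor_map l (z \<bullet> b) = (1 / \<epsilon>) * ((x - a) \<bullet> b)"
            by (metis b cantor_vec_inner inner_diff_left inner_scaleR_left)
          also have "\<bar>\<dots>\<bar> \<le> (1 / \<epsilon>) * norm (x - a)"
            unfolding abs_mult using \<epsilon> Basis_le_norm[OF b, of "x - a"] by (intro mult_mono) auto
          also have "\<dots> = h * d" using h \<epsilon> by (simp add: d_def)
          also have "\<dots> \<le> h * l ^ n" using h n by simp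
          finally show "\<bar>?T x \<bullet> b - cantor_map l (z \<bullet> b)\<bar> \<le> h * l ^ n" .
        qed
        then have "\<mu> ^ n * m \<le> \<psi> n x" unfolding \<psi>_def using \<mu> by simp
        moreover have "?C * norm (x - a) powr (- \<gamma>) \<le> \<mu> ^ n * m"
        proof -
          have "norm (x - a) = d * (\<epsilon> * h)" using h \<epsilon> by (simp add: d_def)
          then have "(\<epsilon> * h * l) powr \<gamma> * norm (x - a) powr (- \<gamma>) = (d / l) powr (- \<gamma>)"
            using h \<epsilon> l d by (simp add: powr_mult powr_divide powr_minus field_simps)
          also have "\<dots> \<le> (l ^ n) powr (- \<gamma>)"
            using n l \<gamma> by (intro powr_mono2') (auto simp: field_simps)
          also have "\<dots> = \<mu> ^ n"
            using l by (simp add: \<mu>_def powr_realpow[symmetric] powr_powr powr_power mult.commute)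
          finally show ?thesis using m by (simp add: mult.assoc mult.commute mult_left_mono)
        qed
        ultimately show ?thesis by (intro exI[of _ n]) linarith
      qed
      moreover have "0 < ?C" using m h \<epsilon> l by simp
      moreover have "0 < \<epsilon> * h" using h \<epsilon> by simp
      ultimately show ?thesis using \<gamma> by blast
    qed
    show "hausdorff_measure (real ?N - 4) Z = 0"
      unfolding Z_def by (rule hausdorff_measure_cantor_limit[OF l ls _ _ \<epsilon>(1)]) (use s in auto)
    show "\<exists>r>0. \<exists>m. \<forall>n\<ge>m. \<forall>x\<in>ball a r. \<psi> n x = 0" if aZ: "a \<notin> Z" for a
    proof -
      \<comment> \<open>The stages are nested, so leaving one means leaving all later ones, and the
        complement of the compact stage is open.\<close>
      obtain m where m: "?T a \<notin> cantor_nbhd l m" using aZ unfolding Z_def by blast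
      have "open (?T -` (- cantor_nbhd l m))"
        using compact_imp_closed[OF compact_cantor_nbhd[OF l, where 'a='a]]
        by (intro open_vimage continuous_intros) auto
      moreover have "a \<in> ?T -` (- cantor_nbhd l m)" using m by simp
      ultimately obtain r where r: "r > 0" "ball a r \<subseteq> ?T -` (- cantor_nbhd l m)"
        using openE by blast
      have "\<psi> n x = 0" if "m \<le> n" "x \<in> ball a r" for n x
      proof -
        have "?T x \<notin> cantor_nbhd l m" using r(2) that(2) by blast
        then have "?T x \<notin> cantor_nbhd l n" using cantor_nbhd_antimono[OF l that(1)] by blast
        then have "cantor_bump l n (?T x) = 0" using cantor_bump_support_nbhd[OF l] by blast
        then show ?thesis by (simp add: \<psi>_def)
      qed
      then show ?thesis using r(1) by blast
    qed
  qed
  then show ?thesis by blast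
qed

section \<open>Singular sets and singular dimension\<close>

lemma AE_lebesgue_on_ex:
  fixes S T :: "'a::euclidean_space set"
  assumes S: "open S" and P: "AE x in lebesgue_on S. P x" and T: "T \<subseteq> S" "T \<in> sets borel" "emeasure lborel T \<noteq> 0"
  shows "\<exists>x\<in>T. P x"
proof (rule ccontr)
  assume "\<not> (\<exists>x\<in>T. P x)"
  moreover have "AE x in lebesgue. x \<in> S \<longrightarrow> P x"
    using S P by (subst AE_restrict_space_iff[symmetric]) auto
  ultimately have "AE x in lebesgue. x \<notin> T"
    using T(1) by (auto elim!: eventually_mono)
  then have "T \<in> null_sets lebesgue"
    using T(2) by (subst AE_iff_null_sets) auto
  then show False using T(2,3) by (auto simp: null_sets_def)
qed

lemma emeasure_ball_pos: "0 < r \<Longrightarrow> emeasure lborel (ball (a::'a::euclidean_space) r) \<noteq> 0"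
  using content_ball_pos[of r a] by (auto simp: measure_def)

text \<open>Singularity is tested by inequalities almost everywhere on balls inside the domain, so
  it does not depend on the representative.\<close>

lemma singular_set_AE_cong:
  fixes u v :: "'a::euclidean_space \<Rightarrow> real"
  assumes \<Omega>: "open \<Omega>" and ae: "AE x in lebesgue_on \<Omega>. u x = v x" and U: "U \<subseteq> \<Omega>"
  shows "singular_set U (\<lambda>x. ereal (u x)) = singular_set U (\<lambda>x. ereal (v x))"
proof -
  have sub: "singular_set U (\<lambda>x. ereal (f x)) \<subseteq> singular_set U (\<lambda>x. ereal (g x))"
    if ae: "AE x in lebesgue. x \<in> \<Omega> \<longrightarrow> f x = g x" for f g :: "'a \<Rightarrow> real"
  proof
    fix a assume "a \<in> singular_set U (\<lambda>x. ereal (f x))"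
    then obtain C \<gamma> r where a: "a \<in> U" "0 < C" "0 < \<gamma>" "0 < r" "ball a r \<subseteq> U"
        "AE x in lebesgue_on (ball a r). ereal (C * norm (x - a) powr (- \<gamma>)) \<le> ereal (f x)"
      by (auto simp: singular_set_def)
    have "AE x in lebesgue. x \<in> ball a r \<longrightarrow> ereal (C * norm (x - a) powr (- \<gamma>)) \<le> ereal (f x)"
      using a(6) by (subst AE_restrict_space_iff[symmetric]) auto
    then have "AE x in lebesgue. x \<in> ball a r \<longrightarrow> ereal (C * norm (x - a) powr (- \<gamma>)) \<le> ereal (g x)"
      using ae by eventually_elim (use a(5) U in auto)
    then have "AE x in lebesgue_on (ball a r). ereal (C * norm (x - a) powr (- \<gamma>)) \<le> ereal (g x)"
      by (subst AE_restrict_space_iff) auto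
    with a show "a \<in> singular_set U (\<lambda>x. ereal (g x))"
      unfolding singular_set_def by blast
  qed
  have "AE x in lebesgue. x \<in> \<Omega> \<longrightarrow> u x = v x"
    using \<Omega> ae by (subst AE_restrict_space_iff[symmetric]) auto
  moreover from this have "AE x in lebesgue. x \<in> \<Omega> \<longrightarrow> v x = u x"
    by eventually_elim auto
  ultimately show ?thesis using sub by blast
qed

lemma singular_dim_AE_cong:
  fixes u v :: "'a::euclidean_space \<Rightarrow> real"
  assumes "open \<Omega>" "AE x in lebesgue_on \<Omega>. u x = v x"
  shows "singular_dim \<Omega> (\<lambda>x. ereal (u x)) a = singular_dim \<Omega> (\<lambda>x. ereal (v x)) a"
  unfolding singular_dim_def using singular_set_AE_cong[OF assms, of "ball a r \<inter> \<Omega>" for r] by simp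

lemma singular_dim_eqI:
  assumes "0 < R" "\<And>r. 0 < r \<Longrightarrow> r < R \<Longrightarrow> hausdorff_dim (singular_set (ball a r \<inter> \<Omega>) u) = c"
  shows "singular_dim \<Omega> u a = c"
proof (rule tendsto_unique[OF _ tendsto_singular_dim])
  show "((\<lambda>r. hausdorff_dim (singular_set (ball a r \<inter> \<Omega>) u)) \<longlongrightarrow> c) (at_right 0)"
    by (rule Lim_transform_eventually[OF tendsto_const])
      (use assms in \<open>auto simp: eventually_at_right_field\<close>)
qed simp

lemma singular_dim_eq_0:
  fixes u :: "'a::euclidean_space \<Rightarrow> real"
  assumes V: "open V" "V \<subseteq> \<Omega>" "a \<in> V" and u: "\<And>x. x \<in> V \<Longrightarrow> u x = 0"
  shows "singular_dim \<Omega> (\<lambda>x. ereal (u x)) a = 0"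
proof -
  obtain R where R: "0 < R" "ball a R \<subseteq> V" using V openE by blast
  show ?thesis
  proof (rule singular_dim_eqI[OF R(1)])
    fix r assume r: "0 < r" "r < R"
    have "singular_set (ball a r \<inter> \<Omega>) (\<lambda>x. ereal (u x)) = {}"
    proof (rule ccontr)
      assume "singular_set (ball a r \<inter> \<Omega>) (\<lambda>x. ereal (u x)) \<noteq> {}"
      then obtain b C \<gamma> s where b: "0 < C" "0 < s" "ball b s \<subseteq> ball a r \<inter> \<Omega>"
          "AE x in lebesgue_on (ball b s). ereal (C * norm (x - b) powr (- \<gamma>)) \<le> ereal (u x)"
        by (auto simp: singular_set_def)
      \<comment> \<open>The centre is removed because \<open>0 powr (- \<gamma>)\<close> is 0, so
        the lower bound is not positive there.\<close>
      have "emeasure lborel (ball b s - {b}) \<noteq> 0"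
        using emeasure_ball_pos[OF b(2), of b] b(2) by (subst emeasure_Diff) auto
      then have "\<exists>x\<in>ball b s - {b}. ereal (C * norm (x - b) powr (- \<gamma>)) \<le> ereal (u x)"
        by (intro AE_lebesgue_on_ex[OF open_ball b(4)]) auto
      then obtain x where "x \<in> ball b s - {b}" "ereal (C * norm (x - b) powr (- \<gamma>)) \<le> ereal (u x)" by blast
      then have x: "x \<in> ball b s" "x \<noteq> b" "C * norm (x - b) powr (- \<gamma>) \<le> u x" by simp_all
      have "x \<in> ball a r" using x(1) b(3) by blast
      then have "x \<in> V" using r R by auto
      moreover have "0 < C * norm (x - b) powr (- \<gamma>)" using b(1) x(2) by simp
      ultimately show False using u[of x] x(3) by simp
    qed
    then show "hausdorff_dim (singular_set (ball a r \<inter> \<Omega>) (\<lambda>x. ereal (u x))) = 0"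
      by (simp add: hausdorff_dim_empty)
  qed
qed

section \<open>Superposition of countably many blocks\<close>

lemma summable_prod_decode:
  fixes a :: "nat \<Rightarrow> nat \<Rightarrow> real"
  assumes a: "\<And>j n. 0 \<le> a j n" "\<And>j. summable (a j)" and b: "\<And>j. suminf (a j) \<le> b j" "summable b"
  shows "summable (\<lambda>i. case prod_decode i of (j, n) \<Rightarrow> a j n)"
\<comment> \<open>In \<open>ennreal\<close> the double series may be rearranged freely; finiteness
  of its value then gives real summability.\<close>
proof (rule summable_suminf_not_top)
  show "0 \<le> (case prod_decode i of (j, n) \<Rightarrow> a j n)" for i
    using a(1) by (simp split: prod.split)
  have b0: "0 \<le> b j" for j
    using suminf_nonneg[OF a(2) a(1), of j] b(1)[of j] by linarith
  have "(\<Sum>i. ennreal (case prod_decode i of (j, n) \<Rightarrow> a j n)) = (\<Sum>j n. ennreal (a j n))"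
    using suminf_ennreal_2dimen[of "\<lambda>j. \<Sum>n. ennreal (a j n)" "\<lambda>(j, n). ennreal (a j n)"]
    by (simp add: prod.case_distrib)
  also have "\<dots> = (\<Sum>j. ennreal (suminf (a j)))"
    using a by (intro suminf_cong suminf_ennreal2)
  also have "\<dots> \<le> (\<Sum>j. ennreal (b j))"
    using b(1) by (intro suminf_le summableI ennreal_leI)
  also have "\<dots> = ennreal (suminf b)"
    using b0 b(2) by (rule suminf_ennreal2)
  finally show "(\<Sum>i. ennreal (case prod_decode i of (j, n) \<Rightarrow> a j n)) \<noteq> top"
    by (auto simp: top_unique)
qed

lemma laplacian_cmult:
  assumes "\<And>k. Ck k f"
  shows "laplacian (\<lambda>x. m * f x) x = m * laplacian f x"
  using laplacian_affine[OF assms, of m 1 0 x] by simp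

text \<open>The \<open>j\<close>-th small ball can meet \<open>ball a \<sigma>\<close> only if \<open>2 ^ (j + 2) * \<rho> j \<le> \<sigma>\<close>, so that together they fill
  at most half of \<open>ball a \<sigma>\<close>.\<close>

lemma ball_minus_tiny_balls_positive:
  fixes a :: "'a::euclidean_space"
  assumes \<rho>: "\<And>j::nat. 0 < \<rho> j" and far: "\<And>j. J \<le> j \<Longrightarrow> 2 ^ (j + 3) * \<rho> j \<le> dist (q j) a" and \<sigma>: "0 < \<sigma>"
  shows "emeasure lborel (ball a \<sigma> - (\<Union>j\<in>{J..}. cball (q j) (\<rho> j)) - {a}) \<noteq> 0"
proof
  let ?T = "\<Union>j\<in>{J..}. cball (q j) (\<rho> j)"
  assume 0: "emeasure lborel (ball a \<sigma> - ?T - {a}) = 0"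
  define B where "B = measure lborel (ball a \<sigma>)"
  have B: "0 < B" unfolding B_def by (rule content_ball_pos[OF \<sigma>])
  have eB: "emeasure lborel (ball a \<sigma>) = ennreal B"
    unfolding B_def using emeasure_bounded_finite[OF bounded_ball, of a \<sigma>]
    by (intro emeasure_eq_ennreal_measure) simp
  define W where "W j = (if J \<le> j then cball (q j) (\<rho> j) \<inter> ball a \<sigma> else {})" for j
  \<comment> \<open>These bounds add up to \<open>B / 2\<close>, which is less than the volume of
    the ball.\<close>
  have W: "emeasure lborel (W j) \<le> ennreal (B / 4 * (1 / 2) ^ j)" for j
  proof (cases "W j = {}")
    case False
    then obtain x where x: "J \<le> j" "x \<in> cball (q j) (\<rho> j)" "x \<in> ball a \<sigma>"
      by (auto simp: W_def split: if_splits)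
    have "2 ^ (j + 3) * \<rho> j \<le> \<sigma> + \<rho> j"
      using far[OF x(1)] x(2,3) dist_triangle[of "q j" a x] by (simp add: dist_commute)
    \<comment> \<open>The exponent j + 3 in \<open>far\<close> has one factor 2 to spare, which
      absorbs the radius on the right-hand side.\<close>
    moreover have "1 * \<rho> j \<le> 2 ^ (j + 2) * \<rho> j"
      using \<rho>[of j] by (intro mult_right_mono one_le_power) auto
    ultimately have \<rho>\<sigma>: "\<rho> j * 2 ^ (j + 2) \<le> \<sigma>"
      by (simp add: power_add algebra_simps)
    have "emeasure lborel (W j) \<le> emeasure lborel (cball (q j) (\<rho> j))"
      by (intro emeasure_mono) (auto simp: W_def)
    also have "\<dots> = ennreal (measure lborel (cball (q j) (\<rho> j)))"
      using emeasure_bounded_finite[OF bounded_cball, of "q j" "\<rho> j"] by (intro emeasure_eq_ennreal_measure) simp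
    also have "measure lborel (cball (q j) (\<rho> j)) = \<rho> j ^ DIM('a) * measure lborel (ball (0::'a) 1)"
      unfolding content_cball_conv_ball using \<rho>[of j] by (intro content_ball_conv_unit_ball) simp
    also have "ennreal \<dots> \<le> ennreal ((\<sigma> * (1 / 2) ^ (j + 2)) ^ DIM('a) * measure lborel (ball (0::'a) 1))"
      using \<rho>[of j] \<rho>\<sigma> by (intro ennreal_leI mult_right_mono power_mono) (auto simp: field_simps power_one_over)
    also have "(\<sigma> * (1 / 2) ^ (j + 2)) ^ DIM('a) * measure lborel (ball (0::'a) 1) = ((1 / 2) ^ (j + 2)) ^ DIM('a) * B"
      unfolding B_def content_ball_conv_unit_ball[OF less_imp_le[OF \<sigma>], of a] power_mult_distrib
      by (simp only: mult_ac)
    also have "ennreal \<dots> \<le> ennreal ((1 / 2) ^ (j + 2) * B)"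
    proof (intro ennreal_leI mult_right_mono)
      show "((1 / 2 :: real) ^ (j + 2)) ^ DIM('a) \<le> (1 / 2) ^ (j + 2)"
      proof -
        have "y ^ DIM('a) \<le> y" if "0 \<le> y" "y \<le> 1" for y :: real
          using power_decreasing[of 1 "DIM('a)" y] that by (simp add: Suc_leI)
        note le = this[OF zero_le_power power_le_one]
        show ?thesis by (rule le) simp_all
      qed
    qed (use B in simp)
    finally show ?thesis by (simp add: power_add mult.commute)
  qed (use B in simp)
  have "ball a \<sigma> \<subseteq> (ball a \<sigma> - ?T - {a}) \<union> {a} \<union> (\<Union>j. W j)"
    by (auto simp: W_def)
  then have "emeasure lborel (ball a \<sigma>) \<le> emeasure lborel ((ball a \<sigma> - ?T - {a}) \<union> {a} \<union> (\<Union>j. W j))"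
    by (intro emeasure_mono) (auto simp: W_def)
  also have "\<dots> \<le> emeasure lborel ((ball a \<sigma> - ?T - {a}) \<union> {a}) + emeasure lborel (\<Union>j. W j)"
    by (intro emeasure_subadditive) (auto simp: W_def)
  finally have le: "ennreal B \<le> emeasure lborel ((ball a \<sigma> - ?T - {a}) \<union> {a}) + emeasure lborel (\<Union>j. W j)"
    unfolding eB .
  have "emeasure lborel ((ball a \<sigma> - ?T - {a}) \<union> {a}) \<le> emeasure lborel (ball a \<sigma> - ?T - {a}) + emeasure lborel {a}"
    by (intro emeasure_subadditive) auto
  then have null: "emeasure lborel ((ball a \<sigma> - ?T - {a}) \<union> {a}) = 0" using 0 by simp
  have "emeasure lborel (\<Union>j. W j) \<le> (\<Sum>j. emeasure lborel (W j))"
    by (intro emeasure_subadditive_countably) (auto simp: W_def)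
  also have "\<dots> \<le> (\<Sum>j. ennreal (B / 4 * (1 / 2) ^ j))"
    by (intro suminf_le summableI W)
  also have "\<dots> = ennreal (\<Sum>j. B / 4 * (1 / 2) ^ j)"
    using B by (intro suminf_ennreal2 summable_mult summable_geometric) auto
  also have "(\<Sum>j. B / 4 * (1 / 2) ^ j) = B / 2"
    by (subst suminf_mult) (auto simp: suminf_geometric)
  finally have "ennreal B \<le> ennreal (B / 2)"
    using le unfolding null by (simp only: add_0)
  then show False using B by (simp add: ennreal_le_iff)
qed

text \<open>The lower bound for the dimension is local: all terms are nonnegative, so one block
  contained in the given ball suffices. The upper bound is global: it is proved for the singular set
  over the whole domain and inherited by monotonicity. Hence the dimension is the same for every
  radius and the limit is immediate.\<close>

lemma singular_sum_exists:
  fixes \<Omega> \<Omega>\<^sub>s :: "'a::euclidean_space set"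
  assumes dim: "5 \<le> DIM('a)" and \<Omega>: "open \<Omega>" and \<Omega>s: "open \<Omega>\<^sub>s" "\<Omega>\<^sub>s \<subseteq> \<Omega>" "\<Omega>\<^sub>s \<noteq> {}"
  obtains F u where "F \<in> L2_on \<Omega>" "weak_solution \<Omega> F u" "\<And>x. x \<notin> \<Omega>\<^sub>s \<Longrightarrow> u x = 0"
    "\<And>a. a \<in> closure \<Omega>\<^sub>s \<Longrightarrow> singular_dim \<Omega> (\<lambda>x. ereal (u x)) a = ereal (real DIM('a) - 4)"
proof -
  let ?N = "DIM('a)"
  obtain D :: "'a set" where D: "countable D" "\<And>X. open X \<Longrightarrow> X \<noteq> {} \<Longrightarrow> \<exists>d\<in>D. d \<in> X"
    using countable_dense_exists by blast
  define p where "p = from_nat_into (D \<inter> \<Omega>\<^sub>s)"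
  have ne: "D \<inter> \<Omega>\<^sub>s \<noteq> {}" using D(2)[OF \<Omega>s(1,3)] by blast
  have p_in: "p i \<in> \<Omega>\<^sub>s" for i
    using from_nat_into[OF ne, of i] by (simp add: p_def)
  have p_dense: "\<exists>i. p i \<in> X" if X: "open X" "X \<inter> \<Omega>\<^sub>s \<noteq> {}" for X
  proof -
    obtain d where "d \<in> D" "d \<in> X \<inter> \<Omega>\<^sub>s" using D(2)[of "X \<inter> \<Omega>\<^sub>s"] X \<Omega>s(1) by blast
    moreover have "range p = D \<inter> \<Omega>\<^sub>s"
      unfolding p_def using ne D(1) by (intro range_from_nat_into) auto
    ultimately show ?thesis by (metis IntE IntI rangeE)
  qed
  \<comment> \<open>The index j encodes a pair: a point of the dense sequence and the precision to
    which \<open>s j\<close> approximates N - 4, so every point carries blocks of all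
    precisions.\<close>
  define q where "q j = p (fst (prod_decode j))" for j
  define s where "s j = real ?N - 4 - 1 / (real (snd (prod_decode j)) + 2)" for j
  have s: "0 < s j" "s j < real ?N - 4" for j
  proof -
    have "1 / (real (snd (prod_decode j)) + 2) < 1" by simp
    moreover have "1 \<le> real ?N - 4" using dim by simp
    ultimately show "0 < s j" unfolding s_def by linarith
  qed (simp add: s_def)
  \<comment> \<open>The bound on the radius makes the ball enlarged by \<open>2 ^ (j + 3)\<close>
    have diameter at most \<open>(1 / 2) ^ j\<close>, as the limsup argument requires.\<close>
  have "\<exists>\<rho>>0. \<rho> \<le> (1 / 2) ^ j / 2 ^ (j + 4) \<and> cball (q j) \<rho> \<subseteq> \<Omega>\<^sub>s" for j
  proof -
    obtain e where e: "0 < e" "cball (q j) e \<subseteq> \<Omega>\<^sub>s"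
      using \<Omega>s(1) p_in[of "fst (prod_decode j)"] unfolding q_def open_contains_cball by blast
    have "cball (q j) (min e ((1 / 2) ^ j / 2 ^ (j + 4))) \<subseteq> cball (q j) e" by (rule subset_cball) simp
    then show ?thesis
      using e by (intro exI[of _ "min e ((1 / 2) ^ j / 2 ^ (j + 4))"]) auto
  qed
  then obtain \<rho> where \<rho>: "\<And>j. 0 < \<rho> j" "\<And>j. \<rho> j \<le> (1 / 2) ^ j / 2 ^ (j + 4)" "\<And>j. cball (q j) (\<rho> j) \<subseteq> \<Omega>\<^sub>s"
    by metis
  have "\<forall>j. \<exists>\<psi> \<beta> A Z. singular_block (q j) (\<rho> j) (s j) \<psi> \<beta> A Z"
    using singular_block_exists[OF s \<rho>(1)] by blast
  then obtain \<psi> :: "nat \<Rightarrow> nat \<Rightarrow> 'a \<Rightarrow> real" and \<beta> :: "nat \<Rightarrow> nat \<Rightarrow> real" and A Z :: "nat \<Rightarrow> 'a set" where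
    block: "\<And>j. singular_block (q j) (\<rho> j) (s j) (\<psi> j) (\<beta> j) (A j) (Z j)"
    by metis
  note block = block[unfolded singular_block_def]
  have \<psi>: "Ck k (\<psi> j n)" "0 \<le> \<psi> j n x" "\<psi> j n x \<noteq> 0 \<Longrightarrow> x \<in> cball (q j) (\<rho> j)" for j k n x
    using block by blast+
  have \<beta>: "0 < \<beta> j n" "summable (\<beta> j)" for j n
    using block by blast+
  have le: "(LINT x|lebesgue. (\<psi> j n x)\<^sup>2) \<le> (\<beta> j n)\<^sup>2" "(LINT x|lebesgue. (laplacian (\<psi> j n) x)\<^sup>2) \<le> (\<beta> j n)\<^sup>2" for j n
    using block by blast+
  have A: "A j \<subseteq> cball (q j) (\<rho> j)" "ereal (s j) \<le> hausdorff_dim (A j)"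
    "a \<in> A j \<Longrightarrow> \<exists>C>0. \<exists>\<gamma>>0. \<exists>r>0. \<forall>x\<in>ball a r - {a}. \<exists>n. C * norm (x - a) powr (- \<gamma>) \<le> \<psi> j n x" for j a
    using block by blast+
  have Z: "hausdorff_measure (real ?N - 4) (Z j) = 0"
    "a \<notin> Z j \<Longrightarrow> \<exists>r>0. \<exists>m. \<forall>n\<ge>m. \<forall>x\<in>ball a r. \<psi> j n x = 0" for j a
    using block by blast+
  \<comment> \<open>The j-th block is scaled down to total weight \<open>(1 / 2) ^ j\<close>; a
    positive factor does not affect its singularities.\<close>
  define c where "c j = (1 / 2) ^ j / suminf (\<beta> j)" for j
  have suminf_\<beta>: "0 < suminf (\<beta> j)" for j
    by (rule suminf_pos[OF \<beta>(2,1)])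
  then have c: "0 < c j" for j by (simp add: c_def)
  define \<phi> where "\<phi> i x = (case prod_decode i of (j, n) \<Rightarrow> c j * \<psi> j n x)" for i x
  define \<omega> where "\<omega> i = (case prod_decode i of (j, n) \<Rightarrow> c j * \<beta> j n)" for i
  define u where "u x = (\<Sum>i. \<phi> i x)" for x
  have \<phi>_encode: "\<phi> (prod_encode (j, n)) x = c j * \<psi> j n x" for j n x by (simp add: \<phi>_def)
  have decode: "\<exists>j n. i = prod_encode (j, n)" for i by (metis prod_decode_inverse surj_pair)
  have \<phi>_nonneg: "0 \<le> \<phi> i x" for i x
    using decode[of i] c \<psi>(2) by (auto simp: \<phi>_encode less_imp_le)
  have \<omega>_pos: "0 < \<omega> i" for i
    using c \<beta>(1) by (simp add: \<omega>_def split: prod.split)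
  have "summable \<omega>"
    unfolding \<omega>_def
  proof (rule summable_prod_decode)
    show "0 \<le> c j * \<beta> j n" for j n using c[of j] \<beta>(1)[of j n] by simp
    show "summable (\<lambda>n. c j * \<beta> j n)" for j by (rule summable_mult[OF \<beta>(2)])
    show "(\<Sum>n. c j * \<beta> j n) \<le> (1 / 2) ^ j" for j
      using suminf_\<beta>[of j] by (subst suminf_mult[OF \<beta>(2)]) (simp add: c_def)
    show "summable (\<lambda>j. (1 / 2 :: real) ^ j)" by (rule summable_geometric) simp
  qed
  have test: "\<phi> i \<in> test_functions \<Omega>" for i
  proof -
    obtain j n where i: "i = prod_encode (j, n)" using decode by blast
    have eq: "\<phi> i = (\<lambda>x. c j * \<psi> j n x)" by (simp add: i \<phi>_encode fun_eq_iff)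
    show ?thesis
      unfolding eq
    proof (rule test_functionsI[OF _ compact_cball])
      show "Ck k (\<lambda>x. c j * \<psi> j n x)" for k by (rule Ck_cmult[OF \<psi>(1)])
      show "{x. c j * \<psi> j n x \<noteq> 0} \<subseteq> cball (q j) (\<rho> j)" using \<psi>(3) by fastforce
      show "cball (q j) (\<rho> j) \<subseteq> \<Omega>" using \<rho>(3) \<Omega>s(2) by blast
    qed
  qed
  have le_\<omega>: "(LINT x|lebesgue. (\<phi> i x)\<^sup>2) \<le> (\<omega> i)\<^sup>2" "(LINT x|lebesgue. (laplacian (\<phi> i) x)\<^sup>2) \<le> (\<omega> i)\<^sup>2" for i
  proof -
    obtain j n where i: "i = prod_encode (j, n)" using decode by blast
    have eq: "\<phi> i = (\<lambda>x. c j * \<psi> j n x)" by (simp add: i \<phi>_encode fun_eq_iff)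
    have \<omega>: "\<omega> i = c j * \<beta> j n" by (simp add: i \<omega>_def)
    show "(LINT x|lebesgue. (\<phi> i x)\<^sup>2) \<le> (\<omega> i)\<^sup>2"
      unfolding eq \<omega> power_mult_distrib integral_mult_right_zero by (rule mult_left_mono[OF le(1)]) simp
    have "laplacian (\<phi> i) x = c j * laplacian (\<psi> j n) x" for x
      unfolding eq by (rule laplacian_cmult[OF \<psi>(1)])
    then have "(LINT x|lebesgue. (laplacian (\<phi> i) x)\<^sup>2) = (c j)\<^sup>2 * (LINT x|lebesgue. (laplacian (\<psi> j n) x)\<^sup>2)"
      by (simp only: power_mult_distrib integral_mult_right_zero)
    also have "\<dots> \<le> (c j)\<^sup>2 * (\<beta> j n)\<^sup>2" by (rule mult_left_mono[OF le(2)]) simp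
    finally show "(LINT x|lebesgue. (laplacian (\<phi> i) x)\<^sup>2) \<le> (\<omega> i)\<^sup>2"
      by (simp only: \<omega> power_mult_distrib)
  qed
  obtain F where F: "F \<in> L2_on \<Omega>" "weak_solution \<Omega> F u" "AE x in lebesgue_on \<Omega>. summable (\<lambda>i. \<phi> i x)"
    using weak_solution_series[OF \<Omega> test le_\<omega> \<omega>_pos \<open>summable \<omega>\<close>] unfolding u_def by blast
  have u0: "u x = 0" if x: "x \<notin> \<Omega>\<^sub>s" for x
  proof -
    have "\<phi> i x = 0" for i
    proof -
      obtain j n where i: "i = prod_encode (j, n)" using decode by blast
      have "x \<notin> cball (q j) (\<rho> j)" using \<rho>(3) x by blast
      then show ?thesis using \<psi>(3)[of j n x] by (auto simp: i \<phi>_encode)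
    qed
    then show ?thesis by (simp add: u_def)
  qed
  have lower: "A j \<subseteq> singular_set (U \<inter> \<Omega>) (\<lambda>x. ereal (u x))" if U: "open U" "cball (q j) (\<rho> j) \<subseteq> U" for U j
  proof
    fix a assume a: "a \<in> A j"
    obtain C \<gamma> r where C: "0 < C" "0 < \<gamma>" "0 < r" "\<And>x. x \<in> ball a r - {a} \<Longrightarrow> \<exists>n. C * norm (x - a) powr (- \<gamma>) \<le> \<psi> j n x"
      using A(3)[OF a] by blast
    have aU: "a \<in> U \<inter> \<Omega>" using a A(1) U(2) \<rho>(3) \<Omega>s(2) by blast
    then obtain r' where r': "0 < r'" "ball a r' \<subseteq> U \<inter> \<Omega>"
      using open_Int[OF U(1) \<Omega>] openE by blast
    let ?r = "min r r'"
    have ball: "ball a ?r \<subseteq> ball a r" "ball a ?r \<subseteq> U \<inter> \<Omega>"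
      using r'(2) by auto
    \<comment> \<open>A single term bounds \<open>suminf\<close> from below only where the series
      converges.\<close>
    have "AE x in lebesgue. x \<in> \<Omega> \<longrightarrow> summable (\<lambda>i. \<phi> i x)"
      using F(3) \<Omega> by (subst AE_restrict_space_iff[symmetric]) auto
    then have "AE x in lebesgue. x \<in> ball a ?r \<longrightarrow> ereal (c j * C * norm (x - a) powr (- \<gamma>)) \<le> ereal (u x)"
    proof eventually_elim
      case (elim x)
      show ?case
      proof
        assume x: "x \<in> ball a ?r"
        then have sum: "summable (\<lambda>i. \<phi> i x)" using elim ball(2) by blast
        show "ereal (c j * C * norm (x - a) powr (- \<gamma>)) \<le> ereal (u x)"
        proof (cases "x = a")
          case True
          \<comment> \<open>At the centre the required lower bound is 0, by the value of
            \<open>0 powr (- \<gamma>)\<close>.\<close>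
          have "0 \<le> u x" unfolding u_def by (rule suminf_nonneg[OF sum \<phi>_nonneg])
          then show ?thesis using True by simp
        next
          case False
          then obtain n where n: "C * norm (x - a) powr (- \<gamma>) \<le> \<psi> j n x" using C(4) x ball(1) by blast
          have "c j * (C * norm (x - a) powr (- \<gamma>)) \<le> c j * \<psi> j n x"
            using n c[of j] by (intro mult_left_mono) auto
          also have "\<dots> = \<phi> (prod_encode (j, n)) x" by (rule \<phi>_encode[symmetric])
          also have "\<dots> \<le> u x"
            unfolding u_def using sum_le_suminf[OF sum, of "{prod_encode (j, n)}"] \<phi>_nonneg by simp
          finally show ?thesis by (simp add: mult.assoc)
        qed
      qed
    qed
    then have "AE x in lebesgue_on (ball a ?r). ereal (c j * C * norm (x - a) powr (- \<gamma>)) \<le> ereal (u x)"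
      by (subst AE_restrict_space_iff) auto
    moreover have "0 < c j * C" using c[of j] C(1) by simp
    moreover have "0 < ?r" using C(3) r'(1) by simp
    ultimately show "a \<in> singular_set (U \<inter> \<Omega>) (\<lambda>x. ereal (u x))"
      unfolding singular_set_def using aU ball(2) C(2) by blast
  qed
  \<comment> \<open>Outside this limsup set, the separation hypothesis of
    \<open>ball_minus_tiny_balls_positive\<close> holds from some index on.\<close>
  define L where "L = {x. \<forall>J. \<exists>j\<ge>J. dist (q j) x < 2 ^ (j + 3) * \<rho> j}"
  have upper: "singular_set \<Omega> (\<lambda>x. ereal (u x)) \<subseteq> (\<Union>j. Z j) \<union> L"
  proof (rule subsetI, rule ccontr)
    fix a assume a: "a \<in> singular_set \<Omega> (\<lambda>x. ereal (u x))" and not: "a \<notin> (\<Union>j. Z j) \<union> L"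
    obtain C \<gamma> r where C: "0 < C" "0 < \<gamma>" "0 < r" "ball a r \<subseteq> \<Omega>"
        "AE x in lebesgue_on (ball a r). ereal (C * norm (x - a) powr (- \<gamma>)) \<le> ereal (u x)"
      using a by (auto simp: singular_set_def)
    obtain J where J: "\<And>j. J \<le> j \<Longrightarrow> 2 ^ (j + 3) * \<rho> j \<le> dist (q j) a"
      using not by (auto simp: L_def not_less)
    have "\<forall>j. \<exists>r m. 0 < r \<and> (\<forall>n\<ge>m. \<forall>x\<in>ball a r. \<psi> j n x = 0)"
      using Z(2)[of a] not by (metis UN_I UNIV_I UnI1)
    then obtain R m where R: "\<And>j. 0 < R j" "\<And>j n x. m j \<le> n \<Longrightarrow> x \<in> ball a (R j) \<Longrightarrow> \<psi> j n x = 0"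
      by metis
    \<comment> \<open>The minimum over the first \<open>J\<close> blocks; the extra element 1 covers
      \<open>J = 0\<close> and keeps the ball inside \<open>cball a 1\<close>, where
      \<open>P\<close> is bounded.\<close>
    define R0 where "R0 = Min (insert 1 (R ` {..<J}))"
    have R0: "0 < R0" "R0 \<le> 1" "\<And>j. j < J \<Longrightarrow> R0 \<le> R j"
      using R(1) by (auto simp: R0_def)
    \<comment> \<open>The finitely many terms that can be nonzero near \<open>a\<close> outside the
      remaining small balls.\<close>
    define I where "I = prod_encode ` (SIGMA j:{..<J}. {..<m j})"
    have finI: "finite I" by (simp add: I_def)
    define P where "P x = (\<Sum>i\<in>I. \<phi> i x)" for x
    have "continuous_on (cball a 1) P"
      unfolding P_def by (intro continuous_intros continuous_on_subset[OF test_functionsD(6)[OF test]]) auto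
    then have "compact (P ` cball a 1)" by (intro compact_continuous_image compact_cball)
    then obtain M where M: "0 < M" "\<And>x. x \<in> cball a 1 \<Longrightarrow> P x \<le> M"
      by (force dest!: compact_imp_bounded simp: bounded_pos)
    define T where "T = (\<Union>j\<in>{J..}. cball (q j) (\<rho> j))"
    have uP: "u x = P x" if x: "x \<in> ball a R0" "x \<notin> T" for x
      unfolding u_def P_def
    proof (rule suminf_finite[OF finI])
      fix i assume i: "i \<notin> I"
      obtain j n where ij: "i = prod_encode (j, n)" using decode by blast
      have "\<psi> j n x = 0"
      proof (cases "J \<le> j")
        case True
        then have "x \<notin> cball (q j) (\<rho> j)" using x(2) by (auto simp: T_def)
        then show ?thesis using \<psi>(3) by blast
      next
        case False
        then have "m j \<le> n" using i by (force simp: I_def ij)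
        moreover have "x \<in> ball a (R j)" using x(1) R0(3)[of j] False by auto
        ultimately show ?thesis by (rule R(2))
      qed
      then show "\<phi> i x = 0" by (simp add: ij \<phi>_encode)
    qed
    \<comment> \<open>Below the distance \<open>(C / M) powr (1 / \<gamma>)\<close> the supposed
      lower bound exceeds the bound \<open>M\<close> for \<open>P\<close>.\<close>
    define \<sigma> where "\<sigma> = min (min r R0) ((C / M) powr (1 / \<gamma>))"
    have \<sigma>: "0 < \<sigma>" using C M(1) R0(1) by (simp add: \<sigma>_def)
    have "emeasure lborel (ball a \<sigma> - T - {a}) \<noteq> 0"
      unfolding T_def by (rule ball_minus_tiny_balls_positive[OF \<rho>(1) J \<sigma>])
    moreover have "T \<in> sets borel" by (auto simp: T_def)
    moreover have "ball a \<sigma> \<subseteq> ball a r" by (rule subset_ball) (simp add: \<sigma>_def)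
    ultimately have "\<exists>x\<in>ball a \<sigma> - T - {a}. ereal (C * norm (x - a) powr (- \<gamma>)) \<le> ereal (u x)"
      by (intro AE_lebesgue_on_ex[OF open_ball C(5)]) auto
    then obtain x where "x \<in> ball a \<sigma> - T - {a}" "ereal (C * norm (x - a) powr (- \<gamma>)) \<le> ereal (u x)" by blast
    then have x: "x \<in> ball a \<sigma>" "x \<notin> T" "x \<noteq> a" "C * norm (x - a) powr (- \<gamma>) \<le> u x" by simp_all
    have xn: "0 < norm (x - a)" "norm (x - a) < (C / M) powr (1 / \<gamma>)" "x \<in> ball a R0"
      using x(1,3) by (auto simp: \<sigma>_def dist_norm norm_minus_commute)
    have "norm (x - a) powr \<gamma> < ((C / M) powr (1 / \<gamma>)) powr \<gamma>"
      using xn C(2) by (intro powr_less_mono2) auto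
    also have "\<dots> = C / M" using C M(1) by (simp add: powr_powr)
    finally have "M * norm (x - a) powr \<gamma> < C" using M(1) by (simp add: field_simps)
    then have "M < C * norm (x - a) powr (- \<gamma>)"
      using xn(1) by (simp add: powr_minus field_simps)
    also have "\<dots> \<le> P x" using x(4) uP[OF xn(3) x(2)] by simp
    also have "\<dots> \<le> M" using xn(3) R0(2) by (intro M(2)) auto
    finally show False by simp
  qed
  \<comment> \<open>Here N >= 5 enters the upper bound: the limsup argument works for exponents at
    least 1.\<close>
  have t: "1 \<le> real ?N - 4" using dim by simp
  have "hausdorff_measure (real ?N - 4) L = 0"
  proof (rule hausdorff_measure_eq_0_limsup[OF t, where B = "\<lambda>j. ball (q j) (2 ^ (j + 3) * \<rho> j)"])
    show "L \<subseteq> (\<Union>j\<in>{J..}. ball (q j) (2 ^ (j + 3) * \<rho> j))" for J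
      by (fastforce simp: L_def)
    show "diameter (ball (q j) (2 ^ (j + 3) * \<rho> j)) \<le> (1 / 2) ^ j" for j
    proof -
      have "\<not> 2 ^ (j + 3) * \<rho> j < 0" using \<rho>(1)[of j] by (simp add: not_less less_imp_le)
      then have "diameter (ball (q j) (2 ^ (j + 3) * \<rho> j)) = 2 * (2 ^ (j + 3) * \<rho> j)"
        unfolding diameter_ball by (rule if_not_P)
      also have "\<dots> = 2 ^ (j + 4) * \<rho> j" by (simp add: power_add)
      also have "\<dots> \<le> (1 / 2) ^ j" using \<rho>(2)[of j] by (simp add: field_simps)
      finally show ?thesis .
    qed
  qed simp
  moreover have "hausdorff_measure (real ?N - 4) (\<Union>j. Z j) = 0"
    using t by (intro hausdorff_measure_UN_eq_0 Z(1)) simp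
  ultimately have "hausdorff_measure (real ?N - 4) ((\<Union>j. Z j) \<union> L) = 0"
    using t by (intro hausdorff_measure_Un_eq_0) auto
  then have dim_upper: "hausdorff_dim ((\<Union>j. Z j) \<union> L) \<le> ereal (real ?N - 4)"
    using t by (intro hausdorff_dim_le) auto
  have "singular_dim \<Omega> (\<lambda>x. ereal (u x)) a = ereal (real ?N - 4)" if a: "a \<in> closure \<Omega>\<^sub>s" for a
  proof (rule singular_dim_eqI[of 1])
    fix r :: real assume r: "0 < r"
    let ?S = "singular_set (ball a r \<inter> \<Omega>) (\<lambda>x. ereal (u x))"
    have "?S \<subseteq> (\<Union>j. Z j) \<union> L"
      using upper singular_set_mono[of "ball a r \<inter> \<Omega>" \<Omega>] by blast
    then have "hausdorff_dim ?S \<le> ereal (real ?N - 4)"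
      by (rule order_trans[OF hausdorff_dim_mono dim_upper])
    \<comment> \<open>The blocks only have dimension bounds \<open>s j\<close> below N - 4, so the
      bound is reached up to an arbitrary error.\<close>
    moreover have "ereal (real ?N - 4) \<le> hausdorff_dim ?S"
    proof (rule ereal_le_epsilon2)
      fix e :: real assume e: "0 < e"
      obtain y where "y \<in> \<Omega>\<^sub>s" "dist y a < r / 2"
        using a r closure_approachable[of a \<Omega>\<^sub>s] half_gt_zero by blast
      then have "ball a (r / 2) \<inter> \<Omega>\<^sub>s \<noteq> {}" by (auto simp: dist_commute)
      then obtain i where i: "p i \<in> ball a (r / 2)" using p_dense[OF open_ball] by blast
      obtain m1 where m1: "1 / real (Suc m1) < e" using e nat_approx_posE by blast
      obtain m2 where m2: "(1 / 2) ^ m2 < r / 2" using real_arch_pow_inv[of "r / 2" "1 / 2"] r by auto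
      \<comment> \<open>A single large precision index serves twice: it brings \<open>s j\<close>
        close to N - 4 and, since \<open>prod_encode (i, m)\<close> is at least m, makes the ball of
        the block small enough to fit.\<close>
      define m where "m = max m1 m2"
      define j where "j = prod_encode (i, m)"
      have qj: "q j = p i" and sj: "s j = real ?N - 4 - 1 / (real m + 2)" by (simp_all add: q_def s_def j_def)
      have "1 / (real m + 2) \<le> 1 / real (Suc m1)" unfolding m_def by (intro divide_left_mono) auto
      then have s_ge: "real ?N - 4 \<le> s j + e" using m1 unfolding sj by linarith
      have "m2 \<le> j" using le_prod_encode_2[of m i] by (simp add: j_def m_def)
      have "\<rho> j \<le> (1 / 2) ^ j / 1"
        by (rule order_trans[OF \<rho>(2)]) (intro divide_left_mono one_le_power, auto)
      also have "\<dots> \<le> (1 / 2) ^ m2" using \<open>m2 \<le> j\<close> by (simp add: power_decreasing)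
      finally have "\<rho> j < r / 2" using m2 by linarith
      have "cball (q j) (\<rho> j) \<subseteq> ball a r"
      proof
        fix x assume "x \<in> cball (q j) (\<rho> j)"
        then have "dist a x < r / 2 + r / 2"
          using i \<open>\<rho> j < r / 2\<close> dist_triangle[of a x "p i"] unfolding qj mem_cball mem_ball by linarith
        then show "x \<in> ball a r" by simp
      qed
      from hausdorff_dim_mono[OF lower[OF open_ball this]]
      have "ereal (s j) \<le> hausdorff_dim ?S" by (rule order_trans[OF A(2)])
      then have "ereal (s j) + ereal e \<le> hausdorff_dim ?S + ereal e" by (rule add_right_mono)
      moreover have "ereal (real ?N - 4) \<le> ereal (s j) + ereal e" using s_ge by simp
      ultimately show "ereal (real ?N - 4) \<le> hausdorff_dim ?S + ereal e" by order
    qed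
    ultimately show "hausdorff_dim ?S = ereal (real ?N - 4)" by (rule antisym)
  qed simp
  with F(1,2) u0 show ?thesis by (rule that)
qed

text \<open>Covers an empty singular region, which has no dense sequence of points; the zero series
  is a special case of the general construction.\<close>

lemma zero_weak_solution:
  fixes \<Omega> :: "'a::euclidean_space set"
  assumes "open \<Omega>"
  obtains F where "F \<in> L2_on \<Omega>" "weak_solution \<Omega> F (\<lambda>x. 0)"
proof -
  have "laplacian (\<lambda>x::'a. 0) x = 0" for x
    by (simp add: frechet_derivative_const)
  then show ?thesis
    using weak_solution_series[OF assms test_functions_0, of "\<lambda>n. (1 / 2) ^ n"] that
    by (auto simp: summable_geometric)
qed

theorem theorem4:
  fixes \<Omega> \<Omega>\<^sub>r \<Omega>\<^sub>s :: "(real ^ 'n) set"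
  assumes "CARD('n) \<ge> 5"
    and "open \<Omega>" "bounded \<Omega>" "of_class_Ck 2 \<Omega>"
    and "open \<Omega>\<^sub>r" "\<Omega>\<^sub>r \<subseteq> \<Omega>" "open \<Omega>\<^sub>s" "\<Omega>\<^sub>s \<subseteq> \<Omega>" "\<Omega>\<^sub>r \<inter> \<Omega>\<^sub>s = {}"
    and "closure \<Omega> = closure \<Omega>\<^sub>r \<union> closure \<Omega>\<^sub>s"
  shows "\<exists>F\<in>L2_on \<Omega>. (\<exists>u. weak_solution \<Omega> F u) \<and>
    (\<forall>u. weak_solution \<Omega> F u \<longrightarrow>
       (\<forall>a\<in>\<Omega>\<^sub>r. singular_dim \<Omega> (\<lambda>x. ereal (u x)) a = 0) \<and>
       (\<forall>a\<in>closure \<Omega>\<^sub>s. singular_dim \<Omega> (\<lambda>x. ereal (u x)) a = ereal (real CARD('n) - 4)))"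
proof -
  have "\<exists>F u. F \<in> L2_on \<Omega> \<and> weak_solution \<Omega> F u \<and> (\<forall>x. x \<notin> \<Omega>\<^sub>s \<longrightarrow> u x = 0) \<and>
      (\<forall>a\<in>closure \<Omega>\<^sub>s. singular_dim \<Omega> (\<lambda>x. ereal (u x)) a = ereal (real CARD('n) - 4))"
  proof (cases "\<Omega>\<^sub>s = {}")
    case True
    then show ?thesis using zero_weak_solution[OF assms(2)] by (metis closure_empty empty_iff)
  next
    case False
    have "5 \<le> DIM(real ^ 'n)" using assms(1) by simp
    from singular_sum_exists[OF this assms(2,7,8) False] show ?thesis by (metis DIM_cart DIM_real mult_1_right)
  qed
  then obtain F u where F: "F \<in> L2_on \<Omega>" "weak_solution \<Omega> F u" "\<And>x. x \<notin> \<Omega>\<^sub>s \<Longrightarrow> u x = 0"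
      "\<And>a. a \<in> closure \<Omega>\<^sub>s \<Longrightarrow> singular_dim \<Omega> (\<lambda>x. ereal (u x)) a = ereal (real CARD('n) - 4)"
    by blast
  have r: "singular_dim \<Omega> (\<lambda>x. ereal (u x)) a = 0" if "a \<in> \<Omega>\<^sub>r" for a
  proof (rule singular_dim_eq_0[OF assms(5,6) that])
    fix x assume "x \<in> \<Omega>\<^sub>r"
    then have "x \<notin> \<Omega>\<^sub>s" using assms(9) by blast
    then show "u x = 0" by (rule F(3))
  qed
  \<comment> \<open>By uniqueness every weak solution is almost everywhere equal to the constructed
    one and has the same singular dimension at each point.\<close>
  have "singular_dim \<Omega> (\<lambda>x. ereal (v x)) a = singular_dim \<Omega> (\<lambda>x. ereal (u x)) a" if "weak_solution \<Omega> F v" for v a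
    by (rule singular_dim_AE_cong[OF assms(2) weak_solution_unique[OF assms(2,3) that F(2)]])
  then have "weak_solution \<Omega> F v \<longrightarrow> (\<forall>a\<in>\<Omega>\<^sub>r. singular_dim \<Omega> (\<lambda>x. ereal (v x)) a = 0) \<and>
      (\<forall>a\<in>closure \<Omega>\<^sub>s. singular_dim \<Omega> (\<lambda>x. ereal (v x)) a = ereal (real CARD('n) - 4))" for v
    using r F(4) by simp
  with F(1,2) show ?thesis by blast
qed

end
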